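(* Let $(X,\omega)$ be a compact K\"ahler manifold of complex dimension $3$ and let $L$ be a holomorphic line bundle on $X$. Suppose there is a smooth closed real $(1,1)$-form $\alpha$ representing $c_1(L)$ such that $\Theta_\omega(\alpha)=\theta$ on $X$ for a constant $\theta\in\left(\frac{\pi}{2},\frac{3\pi}{2}\right)$. Then the Chern number inequality $$\left(\int_X\omega^3\right)\left(\int_X ch_3(L)\right)<3\left(\int_X ch_2(L)\wedge\omega\right)\left(\int_X ch_1(L)\wedge\omega^2\right)$$ holds, and consequently $$\gamma(t):=-\int_X e^{-t\sqrt{-1}\,\omega}\,ch(L)\neq 0\qquad\text{for all } t\in[1,\infty).$$
   Context: For a smooth real $(1,1)$-form $\alpha$ on a K\"ahler manifold $(X,\omega)$ of complex dimension $n$, let $\lambda_1,\dots,\lambda_n$ denote, at each point, the (real) eigenvalues of the relative endomorphism $\omega^{-1}\alpha$; that is, in holomorphic coordinates centered at $p$ with $\omega(p)=\frac{\sqrt{-1}}{2}\sum_i dz_i\wedge d\bar z_i$ and $\alpha(p)=\frac{\sqrt{-1}}{2}\sum_i\lambda_i\,dz_i\wedge d\bar z_i$. Define the real-valued function $\Theta_\omega(\alpha)=\sum_{i=1}^n\arctan(\lambda_i)$, where $\arctan$ takes values in $(-\frac{\pi}{2},\frac{\pi}{2})$. The equation $\Theta_\omega(\alpha)=\theta$ with $\theta$ constant is the deformed Hermitian-Yang-Mills equation. For a line bundle $L$, $ch(L)=e^{c_1(L)}$ and $ch_k(L)=c_1(L)^k/k!$, viewed in $H^{2k}(X,\mathbb{R})$.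 In the integral defining $\gamma(t)$, the exponential is expanded as a power series of forms and only the component of top degree $6$ is integrated, so that $$\gamma(t)=\int_X\left(\frac{t^2 c_1(L)\wedge\omega^2}{2}-\frac{c_1(L)^3}{6}\right)+\sqrt{-1}\int_X\left(\frac{t\,c_1(L)^2\wedge\omega}{2}-\frac{t^3\omega^3}{6}\right).$$ *)

theory Defs
  imports
    "HOL-Analysis.Analysis"
    "HOL-Combinatorics.Permutations"
    "HOL-Computational_Algebra.Polynomial"
begin

section \<open>Smooth and holomorphic functions on open subsets of $\mathbb{C}^n$\<close>

primrec C_k_on :: "nat \<Rightarrow> 'v::real_normed_vector set \<Rightarrow> ('v \<Rightarrow> 'w::real_normed_vector) \<Rightarrow> bool" where
  "C_k_on 0 S f \<longleftrightarrow> continuous_on S f"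
| "C_k_on (Suc k) S f \<longleftrightarrow>
     (\<forall>x\<in>S. f differentiable (at x)) \<and> (\<forall>v. C_k_on k S (\<lambda>x. frechet_derivative f (at x) v))"

definition smooth_on :: "'v::real_normed_vector set \<Rightarrow> ('v \<Rightarrow> 'w::real_normed_vector) \<Rightarrow> bool" where
  "smooth_on S f \<longleftrightarrow> (\<forall>k. C_k_on k S f)"

text \<open>Holomorphic in several variables: smooth, with complex-linear differential
  (that is, $\bar\partial f = 0$).\<close>

definition holo_on :: "(complex^'n) set \<Rightarrow> (complex^'n \<Rightarrow> complex) \<Rightarrow> bool" where
  "holo_on S f \<longleftrightarrow> smooth_on S f \<and>
     (\<forall>x\<in>S. \<forall>v. frechet_derivative f (at x) (\<i> *s v) = \<i> * frechet_derivative f (at x) v)"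

definition d_dz :: "'n::finite \<Rightarrow> (complex^'n \<Rightarrow> complex) \<Rightarrow> complex^'n \<Rightarrow> complex" where
  "d_dz j f x = (frechet_derivative f (at x) (axis j 1) - \<i> * frechet_derivative f (at x) (axis j \<i>)) / 2"

definition d_dzbar :: "'n::finite \<Rightarrow> (complex^'n \<Rightarrow> complex) \<Rightarrow> complex^'n \<Rightarrow> complex" where
  "d_dzbar j f x = (frechet_derivative f (at x) (axis j 1) + \<i> * frechet_derivative f (at x) (axis j \<i>)) / 2"

section \<open>Complex manifolds\<close>

text \<open>The underlying space of the manifold is a whole type; a chart is its domain together with
  its coordinate map, whose values outside the domain are irrelevant.\<close>

type_synonym ('a, 'n) chart = "'a set \<times> ('a \<Rightarrow> (complex, 'n) vec)"

definition cdom :: "('a, 'n::finite) chart \<Rightarrow> 'a set" where "cdom c = fst c"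
definition cmap :: "('a, 'n::finite) chart \<Rightarrow> 'a \<Rightarrow> complex^'n" where "cmap c = snd c"
definition cran :: "('a, 'n::finite) chart \<Rightarrow> (complex^'n) set" where "cran c = cmap c ` cdom c"
definition cinv :: "('a, 'n::finite) chart \<Rightarrow> complex^'n \<Rightarrow> 'a" where "cinv c = inv_into (cdom c) (cmap c)"

definition complex_atlas :: "('a::topological_space, 'n::finite) chart set \<Rightarrow> bool" where
  "complex_atlas M \<longleftrightarrow>
     (\<Union>c\<in>M. cdom c) = UNIV \<and>
     (\<forall>c\<in>M. open (cdom c) \<and> open (cran c) \<and> homeomorphism (cdom c) (cran c) (cmap c) (cinv c)) \<and>
     (\<forall>c\<in>M. \<forall>c'\<in>M. \<forall>j. holo_on (cmap c ` (cdom c \<inter> cdom c')) (\<lambda>x. cmap c' (cinv c x) $ j))"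

definition smooth_fun_on ::
    "('a, 'n::finite) chart set \<Rightarrow> 'a set \<Rightarrow> ('a \<Rightarrow> real) \<Rightarrow> bool" where
  "smooth_fun_on M W f \<longleftrightarrow> (\<forall>c\<in>M. smooth_on (cmap c ` (cdom c \<inter> W)) (\<lambda>x. f (cinv c x)))"

definition holo_fun_on ::
    "('a, 'n::finite) chart set \<Rightarrow> 'a set \<Rightarrow> ('a \<Rightarrow> complex) \<Rightarrow> bool" where
  "holo_fun_on M W f \<longleftrightarrow> (\<forall>c\<in>M. holo_on (cmap c ` (cdom c \<inter> W)) (\<lambda>x. f (cinv c x)))"

section \<open>Differential forms\<close>

text \<open>A real \<open>k\<close>-covector is an alternating function on lists of \<open>k\<close> tangent vectors (its values on
  lists of other lengths are irrelevant). A differential form is the family of its coordinate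
  expressions \<open>\<eta> c x\<close>, for charts \<open>c\<close> of the atlas and \<open>x \<in> cran c\<close>, compatible under pullback by
  the transition maps.\<close>

type_synonym 'n covec = "(complex, 'n) vec list \<Rightarrow> real"
type_synonym ('a, 'n) form = "('a, 'n) chart \<Rightarrow> (complex, 'n) vec \<Rightarrow> 'n covec"

definition alternating :: "nat \<Rightarrow> ('n::finite) covec \<Rightarrow> bool" where
  "alternating k f \<longleftrightarrow>
     (\<forall>vs. length vs = k \<longrightarrow>
        (\<forall>i<k. linear (\<lambda>v. f (vs[i := v]))) \<and>
        (\<forall>i<k. \<forall>j<k. i \<noteq> j \<and> vs ! i = vs ! j \<longrightarrow> f vs = 0))"

definition smooth_form :: "('a, 'n::finite) chart set \<Rightarrow> nat \<Rightarrow> ('a, 'n) form \<Rightarrow> bool" where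
  "smooth_form M k \<eta> \<longleftrightarrow>
     (\<forall>c\<in>M. (\<forall>x\<in>cran c. alternating k (\<eta> c x)) \<and>
             (\<forall>vs. length vs = k \<longrightarrow> smooth_on (cran c) (\<lambda>x. \<eta> c x vs))) \<and>
     (\<forall>c\<in>M. \<forall>c'\<in>M. \<forall>p\<in>cdom c \<inter> cdom c'. \<forall>vs. length vs = k \<longrightarrow>
        \<eta> c (cmap c p) vs =
        \<eta> c' (cmap c' p) (map (frechet_derivative (\<lambda>x. cmap c' (cinv c x)) (at (cmap c p))) vs))"

definition form_eq ::
    "('a, 'n::finite) chart set \<Rightarrow> nat \<Rightarrow> ('a, 'n) form \<Rightarrow> ('a, 'n) form \<Rightarrow> bool" where
  "form_eq M k \<alpha> \<beta> \<longleftrightarrow>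
     (\<forall>c\<in>M. \<forall>x\<in>cran c. \<forall>vs. length vs = k \<longrightarrow> \<alpha> c x vs = \<beta> c x vs)"

definition form_zero :: "('a, 'n::finite) form" where
  "form_zero = (\<lambda>c x vs. 0)"

definition form_one :: "('a, 'n::finite) form" where
  "form_one = (\<lambda>c x vs. 1)"

definition form_diff :: "('a, 'n::finite) form \<Rightarrow> ('a, 'n) form \<Rightarrow> ('a, 'n) form" where
  "form_diff \<alpha> \<beta> = (\<lambda>c x vs. \<alpha> c x vs - \<beta> c x vs)"

definition form_scale :: "real \<Rightarrow> ('a, 'n::finite) form \<Rightarrow> ('a, 'n) form" where
  "form_scale r \<alpha> = (\<lambda>c x vs. r * \<alpha> c x vs)"

text \<open>Wedge product of a \<open>p\<close>-form and a \<open>q\<close>-form and exterior derivative, normalized so that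
  $(dx \wedge dy)(\partial_x,\partial_y) = 1$.\<close>

definition wedge :: "nat \<Rightarrow> nat \<Rightarrow> ('a, 'n::finite) form \<Rightarrow> ('a, 'n) form \<Rightarrow> ('a, 'n) form" where
  "wedge p q \<alpha> \<beta> = (\<lambda>c x vs.
     (\<Sum>\<sigma> | \<sigma> permutes {..<p + q}.
        real_of_int (sign \<sigma>) *
        \<alpha> c x (map (\<lambda>i. vs ! \<sigma> i) [0..<p]) * \<beta> c x (map (\<lambda>i. vs ! \<sigma> i) [p..<p + q]))
     / (fact p * fact q))"

definition ext_d :: "('a, 'n::finite) form \<Rightarrow> ('a, 'n) form" where
  "ext_d \<eta> = (\<lambda>c x vs. \<Sum>i<length vs.
     (- 1) ^ i * frechet_derivative (\<lambda>y. \<eta> c y (take i vs @ drop (Suc i) vs)) (at x) (vs ! i))"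

text \<open>\<open>form_power \<alpha> k\<close> is $\alpha^k$ for a 2-form $\alpha$.\<close>

primrec form_power :: "('a, 'n::finite) form \<Rightarrow> nat \<Rightarrow> ('a, 'n) form" where
  "form_power \<alpha> 0 = form_one"
| "form_power \<alpha> (Suc k) = wedge 2 (2 * k) \<alpha> (form_power \<alpha> k)"

definition closed_form :: "('a, 'n::finite) chart set \<Rightarrow> nat \<Rightarrow> ('a, 'n) form \<Rightarrow> bool" where
  "closed_form M k \<eta> \<longleftrightarrow> smooth_form M k \<eta> \<and> form_eq M (Suc k) (ext_d \<eta>) form_zero"

definition exact_form :: "('a, 'n::finite) chart set \<Rightarrow> nat \<Rightarrow> ('a, 'n) form \<Rightarrow> bool" where
  "exact_form M k \<eta> \<longleftrightarrow>
     (case k of 0 \<Rightarrow> form_eq M 0 \<eta> form_zero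
              | Suc j \<Rightarrow> \<exists>\<xi>. smooth_form M j \<xi> \<and> form_eq M k \<eta> (ext_d \<xi>))"

section \<open>Integration\<close>

text \<open>The tuple $(e_1, ie_1, \dots, e_n, ie_n)$, which is positively oriented for the complex
  orientation whatever enumeration of the index type is chosen.\<close>

definition oriented_basis :: "(complex^'n::finite) list" where
  "oriented_basis =
     concat (map (\<lambda>j. [axis j 1, axis j \<i>]) (SOME js. distinct js \<and> set js = UNIV))"

definition partition_of_unity ::
    "('a::topological_space, 'n::finite) chart set \<Rightarrow> ('a, 'n) chart set
     \<Rightarrow> (('a, 'n) chart \<Rightarrow> 'a \<Rightarrow> real) \<Rightarrow> bool" where
  "partition_of_unity M F \<rho> \<longleftrightarrow>
     finite F \<and> F \<subseteq> M \<and>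
     (\<forall>c\<in>F. smooth_fun_on M UNIV (\<rho> c) \<and> (\<forall>p. \<rho> c p \<ge> 0) \<and> closure {p. \<rho> c p \<noteq> 0} \<subseteq> cdom c) \<and>
     (\<forall>p. (\<Sum>c\<in>F. \<rho> c p) = 1)"

text \<open>Integral of a form of top degree \<open>2 * CARD('n)\<close> over a compact manifold, by means of
  a finite smooth partition of unity subordinate to the atlas (the value does not depend on its choice).\<close>

definition form_integral ::
    "('a::topological_space, 'n::finite) chart set \<Rightarrow> ('a, 'n) form \<Rightarrow> real" where
  "form_integral M \<eta> =
     (let (F, \<rho>) = SOME (F, \<rho>). partition_of_unity M F \<rho>
      in \<Sum>c\<in>F. integral (cran c) (\<lambda>x. \<rho> c (cinv c x) * \<eta> c x oriented_basis))"

section \<open>De Rham cohomology\<close>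

text \<open>A cohomology class is the set of all closed forms representing it.\<close>

definition dR_class ::
    "('a, 'n::finite) chart set \<Rightarrow> nat \<Rightarrow> ('a, 'n) form \<Rightarrow> ('a, 'n) form set" where
  "dR_class M k \<beta> = {\<beta>'. closed_form M k \<beta>' \<and> exact_form M k (form_diff \<beta>' \<beta>)}"

definition cup ::
    "('a, 'n::finite) chart set \<Rightarrow> nat \<Rightarrow> nat \<Rightarrow> ('a, 'n) form set \<Rightarrow> ('a, 'n) form set
     \<Rightarrow> ('a, 'n) form set" where
  "cup M p q A B = (\<Union>a\<in>A. \<Union>b\<in>B. dR_class M (p + q) (wedge p q a b))"

text \<open>All representatives of a class of top degree have the same integral, by Stokes' theorem.\<close>

definition class_integral ::
    "('a::topological_space, 'n::finite) chart set \<Rightarrow> ('a, 'n) form set \<Rightarrow> real" where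
  "class_integral M C = (THE r. r \<in> form_integral M ` C)"

section \<open>(1,1)-forms, Kaehler forms, and the function $\Theta_\omega$\<close>

definition dz_dzbar :: "'n::finite \<Rightarrow> 'n \<Rightarrow> complex^'n \<Rightarrow> complex^'n \<Rightarrow> complex" where
  "dz_dzbar j k v w = v $ j * cnj (w $ k) - w $ j * cnj (v $ k)"

text \<open>$\beta = \frac{\sqrt{-1}}{2}\sum_{j,k} A_{jk}\, dz_j \wedge d\bar z_k$\<close>

definition has_coeffs :: "('n::finite) covec \<Rightarrow> complex^'n^'n \<Rightarrow> bool" where
  "has_coeffs \<beta> A \<longleftrightarrow>
     (\<forall>v w. complex_of_real (\<beta> [v, w]) = \<i> / 2 * (\<Sum>j\<in>UNIV. \<Sum>k\<in>UNIV. A $ j $ k * dz_dzbar j k v w))"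

definition coeffs :: "('n::finite) covec \<Rightarrow> complex^'n^'n" where
  "coeffs \<beta> = (THE A. has_coeffs \<beta> A)"

definition type_11 :: "('a, 'n::finite) chart set \<Rightarrow> ('a, 'n) form \<Rightarrow> bool" where
  "type_11 M \<beta> \<longleftrightarrow> (\<forall>c\<in>M. \<forall>x\<in>cran c. \<exists>A. has_coeffs (\<beta> c x) A)"

definition kaehler_form :: "('a, 'n::finite) chart set \<Rightarrow> ('a, 'n) form \<Rightarrow> bool" where
  "kaehler_form M \<omega> \<longleftrightarrow>
     closed_form M 2 \<omega> \<and> type_11 M \<omega> \<and>
     (\<forall>c\<in>M. \<forall>x\<in>cran c. \<forall>v. v \<noteq> 0 \<longrightarrow> \<omega> c x [v, \<i> *s v] > 0)"

text \<open>The matrix of $\omega^{-1}\alpha$ on $T^{1,0}$: its $(i,j)$ entry is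
  $\sum_k g^{i\bar k} a_{j\bar k}$, where $\sum_k g^{i\bar k} g_{j\bar k} = \delta_{ij}$.\<close>

definition relative_endo :: "('n::finite) covec \<Rightarrow> 'n covec \<Rightarrow> complex^'n^'n" where
  "relative_endo \<omega> \<alpha> = matrix_inv (transpose (coeffs \<omega>)) ** transpose (coeffs \<alpha>)"

definition charpoly :: "complex^'n^'n \<Rightarrow> complex poly" where
  "charpoly E = det (\<chi> i j. (if i = j then [:0, 1:] else 0) - [:E $ i $ j:])"

definition eigenvalues :: "complex^'n^'n \<Rightarrow> complex multiset" where
  "eigenvalues E = proots (charpoly E)"

text \<open>The eigenvalues in question are real, so \<open>Re\<close> only changes their type.\<close>

definition Theta :: "('n::finite) covec \<Rightarrow> 'n covec \<Rightarrow> real" where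
  "Theta \<omega> \<alpha> = (\<Sum>l\<in>#eigenvalues (relative_endo \<omega> \<alpha>). arctan (Re l))"

section \<open>Holomorphic line bundles and Chern classes\<close>

text \<open>A line bundle is given by its projection \<open>pr\<close> from the total space \<open>'e\<close> and a family of
  trivializations \<open>(U, \<tau>)\<close>, where \<open>\<tau>\<close> is the fibre coordinate over \<open>U\<close>.\<close>

type_synonym ('e, 'a) trivialization = "'a set \<times> ('e \<Rightarrow> complex)"

definition holo_line_bundle ::
    "('a::topological_space, 'n::finite) chart set \<Rightarrow> ('e \<Rightarrow> 'a) \<Rightarrow> ('e, 'a) trivialization set
     \<Rightarrow> bool" where
  "holo_line_bundle M pr L \<longleftrightarrow>
     (\<Union>(U, \<tau>)\<in>L. U) = UNIV \<and>
     (\<forall>(U, \<tau>)\<in>L. open U \<and> bij_betw (\<lambda>e. (pr e, \<tau> e)) (pr -` U) (U \<times> UNIV)) \<and>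
     (\<forall>(U, \<tau>)\<in>L. \<forall>(V, \<sigma>)\<in>L. \<exists>g. holo_fun_on M (U \<inter> V) g \<and> (\<forall>p\<in>U \<inter> V. g p \<noteq> 0) \<and>
        (\<forall>e. pr e \<in> U \<inter> V \<longrightarrow> \<sigma> e = g (pr e) * \<tau> e))"

text \<open>The local holomorphic section on which the fibre coordinate is 1.\<close>

definition unit_section :: "('e \<Rightarrow> 'a) \<Rightarrow> ('e, 'a) trivialization \<Rightarrow> 'a \<Rightarrow> 'e" where
  "unit_section pr = (\<lambda>(U, \<tau>) p. inv_into (pr -` U) (\<lambda>e. (pr e, \<tau> e)) (p, 1))"

text \<open>A Hermitian metric is given by its squared norm \<open>h\<close>.\<close>

definition hermitian_metric ::
    "('a, 'n::finite) chart set \<Rightarrow> ('e \<Rightarrow> 'a) \<Rightarrow> ('e, 'a) trivialization set \<Rightarrow> ('e \<Rightarrow> real)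
     \<Rightarrow> bool" where
  "hermitian_metric M pr L h \<longleftrightarrow>
     (\<forall>(U, \<tau>)\<in>L. smooth_fun_on M U (\<lambda>p. h (unit_section pr (U, \<tau>) p)) \<and>
        (\<forall>p\<in>U. h (unit_section pr (U, \<tau>) p) > 0) \<and>
        (\<forall>e\<in>pr -` U. h e = h (unit_section pr (U, \<tau>) (pr e)) * (cmod (\<tau> e))\<^sup>2))"

text \<open>\<open>F\<close> is the first Chern form of the Chern connection of \<open>h\<close>, locally
  $-\frac{\sqrt{-1}}{2\pi}\partial\bar\partial\log h(s)$ with $s$ the unit section.\<close>

definition chern_form ::
    "('a, 'n::finite) chart set \<Rightarrow> ('e \<Rightarrow> 'a) \<Rightarrow> ('e, 'a) trivialization set \<Rightarrow> ('e \<Rightarrow> real)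
     \<Rightarrow> ('a, 'n) form \<Rightarrow> bool" where
  "chern_form M pr L h F \<longleftrightarrow>
     smooth_form M 2 F \<and>
     (\<forall>(U, \<tau>)\<in>L. \<forall>c\<in>M. \<forall>x\<in>cmap c ` (cdom c \<inter> U). \<forall>v w.
        complex_of_real (F c x [v, w]) =
        - (\<i> / (2 * of_real pi)) *
          (\<Sum>j\<in>UNIV. \<Sum>k\<in>UNIV.
             d_dz j (d_dzbar k (\<lambda>y. complex_of_real (ln (h (unit_section pr (U, \<tau>) (cinv c y)))))) x
             * dz_dzbar j k v w))"

text \<open>The de Rham class of the Chern form of any Hermitian metric; it does not depend on the
  metric.\<close>

definition c1 ::
    "('a, 'n::finite) chart set \<Rightarrow> ('e \<Rightarrow> 'a) \<Rightarrow> ('e, 'a) trivialization set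
     \<Rightarrow> ('a, 'n) form set" where
  "c1 M pr L = (\<Union>h\<in>{h. hermitian_metric M pr L h}. \<Union>F\<in>{F. chern_form M pr L h F}. dR_class M 2 F)"

definition ch ::
    "('a, 'n::finite) chart set \<Rightarrow> ('e \<Rightarrow> 'a) \<Rightarrow> ('e, 'a) trivialization set \<Rightarrow> nat
     \<Rightarrow> ('a, 'n) form set" where
  "ch M pr L k = (\<Union>\<beta>\<in>c1 M pr L. dR_class M (2 * k) (form_scale (1 / fact k) (form_power \<beta> k)))"

text \<open>$\int_X ch_k(L) \wedge \omega^{n-k}$\<close>

definition ch_number ::
    "('a::topological_space, 'n::finite) chart set \<Rightarrow> ('a, 'n) form \<Rightarrow> ('e \<Rightarrow> 'a)
     \<Rightarrow> ('e, 'a) trivialization set \<Rightarrow> nat \<Rightarrow> real" where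
  "ch_number M \<omega> pr L k =
     (let m = CARD('n) - k
      in class_integral M (cup M (2 * k) (2 * m) (ch M pr L k) (dR_class M (2 * m) (form_power \<omega> m))))"

text \<open>$\gamma(t) = -\int_X e^{-t\sqrt{-1}\omega}\, ch(L)$. The part of the integrand in top degree
  is $\sum_{k \le n} \frac{(-t\sqrt{-1})^{n-k}}{(n-k)!}\, ch_k(L) \wedge \omega^{n-k}$.\<close>

definition gamma_curve ::
    "('a::topological_space, 'n::finite) chart set \<Rightarrow> ('a, 'n) form \<Rightarrow> ('e \<Rightarrow> 'a)
     \<Rightarrow> ('e, 'a) trivialization set \<Rightarrow> real \<Rightarrow> complex" where
  "gamma_curve M \<omega> pr L t =
     - (\<Sum>k\<le>CARD('n). (- (of_real t * \<i>)) ^ (CARD('n) - k) / fact (CARD('n) - k)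
                         * of_real (ch_number M \<omega> pr L k))"

end

theory Submission
  imports Defs "HOL-Computational_Algebra.Fundamental_Theorem_Algebra"
begin

text \<open>At each point let \<open>\<lambda>\<^sub>1, \<lambda>\<^sub>2, \<lambda>\<^sub>3\<close> be the relative eigenvalues of \<open>\<alpha>\<close>, with elementary symmetric
  functions \<open>\<sigma>\<^sub>1, \<sigma>\<^sub>2, \<sigma>\<^sub>3\<close>. The product of the \<open>1 + \<i> \<lambda>\<^sub>j\<close> is a positive multiple of \<open>exp (\<i> \<theta>)\<close>, hence
  \<open>(\<sigma>\<^sub>1 - \<sigma>\<^sub>3) cos \<theta> = (1 - \<sigma>\<^sub>2) sin \<theta>\<close> and, because \<open>cos \<theta> < 0\<close>, also \<open>\<sigma>\<^sub>2 > 1\<close>. As \<open>\<theta> > pi / 2\<close>, any two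
  of the angles have positive sum, so \<open>\<sigma>\<^sub>1 \<sigma>\<^sub>2 - \<sigma>\<^sub>3 = (\<lambda>\<^sub>1 + \<lambda>\<^sub>2) (\<lambda>\<^sub>1 + \<lambda>\<^sub>3) (\<lambda>\<^sub>2 + \<lambda>\<^sub>3) > 0\<close>, which
  amounts to \<open>\<sigma>\<^sub>1 cos \<theta> < sin \<theta>\<close>. These three relations are affine in the \<open>\<sigma>\<^sub>k\<close> and therefore survive
  averaging against \<open>\<omega>\<^sup>3\<close>, and the averages \<open>s\<^sub>k\<close> satisfy
  \<open>(s\<^sub>1 s\<^sub>2 - s\<^sub>3) cos \<theta> = (s\<^sub>2 - 1) (s\<^sub>1 cos \<theta> - sin \<theta>) < 0\<close>. Up to constants the \<open>s\<^sub>k\<close> are the Chern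
  numbers, computed by Stokes' theorem from the representative \<open>\<alpha>\<close>. If \<open>\<gamma>(t) = 0\<close> for some \<open>t > 0\<close>, the imaginary
  part determines \<open>t\<^sup>2\<close>, and the real part then gives equality in the Chern number inequality.\<close>

section \<open>Calculus of smooth functions\<close>

text \<open>The inequality \<open>\<sigma>\<^sub>1 \<sigma>\<^sub>2 > \<sigma>\<^sub>3\<close> is
  quadratic and would not survive averaging by itself; the constancy of \<theta> is what trades it
  for the affine relation with \<open>cos \<theta>\<close> and \<open>sin \<theta>\<close>. Most of
  the work lies in giving the averages a meaning. \<open>class_integral\<close> is a definite
  description over all closed forms of a class, so a Chern number can be computed from \<alpha> only
  once all representatives are known to have the same integral. Three facts enter: Chern forms of
  two Hermitian metrics differ by an exact form, wedge products of closed forms respect exactness,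
  and exact top forms integrate to zero. Every integral refers to the single partition of unity that
  \<open>form_integral\<close> selects, and Stokes' theorem is proved for that one directly. The
  atlas carries no separate orientation; the sign of the Jacobians of the transition maps is read
  off from a positive top form, for which \<omega>^3 is available. Since forms are families of
  coordinate expressions, each form that is moved from one chart to another must come with a proof
  of its compatibility.\<close>

lemma C_k_on_subset: "C_k_on k S f \<Longrightarrow> T \<subseteq> S \<Longrightarrow> C_k_on k T f"
proof (induction k arbitrary: f)
  case 0
  then show ?case by (auto intro: continuous_on_subset)
next
  case (Suc k)
  then show ?case by (auto simp: subset_iff)
qed

lemma C_k_on_cong:
  assumes "open S" "\<And>x. x \<in> S \<Longrightarrow> f x = g x" "C_k_on k S f"
  shows "C_k_on k S g"
  using assms(2,3)
proof (induction k arbitrary: f g)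
  case 0
  then show ?case by (simp cong: continuous_on_cong)
next
  case (Suc k)
  have d: "f differentiable (at x)" if "x \<in> S" for x
    using Suc.prems that by simp
  have e: "frechet_derivative f (at x) = frechet_derivative g (at x)" if "x \<in> S" for x
    by (rule frechet_derivative_transform_within_open[OF d[OF that] \<open>open S\<close> that]) (rule Suc.prems(1))
  have "g differentiable (at x)" if "x \<in> S" for x
    using d[OF that] has_derivative_transform_within_open[where f=f and g=g, OF _ \<open>open S\<close> that Suc.prems(1)]
    unfolding differentiable_def by blast
  moreover have "C_k_on k S (\<lambda>x. frechet_derivative g (at x) v)" for v
    by (rule Suc.IH[of "\<lambda>x. frechet_derivative f (at x) v"]) (use e Suc.prems(2) in auto)
  ultimately show ?case by simp
qed

lemma C_k_on_SucD: "C_k_on (Suc k) S f \<Longrightarrow> C_k_on k S f"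
proof (induction k arbitrary: f)
  case 0
  then show ?case
    by (auto intro!: continuous_at_imp_continuous_on differentiable_imp_continuous_within)
next
  case (Suc k)
  then have *: "\<forall>x\<in>S. f differentiable (at x)"
      "\<And>v. C_k_on (Suc k) S (\<lambda>x. frechet_derivative f (at x) v)"
    by (subst (asm) C_k_on.simps(2); blast)+
  then show ?case using Suc.IH by (subst C_k_on.simps(2)) blast
qed

lemma C_k_on_localI:
  assumes "\<And>x. x \<in> S \<Longrightarrow> \<exists>T. open T \<and> x \<in> T \<and> C_k_on k T f"
  shows "C_k_on k S f"
  using assms
proof (induction k arbitrary: f)
  case 0
  show ?case
    unfolding C_k_on.simps
  proof (rule continuous_at_imp_continuous_on, rule ballI)
    fix x assume "x \<in> S"
    then obtain T where "open T" "x \<in> T" "continuous_on T f" using 0 by auto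
    then show "isCont f x" by (simp add: continuous_on_eq_continuous_at)
  qed
next
  case (Suc k)
  have "f differentiable (at x)" if "x \<in> S" for x
    using Suc.prems[OF that] by auto
  moreover have "C_k_on k S (\<lambda>x. frechet_derivative f (at x) v)" for v
    by (rule Suc.IH) (use Suc.prems in \<open>simp only: C_k_on.simps; blast\<close>)
  ultimately show ?case by simp
qed

text \<open>\<open>C_k_on\<close> is phrased with \<open>frechet_derivative\<close>; this rule
  accepts any explicit formula for the derivative, so that the closure properties below become
  inductions in which the formula is rebuilt from smaller pieces.\<close>

lemma C_k_on_SucI:
  assumes "open S" "\<And>x. x \<in> S \<Longrightarrow> (f has_derivative f' x) (at x)"
    and "\<And>v. C_k_on k S (\<lambda>x. f' x v)"
  shows "C_k_on (Suc k) S f"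
proof -
  have "frechet_derivative f (at x) = f' x" if "x \<in> S" for x
    using frechet_derivative_at[OF assms(2)[OF that]] by simp
  then have "C_k_on k S (\<lambda>x. frechet_derivative f (at x) v)" for v
    by (intro C_k_on_cong[OF assms(1) _ assms(3)[of v]]) simp
  then show ?thesis using assms(2) by (auto simp: differentiable_def)
qed

lemma C_k_on_has_derivative:
  "C_k_on (Suc k) S f \<Longrightarrow> x \<in> S \<Longrightarrow> (f has_derivative frechet_derivative f (at x)) (at x)"
  by (simp add: frechet_derivative_works)

lemma C_k_on_frechet: "C_k_on (Suc k) S f \<Longrightarrow> C_k_on k S (\<lambda>x. frechet_derivative f (at x) v)"
  by simp

lemma C_k_on_const: "C_k_on k S (\<lambda>_. c)"
  by (induction k arbitrary: c) auto

lemma C_k_on_bounded_linear: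
  assumes "bounded_linear h"
  shows "C_k_on k S h"
proof (cases k)
  case 0
  then show ?thesis using assms by (simp add: linear_continuous_on)
next
  case (Suc j)
  have "frechet_derivative h (at x) = h" for x
    using frechet_derivative_at[OF bounded_linear.has_derivative[OF assms has_derivative_ident]] by simp
  moreover have "h differentiable (at x)" for x
    using assms bounded_linear_imp_differentiable by blast
  ultimately show ?thesis using Suc by (simp add: C_k_on_const)
qed

lemma C_k_on_linear_compose:
  assumes "bounded_linear h" "open S" "C_k_on k S f"
  shows "C_k_on k S (\<lambda>x. h (f x))"
  using assms(3)
proof (induction k arbitrary: f)
  case 0
  then show ?case
    using linear_continuous_on[OF assms(1), of UNIV] by (auto intro: continuous_on_compose2)
next
  case (Suc k)
  show ?case
    by (rule C_k_on_SucI[OF assms(2)])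
      (auto intro!: bounded_linear.has_derivative[OF assms(1)] C_k_on_has_derivative[OF Suc.prems]
          Suc.IH C_k_on_frechet[OF Suc.prems])
qed

lemma C_k_on_add:
  assumes "open S" "C_k_on k S f" "C_k_on k S g"
  shows "C_k_on k S (\<lambda>x. f x + g x)"
  using assms(2,3)
proof (induction k arbitrary: f g)
  case 0
  then show ?case by (auto intro: continuous_on_add)
next
  case (Suc k)
  show ?case
    by (rule C_k_on_SucI[OF assms(1)])
      (auto intro!: has_derivative_add C_k_on_has_derivative[OF Suc.prems(1)]
          C_k_on_has_derivative[OF Suc.prems(2)] Suc.IH C_k_on_frechet[OF Suc.prems(1)]
          C_k_on_frechet[OF Suc.prems(2)])
qed

text \<open>Both terms of the product rule are again values of \<open>h\<close>, one argument being
  a derivative and the other an original function with one order of smoothness discarded, so the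
  induction closes. Products, scalar multiples and inner products are all instances.\<close>

lemma C_k_on_bilinear:
  assumes "bounded_bilinear h" "open S" "C_k_on k S f" "C_k_on k S g"
  shows "C_k_on k S (\<lambda>x. h (f x) (g x))"
  using assms(3,4)
proof (induction k arbitrary: f g)
  case 0
  then show ?case by (auto intro: bounded_bilinear.continuous_on[OF assms(1)])
next
  case (Suc k)
  note f = Suc.prems(1) and g = Suc.prems(2)
  show ?case
  proof (rule C_k_on_SucI[OF assms(2)])
    show "((\<lambda>x. h (f x) (g x)) has_derivative
        (\<lambda>v. h (f x) (frechet_derivative g (at x) v) + h (frechet_derivative f (at x) v) (g x))) (at x)"
      if "x \<in> S" for x
      by (rule bounded_bilinear.FDERIV[OF assms(1)])
        (auto intro: C_k_on_has_derivative[OF f that] C_k_on_has_derivative[OF g that])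
    show "C_k_on k S (\<lambda>x. h (f x) (frechet_derivative g (at x) v) + h (frechet_derivative f (at x) v) (g x))" for v
      by (intro C_k_on_add assms Suc.IH C_k_on_frechet[OF f] C_k_on_frechet[OF g] C_k_on_SucD[OF f] C_k_on_SucD[OF g])
  qed
qed

lemma C_k_on_sum:
  assumes "open S" "\<And>i. i \<in> I \<Longrightarrow> C_k_on k S (f i)"
  shows "C_k_on k S (\<lambda>x. \<Sum>i\<in>I. f i x)"
  using assms(2)
proof (induction I rule: infinite_finite_induct)
  case (insert i I)
  then show ?case by (simp add: C_k_on_add[OF assms(1)])
qed (auto simp: C_k_on_const)

text \<open>The derivative of \<open>g\<close> at \<open>f x\<close> is evaluated in a direction
  that varies with \<open>x\<close>, which the induction hypothesis does not cover. Expanding this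
  direction in \<open>Basis\<close> leaves a finite sum of products of \<open>g\<close>-derivatives
  in fixed directions with coordinates of the derivative of \<open>f\<close>; hence the Euclidean
  space in the middle.\<close>

lemma C_k_on_compose:
  fixes g :: "'w::euclidean_space \<Rightarrow> 'z::real_normed_vector"
  assumes "open S" "open T" "C_k_on k S f" "C_k_on k T g" "f ` S \<subseteq> T"
  shows "C_k_on k S (\<lambda>x. g (f x))"
  using assms(3,4)
proof (induction k arbitrary: g)
  case 0
  then show ?case using assms(5) by (auto intro: continuous_on_compose2)
next
  case (Suc k)
  note f = Suc.prems(1) and g = Suc.prems(2)
  show ?case
  proof (rule C_k_on_SucI[OF assms(1)])
    fix x assume x: "x \<in> S"
    with assms(5) have y: "f x \<in> T" by auto
    have g': "(g has_derivative frechet_derivative g (at (f x))) (at (f x))"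
      by (rule C_k_on_has_derivative[OF g y])
    then have lin: "linear (frechet_derivative g (at (f x)))"
      using has_derivative_linear by blast
    have "((\<lambda>x. g (f x)) has_derivative
        (\<lambda>v. frechet_derivative g (at (f x)) (frechet_derivative f (at x) v))) (at x)"
      using has_derivative_compose[OF C_k_on_has_derivative[OF f x], of g] g' by simp
    moreover have "frechet_derivative g (at (f x)) w =
        (\<Sum>b\<in>Basis. (w \<bullet> b) *\<^sub>R frechet_derivative g (at (f x)) b)" for w
    proof -
      have "frechet_derivative g (at (f x)) w = frechet_derivative g (at (f x)) (\<Sum>b\<in>Basis. (w \<bullet> b) *\<^sub>R b)"
        by (simp add: euclidean_representation)
      also have "\<dots> = (\<Sum>b\<in>Basis. (w \<bullet> b) *\<^sub>R frechet_derivative g (at (f x)) b)"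
        by (simp add: linear_sum[OF lin] linear_cmul[OF lin])
      finally show ?thesis .
    qed
    then have "frechet_derivative g (at (f x)) (frechet_derivative f (at x) v) =
        (\<Sum>b\<in>Basis. (frechet_derivative f (at x) v \<bullet> b) *\<^sub>R frechet_derivative g (at (f x)) b)" for v .
    ultimately show "((\<lambda>x. g (f x)) has_derivative (\<lambda>v. \<Sum>b\<in>Basis.
        (frechet_derivative f (at x) v \<bullet> b) *\<^sub>R frechet_derivative g (at (f x)) b)) (at x)"
      by (simp only:)
  next
    fix v
    have "C_k_on k S (\<lambda>x. frechet_derivative g (at (f x)) b)" for b
      by (rule Suc.IH[OF C_k_on_SucD[OF f] C_k_on_frechet[OF g]])
    then show "C_k_on k S (\<lambda>x. \<Sum>b\<in>Basis.
        (frechet_derivative f (at x) v \<bullet> b) *\<^sub>R frechet_derivative g (at (f x)) b)"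
      by (intro C_k_on_sum C_k_on_bilinear[OF bounded_bilinear_scaleR] assms(1)
          C_k_on_linear_compose[OF bounded_linear_inner_left] C_k_on_frechet[OF f])
  qed
qed

lemma bounded_linear_axis: "bounded_linear (axis j :: 'a::euclidean_space \<Rightarrow> 'a^'n)"
  by (intro linear_conv_bounded_linear[THEN iffD1] linearI) (auto simp: axis_def vec_eq_iff)

lemma C_k_on_vec:
  fixes f :: "'v::real_normed_vector \<Rightarrow> ('a::euclidean_space)^'n"
  assumes "open S" "\<And>j. C_k_on k S (\<lambda>x. f x $ j)"
  shows "C_k_on k S f"
proof -
  have "f x = (\<Sum>j\<in>UNIV. axis j (f x $ j))" for x
    by (simp add: vec_eq_iff axis_def if_distrib sum.delta cong: if_cong)
  moreover have "C_k_on k S (\<lambda>x. \<Sum>j\<in>UNIV. axis j (f x $ j))"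
    by (intro C_k_on_sum C_k_on_linear_compose[OF bounded_linear_axis] assms)
  ultimately show ?thesis by simp
qed

section \<open>Closure properties of smooth functions\<close>

lemma smooth_on_subset: "smooth_on S f \<Longrightarrow> T \<subseteq> S \<Longrightarrow> smooth_on T f"
  unfolding smooth_on_def by (blast intro: C_k_on_subset)

lemma smooth_on_cong: "open S \<Longrightarrow> (\<And>x. x \<in> S \<Longrightarrow> f x = g x) \<Longrightarrow> smooth_on S f \<Longrightarrow> smooth_on S g"
  unfolding smooth_on_def by (blast intro: C_k_on_cong)

lemma smooth_on_localI: "(\<And>x. x \<in> S \<Longrightarrow> \<exists>T. open T \<and> x \<in> T \<and> smooth_on T f) \<Longrightarrow> smooth_on S f"
  unfolding smooth_on_def by (blast intro!: C_k_on_localI)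

lemma smooth_on_has_derivative:
  "smooth_on S f \<Longrightarrow> x \<in> S \<Longrightarrow> (f has_derivative frechet_derivative f (at x)) (at x)"
  unfolding smooth_on_def using C_k_on_has_derivative by blast

lemma smooth_on_frechet: "smooth_on S f \<Longrightarrow> smooth_on S (\<lambda>x. frechet_derivative f (at x) v)"
  unfolding smooth_on_def using C_k_on_frechet by blast

lemma smooth_on_continuous: "smooth_on S f \<Longrightarrow> continuous_on S f"
  unfolding smooth_on_def using C_k_on.simps(1) by blast

lemma smooth_on_const: "smooth_on S (\<lambda>_. c)"
  unfolding smooth_on_def by (simp add: C_k_on_const)

lemma smooth_on_bounded_linear: "bounded_linear h \<Longrightarrow> smooth_on S h"
  unfolding smooth_on_def by (simp add: C_k_on_bounded_linear)

lemma smooth_on_linear_compose: "bounded_linear h \<Longrightarrow> open S \<Longrightarrow> smooth_on S f \<Longrightarrow> smooth_on S (\<lambda>x. h (f x))"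
  unfolding smooth_on_def by (simp add: C_k_on_linear_compose)

lemma smooth_on_add: "open S \<Longrightarrow> smooth_on S f \<Longrightarrow> smooth_on S g \<Longrightarrow> smooth_on S (\<lambda>x. f x + g x)"
  unfolding smooth_on_def by (simp add: C_k_on_add)

lemma smooth_on_bilinear:
  "bounded_bilinear h \<Longrightarrow> open S \<Longrightarrow> smooth_on S f \<Longrightarrow> smooth_on S g \<Longrightarrow> smooth_on S (\<lambda>x. h (f x) (g x))"
  unfolding smooth_on_def by (simp add: C_k_on_bilinear)

lemma smooth_on_mult:
  fixes f g :: "'v::real_normed_vector \<Rightarrow> 'a::real_normed_algebra"
  shows "open S \<Longrightarrow> smooth_on S f \<Longrightarrow> smooth_on S g \<Longrightarrow> smooth_on S (\<lambda>x. f x * g x)"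
  by (rule smooth_on_bilinear[OF bounded_bilinear_mult])

lemma smooth_on_diff:
  assumes "open S" "smooth_on S f" "smooth_on S g"
  shows "smooth_on S (\<lambda>x. f x - g x)"
  using smooth_on_add[OF assms(1,2) smooth_on_linear_compose[OF bounded_linear_minus[OF bounded_linear_ident] assms(1,3)]]
  by simp

lemma smooth_on_sum: "open S \<Longrightarrow> (\<And>i. i \<in> I \<Longrightarrow> smooth_on S (f i)) \<Longrightarrow> smooth_on S (\<lambda>x. \<Sum>i\<in>I. f i x)"
  unfolding smooth_on_def by (simp add: C_k_on_sum)

lemma smooth_on_compose:
  fixes g :: "'w::euclidean_space \<Rightarrow> 'z::real_normed_vector"
  shows "open S \<Longrightarrow> open T \<Longrightarrow> smooth_on S f \<Longrightarrow> smooth_on T g \<Longrightarrow> f ` S \<subseteq> T \<Longrightarrow> smooth_on S (\<lambda>x. g (f x))"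
  unfolding smooth_on_def by (blast intro: C_k_on_compose)

lemma smooth_on_vec:
  fixes f :: "'v::real_normed_vector \<Rightarrow> ('a::euclidean_space)^'n"
  shows "open S \<Longrightarrow> (\<And>j. smooth_on S (\<lambda>x. f x $ j)) \<Longrightarrow> smooth_on S f"
  unfolding smooth_on_def by (simp add: C_k_on_vec)

text \<open>The derivative is a polynomial expression in \<open>inverse\<close> itself, so
  smoothness of order \<open>k\<close> yields order \<open>Suc k\<close>.\<close>

lemma smooth_on_inverse: "smooth_on {x::real. x \<noteq> 0} inverse"
proof -
  have op: "open {x::real. x \<noteq> 0}" by (rule open_Collect_neq) (auto intro: continuous_intros)
  have "C_k_on k {x::real. x \<noteq> 0} inverse" for k
  proof (induction k)
    case 0
    show ?case by (auto intro!: continuous_intros)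
  next
    case (Suc k)
    have "(inverse has_derivative (\<lambda>h. - (inverse x * h * inverse x))) (at x)"
      if "x \<in> {x::real. x \<noteq> 0}" for x
      using that by (auto intro!: has_derivative_inverse')
    moreover have "C_k_on k {x::real. x \<noteq> 0} (\<lambda>x. - (inverse x * v * inverse x))" for v
      by (intro C_k_on_linear_compose[OF bounded_linear_minus[OF bounded_linear_ident]]
          C_k_on_bilinear[OF bounded_bilinear_mult] op Suc C_k_on_const)
    ultimately show ?case by (rule C_k_on_SucI[OF op])
  qed
  then show ?thesis by (simp add: smooth_on_def)
qed

lemma smooth_on_ln: "smooth_on {0<..} (ln :: real \<Rightarrow> real)"
proof -
  have "C_k_on k {0<..} (ln :: real \<Rightarrow> real)" for k
  proof (cases k)
    case 0
    then show ?thesis by (auto intro!: continuous_intros)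
  next
    case (Suc j)
    have "C_k_on (Suc j) {0<..} (ln :: real \<Rightarrow> real)"
    proof (rule C_k_on_SucI)
      show "(ln has_derivative (\<lambda>h. h * inverse x)) (at x)" if "x \<in> {0<..}" for x :: real
        using that has_derivative_ln[OF _ has_derivative_ident, of x UNIV] by (simp add: mult.commute)
      have "C_k_on j {0<..} (inverse :: real \<Rightarrow> real)"
        by (rule C_k_on_subset) (use smooth_on_inverse in \<open>auto simp: smooth_on_def\<close>)
      then show "C_k_on j {0<..} (\<lambda>x::real. v * inverse x)" for v
        by (intro C_k_on_bilinear[OF bounded_bilinear_mult] C_k_on_const) auto
    qed auto
    then show ?thesis using Suc by simp
  qed
  then show ?thesis by (simp add: smooth_on_def)
qed

lemma smooth_on_inverse_compose:
  fixes f :: "'v::real_normed_vector \<Rightarrow> real"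
  assumes "open S" "smooth_on S f" "\<And>x. x \<in> S \<Longrightarrow> f x \<noteq> 0"
  shows "smooth_on S (\<lambda>x. inverse (f x))"
  by (rule smooth_on_compose[OF assms(1) _ assms(2) smooth_on_inverse])
    (use assms(3) in \<open>auto intro!: open_Collect_neq continuous_intros\<close>)

lemma smooth_on_ln_compose:
  fixes f :: "'v::real_normed_vector \<Rightarrow> real"
  assumes "open S" "smooth_on S f" "\<And>x. x \<in> S \<Longrightarrow> f x > 0"
  shows "smooth_on S (\<lambda>x. ln (f x))"
  by (rule smooth_on_compose[OF assms(1) _ assms(2) smooth_on_ln]) (use assms(3) in auto)

subsection \<open>A smooth cutoff function\<close>

text \<open>The linear span of the functions \<open>exp (- 1 / x) / x ^ n\<close> is closed under differentiation,
  so that smoothness at \<open>0\<close> becomes a plain induction.\<close>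

definition flat_exp :: "nat \<Rightarrow> real \<Rightarrow> real" where
  "flat_exp n x = (if x > 0 then exp (- inverse x) * inverse x ^ n else 0)"

lemma flat_exp_nonpos: "x \<le> 0 \<Longrightarrow> flat_exp n x = 0"
  by (auto simp: flat_exp_def)

lemma flat_exp_tendsto_0: "(flat_exp n \<longlongrightarrow> 0) (at 0)"
proof -
  have "((\<lambda>x. x ^ n / exp x) \<longlongrightarrow> (0::real)) at_top"
    by (rule tendsto_power_div_exp_0)
  then have "((\<lambda>x. inverse x ^ n / exp (inverse x)) \<longlongrightarrow> (0::real)) (at_right 0)"
    by (rule filterlim_compose) (rule filterlim_inverse_at_top_right)
  then have "(flat_exp n \<longlongrightarrow> 0) (at_right 0)"
    by (rule Lim_transform_eventually)
      (auto simp: eventually_at_filter flat_exp_def exp_minus field_simps)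
  moreover have "(flat_exp n \<longlongrightarrow> 0) (at_left 0)"
    by (rule Lim_transform_eventually[OF tendsto_const]) (auto simp: eventually_at_filter flat_exp_def)
  ultimately show ?thesis by (simp add: filterlim_split_at)
qed

lemma flat_exp_has_derivative:
  "(flat_exp n has_real_derivative (flat_exp (n + 2) x - n * flat_exp (n + 1) x)) (at x)"
proof (cases x "0::real" rule: linorder_cases)
  case less
  have "((\<lambda>x. 0::real) has_real_derivative (flat_exp (n + 2) x - n * flat_exp (n + 1) x)) (at x)"
    using less by (simp add: flat_exp_def)
  then show ?thesis
    by (rule has_field_derivative_transform_within_open[of _ _ _ "{..<0}"])
      (use less in \<open>auto simp: flat_exp_def\<close>)
next
  case equal
  \<comment> \<open>The difference quotient at 0 is the next member of the family, and that tends to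
    0.\<close>
  have "(\<lambda>h. (flat_exp n (0 + h) - flat_exp n 0) / h) = flat_exp (Suc n)"
    by (auto simp: flat_exp_def fun_eq_iff divide_inverse)
  then have "((\<lambda>h. (flat_exp n (0 + h) - flat_exp n 0) / h) \<longlongrightarrow> 0) (at 0)"
    using flat_exp_tendsto_0 by simp
  then show ?thesis using equal by (simp add: flat_exp_nonpos DERIV_def)
next
  case greater
  have i: "(inverse has_real_derivative - (inverse x * inverse x)) (at x)"
    using greater by (auto intro!: derivative_eq_intros)
  have p: "((\<lambda>x. inverse x ^ n) has_real_derivative - (n * inverse x ^ (n + 1))) (at x)"
    by (rule DERIV_cong[OF DERIV_power[OF i]]) (cases n; simp)
  have e: "((\<lambda>x. exp (- inverse x)) has_real_derivative exp (- inverse x) * (inverse x * inverse x)) (at x)"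
    by (rule DERIV_cong[OF DERIV_fun_exp[OF DERIV_minus[OF i]]]) simp
  have "((\<lambda>x. exp (- inverse x) * inverse x ^ n) has_real_derivative
     (flat_exp (n + 2) x - n * flat_exp (n + 1) x)) (at x)"
    by (rule DERIV_cong[OF DERIV_mult[OF e p]]) (use greater in \<open>simp add: flat_exp_def algebra_simps\<close>)
  then show ?thesis
    by (rule has_field_derivative_transform_within_open[of _ _ _ "{0<..}"])
      (use greater in \<open>auto simp: flat_exp_def\<close>)
qed

lemma smooth_on_flat_exp: "smooth_on UNIV (flat_exp n)"
proof -
  have "C_k_on k UNIV (flat_exp n)" for k
  proof (induction k arbitrary: n)
    case 0
    show ?case
      by (auto intro!: continuous_at_imp_continuous_on DERIV_isCont[OF flat_exp_has_derivative])
  next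
    case (Suc k)
    show ?case
    proof (rule C_k_on_SucI)
      show "(flat_exp n has_derivative (\<lambda>h. (flat_exp (n + 2) x - n * flat_exp (n + 1) x) * h)) (at x)" for x
        using flat_exp_has_derivative by (simp add: has_field_derivative_def)
      have "C_k_on k UNIV (\<lambda>x. (flat_exp (n + 2) x + (- real n) * flat_exp (n + 1) x) * v)" for v
        by (intro C_k_on_add C_k_on_bilinear[OF bounded_bilinear_mult] C_k_on_const Suc) auto
      then show "C_k_on k UNIV (\<lambda>x. (flat_exp (n + 2) x - n * flat_exp (n + 1) x) * v)" for v
        by simp
    qed auto
  qed
  then show ?thesis by (simp add: smooth_on_def)
qed

text \<open>The squared distance replaces the distance because it is smooth at the centre too; its
  comparison with \<open>r\<^sup>2\<close> describes the same ball.\<close>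

definition ball_bump :: "'v::euclidean_space \<Rightarrow> real \<Rightarrow> 'v \<Rightarrow> real" where
  "ball_bump x0 r x = flat_exp 0 (r\<^sup>2 - (x - x0) \<bullet> (x - x0))"

lemma ball_bump_nonneg: "ball_bump x0 r x \<ge> 0"
  by (simp add: ball_bump_def flat_exp_def)

lemma ball_bump_pos_iff: "r > 0 \<Longrightarrow> ball_bump x0 r x > 0 \<longleftrightarrow> x \<in> ball x0 r"
  by (auto simp: ball_bump_def flat_exp_def dist_norm power2_norm_eq_inner[symmetric] norm_minus_commute
      abs_square_less_1 dest: power_less_imp_less_base intro!: power_strict_mono)

lemma ball_bump_eq_0: "r > 0 \<Longrightarrow> x \<notin> ball x0 r \<Longrightarrow> ball_bump x0 r x = 0"
  using ball_bump_pos_iff[of r x0 x] ball_bump_nonneg[of x0 r x] by linarith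

lemma smooth_on_ball_bump: "smooth_on UNIV (ball_bump x0 r)"
proof -
  have "smooth_on UNIV (\<lambda>x. r\<^sup>2 - (x - x0) \<bullet> (x - x0))"
    by (intro smooth_on_diff smooth_on_bilinear[OF bounded_bilinear_inner] smooth_on_const
        smooth_on_bounded_linear[OF bounded_linear_ident]) auto
  then have "smooth_on UNIV (\<lambda>x. flat_exp 0 (r\<^sup>2 - (x - x0) \<bullet> (x - x0)))"
    by (intro smooth_on_compose[OF _ _ _ smooth_on_flat_exp]) auto
  then show ?thesis unfolding ball_bump_def .
qed

subsection \<open>Symmetry of second derivatives\<close>

lemma has_real_derivative_along:
  fixes f :: "'v::real_normed_vector \<Rightarrow> real"
  assumes "f differentiable (at (a + t *\<^sub>R v))"
  shows "((\<lambda>s. f (a + s *\<^sub>R v)) has_real_derivative frechet_derivative f (at (a + t *\<^sub>R v)) v) (at t)"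
proof -
  have f: "(f has_derivative frechet_derivative f (at (a + t *\<^sub>R v))) (at (a + t *\<^sub>R v))"
    using assms frechet_derivative_works by blast
  have g: "((\<lambda>s. a + s *\<^sub>R v) has_derivative (\<lambda>h. h *\<^sub>R v)) (at t)"
    by (auto intro!: derivative_eq_intros)
  have "((\<lambda>s. f (a + s *\<^sub>R v)) has_derivative (\<lambda>h. frechet_derivative f (at (a + t *\<^sub>R v)) (h *\<^sub>R v))) (at t)"
    using has_derivative_compose[OF g, of f] f by simp
  moreover have "frechet_derivative f (at (a + t *\<^sub>R v)) (h *\<^sub>R v) = frechet_derivative f (at (a + t *\<^sub>R v)) v * h" for h
    using linear_cmul[OF has_derivative_linear[OF f]] by (simp add: mult.commute)
  ultimately show ?thesis by (simp add: has_field_derivative_def)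
qed

text \<open>The mean value theorem is applied in direction \<open>v\<close> to the increment of
  \<open>f\<close> along \<open>w\<close>, and then in direction \<open>w\<close> to the derivative
  along \<open>v\<close>. The left side is symmetric in \<open>v\<close> and \<open>w\<close>, which
  is the source of the symmetry of second derivatives.\<close>

lemma second_difference_mvt:
  fixes f :: "'v::real_normed_vector \<Rightarrow> real"
  assumes f: "C_k_on 2 S f" and h: "h > 0"
    and S: "\<And>s t. 0 \<le> s \<Longrightarrow> s \<le> h \<Longrightarrow> 0 \<le> t \<Longrightarrow> t \<le> h \<Longrightarrow> x + s *\<^sub>R v + t *\<^sub>R w \<in> S"
  obtains s t where "0 < s" "s < h" "0 < t" "t < h"
    "f (x + h *\<^sub>R v + h *\<^sub>R w) - f (x + h *\<^sub>R v) - f (x + h *\<^sub>R w) + f x =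
     h * h * frechet_derivative (\<lambda>y. frechet_derivative f (at y) v) (at (x + s *\<^sub>R v + t *\<^sub>R w)) w"
proof -
  have C: "C_k_on (Suc 1) S f" using f by (simp add: numeral_2_eq_2)
  have d1: "f differentiable (at y)" if "y \<in> S" for y using C that by simp
  have d2: "(\<lambda>y. frechet_derivative f (at y) v) differentiable (at y)" if "y \<in> S" for y
    using C_k_on_frechet[OF C] that by simp
  have S0: "x + s *\<^sub>R v \<in> S" if "0 \<le> s" "s \<le> h" for s using S[of s 0] that h by simp
  let ?D = "\<lambda>y. frechet_derivative f (at y) v"
  have "\<exists>s. 0 < s \<and> s < h \<and>
      (f (x + h *\<^sub>R w + h *\<^sub>R v) - f (x + h *\<^sub>R v)) - (f (x + h *\<^sub>R w + 0 *\<^sub>R v) - f (x + 0 *\<^sub>R v)) =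
      (h - 0) * (?D (x + h *\<^sub>R w + s *\<^sub>R v) - ?D (x + s *\<^sub>R v))"
  proof (rule MVT2[OF h])
    fix s assume s: "0 \<le> s" "s \<le> h"
    have "x + h *\<^sub>R w + s *\<^sub>R v \<in> S" using S[of s h] s h by (simp add: algebra_simps)
    then show "((\<lambda>s. f (x + h *\<^sub>R w + s *\<^sub>R v) - f (x + s *\<^sub>R v)) has_real_derivative
        (?D (x + h *\<^sub>R w + s *\<^sub>R v) - ?D (x + s *\<^sub>R v))) (at s)"
      using S0[OF s] by (intro DERIV_diff has_real_derivative_along d1)
  qed
  then obtain s where s: "0 < s" "s < h" and
    es: "f (x + h *\<^sub>R v + h *\<^sub>R w) - f (x + h *\<^sub>R v) - f (x + h *\<^sub>R w) + f x =
      h * (?D (x + s *\<^sub>R v + h *\<^sub>R w) - ?D (x + s *\<^sub>R v))"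
    by (auto simp: algebra_simps)
  have "\<exists>t. 0 < t \<and> t < h \<and> ?D (x + s *\<^sub>R v + h *\<^sub>R w) - ?D (x + s *\<^sub>R v + 0 *\<^sub>R w) =
      (h - 0) * frechet_derivative ?D (at (x + s *\<^sub>R v + t *\<^sub>R w)) w"
    by (rule MVT2[OF h]) (use S s in \<open>intro has_real_derivative_along d2, auto\<close>)
  then obtain t where "0 < t" "t < h" "?D (x + s *\<^sub>R v + h *\<^sub>R w) - ?D (x + s *\<^sub>R v) =
      h * frechet_derivative ?D (at (x + s *\<^sub>R v + t *\<^sub>R w)) w"
    by auto
  with s es that show thesis by (metis mult.assoc)
qed

text \<open>Both mixed derivatives, taken at suitable points of a small parallelogram, equal the
  same second difference divided by \<open>h * h\<close>; continuity carries the equality to the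
  corner \<open>x\<close>.\<close>

lemma second_derivative_symmetric:
  fixes f :: "'v::real_normed_vector \<Rightarrow> real"
  assumes "open S" "C_k_on 2 S f" "x \<in> S"
  shows "frechet_derivative (\<lambda>y. frechet_derivative f (at y) v) (at x) w =
         frechet_derivative (\<lambda>y. frechet_derivative f (at y) w) (at x) v"
    (is "?A x = ?B x")
proof (rule ccontr)
  assume ne: "?A x \<noteq> ?B x"
  \<comment> \<open>Half the supposed gap: two errors below \<open>e\<close> cannot bridge
    it.\<close>
  define e where "e = \<bar>?A x - ?B x\<bar> / 2"
  have e: "e > 0" using ne by (simp add: e_def)
  have C: "C_k_on (Suc (Suc 0)) S f" using assms(2) by (simp add: numeral_2_eq_2)
  have "isCont ?A x" "isCont ?B x"
    using C_k_on_frechet[OF C_k_on_frechet[OF C]] assms(1,3)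
    by (auto simp: continuous_on_eq_continuous_at)
  then have "\<exists>d>0. \<forall>y. dist y x < d \<longrightarrow> dist (?A y) (?A x) < e"
      "\<exists>d>0. \<forall>y. dist y x < d \<longrightarrow> dist (?B y) (?B x) < e"
    using e by (simp_all add: continuous_at_eps_delta)
  then obtain d1 d2 where d1: "d1 > 0" "\<And>y. dist y x < d1 \<Longrightarrow> dist (?A y) (?A x) < e"
    and d2: "d2 > 0" "\<And>y. dist y x < d2 \<Longrightarrow> dist (?B y) (?B x) < e"
    by blast
  obtain d3 where d3: "d3 > 0" "ball x d3 \<subseteq> S"
    using assms(1,3) openE by blast
  define d where "d = min d1 (min d2 d3)"
  have d: "d > 0" using d1(1) d2(1) d3(1) by (simp add: d_def)
  \<comment> \<open>The summand 1 keeps \<open>N\<close> positive when both vectors vanish. With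
    side parameter \<open>h\<close> the whole parallelogram then stays within \<open>d / 2\<close>
    of \<open>x\<close>.\<close>
  define N where "N = norm v + norm w + 1"
  define h where "h = d / (2 * N)"
  have nvw: "N > 0" using norm_ge_zero[of v] norm_ge_zero[of w] unfolding N_def by linarith
  have h: "h > 0" using d nvw by (simp add: h_def)
  have near: "dist (x + s *\<^sub>R v + t *\<^sub>R w) x < d" if "0 \<le> s" "s \<le> h" "0 \<le> t" "t \<le> h" for s t
  proof -
    have "dist (x + s *\<^sub>R v + t *\<^sub>R w) x \<le> norm (s *\<^sub>R v) + norm (t *\<^sub>R w)"
      using norm_triangle_ineq[of "s *\<^sub>R v" "t *\<^sub>R w"] by (simp add: dist_norm)
    also have "\<dots> \<le> h * norm v + h * norm w"
      using that by (auto intro!: add_mono mult_right_mono)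
    also have "\<dots> \<le> h * N" using h by (simp add: N_def algebra_simps)
    also have "\<dots> = d / 2" using nvw by (simp add: h_def)
    also have "\<dots> < d" using d by simp
    finally show ?thesis .
  qed
  have inS: "x + s *\<^sub>R v + t *\<^sub>R w \<in> S" if "0 \<le> s" "s \<le> h" "0 \<le> t" "t \<le> h" for s t
    using near[OF that] d3(2) by (auto simp: d_def dist_commute)
  have inS': "x + s *\<^sub>R w + t *\<^sub>R v \<in> S" if "0 \<le> s" "s \<le> h" "0 \<le> t" "t \<le> h" for s t
    using inS[OF that(3,4,1,2)] by (simp add: add.assoc add.commute[of "s *\<^sub>R w"])
  obtain s t where st: "0 < s" "s < h" "0 < t" "t < h"
    and A: "f (x + h *\<^sub>R v + h *\<^sub>R w) - f (x + h *\<^sub>R v) - f (x + h *\<^sub>R w) + f x =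
      h * h * ?A (x + s *\<^sub>R v + t *\<^sub>R w)"
    by (rule second_difference_mvt[OF assms(2) h inS])
  obtain s' t' where st': "0 < s'" "s' < h" "0 < t'" "t' < h"
    and B: "f (x + h *\<^sub>R w + h *\<^sub>R v) - f (x + h *\<^sub>R w) - f (x + h *\<^sub>R v) + f x =
      h * h * ?B (x + s' *\<^sub>R w + t' *\<^sub>R v)"
    by (rule second_difference_mvt[OF assms(2) h inS'])
  have "h * h * ?A (x + s *\<^sub>R v + t *\<^sub>R w) = h * h * ?B (x + t' *\<^sub>R v + s' *\<^sub>R w)"
    using A B by (simp add: algebra_simps)
  then have "?A (x + s *\<^sub>R v + t *\<^sub>R w) = ?B (x + t' *\<^sub>R v + s' *\<^sub>R w)" using h by simp
  moreover have "dist (?A (x + s *\<^sub>R v + t *\<^sub>R w)) (?A x) < e"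
    by (rule d1(2)) (use near[of s t] st in \<open>auto simp: d_def\<close>)
  moreover have "dist (?B (x + t' *\<^sub>R v + s' *\<^sub>R w)) (?B x) < e"
    by (rule d2(2)) (use near[of t' s'] st' in \<open>auto simp: d_def\<close>)
  moreover have False if "p = q" "dist p a < \<bar>a - b\<bar> / 2" "dist q b < \<bar>a - b\<bar> / 2" for p q a b :: real
    using that by (simp add: dist_real_def abs_if split: if_splits)
  ultimately show False unfolding e_def by blast
qed

section \<open>Charts and partitions of unity\<close>

locale compact_complex_manifold =
  fixes M :: "('a::t2_space, 'n::finite) chart set"
  assumes compact_UNIV: "compact (UNIV :: 'a set)"
    and atlas: "complex_atlas M"
begin

lemma charts_cover: obtains c where "c \<in> M" "p \<in> cdom c"
  using atlas unfolding complex_atlas_def by blast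

lemma
  assumes "c \<in> M"
  shows open_cdom: "open (cdom c)" and open_cran: "open (cran c)"
    and chart_homeo: "homeomorphism (cdom c) (cran c) (cmap c) (cinv c)"
  using atlas assms unfolding complex_atlas_def by auto

lemma cinv_cmap: "c \<in> M \<Longrightarrow> p \<in> cdom c \<Longrightarrow> cinv c (cmap c p) = p"
  and cmap_cinv: "c \<in> M \<Longrightarrow> x \<in> cran c \<Longrightarrow> cmap c (cinv c x) = x"
  and cinv_in: "c \<in> M \<Longrightarrow> x \<in> cran c \<Longrightarrow> cinv c x \<in> cdom c"
  and cont_cmap: "c \<in> M \<Longrightarrow> continuous_on (cdom c) (cmap c)"
  and cont_cinv: "c \<in> M \<Longrightarrow> continuous_on (cran c) (cinv c)"
  using chart_homeo[of c] unfolding homeomorphism_def by auto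

lemma cmap_in: "p \<in> cdom c \<Longrightarrow> cmap c p \<in> cran c"
  by (simp add: cran_def)

lemma cmap_image_eq: "c \<in> M \<Longrightarrow> cmap c ` (cdom c \<inter> W) = {x \<in> cran c. cinv c x \<in> W}"
  by (auto simp: cmap_in cinv_cmap image_iff) (metis IntI cinv_in cmap_cinv)

lemma cmap_image_whole: "cmap c ` (cdom c \<inter> UNIV) = cran c"
  by (simp add: cran_def)

lemma open_cmap_image:
  assumes "c \<in> M" "open W"
  shows "open (cmap c ` (cdom c \<inter> W))"
proof -
  have "open (cinv c -` W \<inter> cran c)"
    using continuous_on_open_vimage[OF open_cran[OF assms(1)]] cont_cinv[OF assms(1)] assms(2) by blast
  moreover have "cinv c -` W \<inter> cran c = cmap c ` (cdom c \<inter> W)"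
    using cmap_image_eq[OF assms(1)] by auto
  ultimately show ?thesis by simp
qed

lemma smooth_on_transition:
  assumes "c \<in> M" "c' \<in> M"
  shows "smooth_on (cmap c ` (cdom c \<inter> cdom c')) (\<lambda>x. cmap c' (cinv c x))"
proof (rule smooth_on_vec)
  show "open (cmap c ` (cdom c \<inter> cdom c'))"
    using open_cmap_image assms open_cdom by blast
  show "smooth_on (cmap c ` (cdom c \<inter> cdom c')) (\<lambda>x. cmap c' (cinv c x) $ j)" for j
    using atlas assms unfolding complex_atlas_def holo_on_def by blast
qed

lemma smooth_on_change_chart:
  fixes f :: "'a \<Rightarrow> 'z::real_normed_vector"
  assumes "c \<in> M" "c' \<in> M" "open W"
    and "smooth_on (cmap c' ` (cdom c' \<inter> W)) (\<lambda>x. f (cinv c' x))"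
  shows "smooth_on (cmap c ` (cdom c \<inter> (cdom c' \<inter> W))) (\<lambda>x. f (cinv c x))"
proof -
  let ?S = "cmap c ` (cdom c \<inter> (cdom c' \<inter> W))"
  have op: "open ?S" by (intro open_cmap_image open_Int open_cdom assms)
  have "smooth_on ?S (\<lambda>x. f (cinv c' (cmap c' (cinv c x))))"
  proof (rule smooth_on_compose[OF op _ _ assms(4)])
    show "smooth_on ?S (\<lambda>x. cmap c' (cinv c x))"
      by (rule smooth_on_subset[OF smooth_on_transition[OF assms(1,2)]]) auto
    show "(\<lambda>x. cmap c' (cinv c x)) ` ?S \<subseteq> cmap c' ` (cdom c' \<inter> W)"
      using assms by (auto simp: cinv_cmap)
  qed (use assms open_cmap_image in auto)
  then show ?thesis
    by (rule smooth_on_cong[OF op, rotated]) (use assms in \<open>auto simp: cinv_cmap\<close>)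
qed

text \<open>\<open>smooth_fun_on\<close> demands smoothness in every chart of the atlas; near each
  point one chart suffices, since the smooth transition maps carry the property to all
  others.\<close>

lemma smooth_fun_onI:
  assumes "\<And>p. \<exists>c W. c \<in> M \<and> open W \<and> p \<in> W \<and> p \<in> cdom c \<and> smooth_on (cmap c ` (cdom c \<inter> W)) (\<lambda>x. f (cinv c x))"
  shows "smooth_fun_on M UNIV f"
  unfolding smooth_fun_on_def cmap_image_whole
proof (intro ballI smooth_on_localI)
  fix c x assume c: "c \<in> M" and x: "x \<in> cran c"
  obtain c' W where W: "c' \<in> M" "open W" "cinv c x \<in> W" "cinv c x \<in> cdom c'"
      "smooth_on (cmap c' ` (cdom c' \<inter> W)) (\<lambda>x. f (cinv c' x))"
    using assms by blast
  show "\<exists>T. open T \<and> x \<in> T \<and> smooth_on T (\<lambda>x. f (cinv c x))"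
  proof (intro exI conjI)
    show "smooth_on (cmap c ` (cdom c \<inter> (cdom c' \<inter> W))) (\<lambda>x. f (cinv c x))"
      by (rule smooth_on_change_chart[OF c W(1,2,5)])
    show "open (cmap c ` (cdom c \<inter> (cdom c' \<inter> W)))"
      by (intro open_cmap_image open_Int open_cdom c W)
    show "x \<in> cmap c ` (cdom c \<inter> (cdom c' \<inter> W))"
      using c x W by (simp add: cmap_image_eq)
  qed
qed

section \<open>Bump functions and partitions of unity\<close>

definition chart_bump :: "('a, 'n) chart \<Rightarrow> complex^'n \<Rightarrow> real \<Rightarrow> 'a \<Rightarrow> real" where
  "chart_bump c x0 r p = (if p \<in> cdom c then ball_bump x0 r (cmap c p) else 0)"

lemma chart_bump_nonneg: "chart_bump c x0 r p \<ge> 0"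
  by (simp add: chart_bump_def ball_bump_nonneg)

text \<open>The chart preimage of the closed ball is compact, hence closed because the space is
  Hausdorff. Its complement is therefore an open set on which the bump vanishes, and this makes the
  extension by zero smooth outside the chart.\<close>

lemma
  assumes c: "c \<in> M" and r: "r > 0" and x0: "cball x0 r \<subseteq> cran c"
  shows smooth_chart_bump: "smooth_fun_on M UNIV (chart_bump c x0 r)"
    and closure_chart_bump: "closure {p. chart_bump c x0 r p \<noteq> 0} \<subseteq> cinv c ` cball x0 r"
    and closed_chart_ball: "closed (cinv c ` cball x0 r)"
    and chart_ball_subset: "cinv c ` cball x0 r \<subseteq> cdom c"
    and open_chart_bump: "open {p. chart_bump c x0 r p > 0}"
proof -
  let ?K = "cinv c ` cball x0 r"
  have "compact ?K"
    by (rule compact_continuous_image) (use x0 cont_cinv[OF c] in \<open>auto intro: continuous_on_subset\<close>)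
  then show K: "closed ?K" by (rule compact_imp_closed)
  show Kc: "?K \<subseteq> cdom c" using x0 cinv_in[OF c] by auto
  have nz: "p \<in> ?K" if "chart_bump c x0 r p \<noteq> 0" for p
  proof -
    from that have p: "p \<in> cdom c" "cmap c p \<in> ball x0 r"
      using ball_bump_eq_0[OF r] by (auto simp: chart_bump_def split: if_splits)
    then show ?thesis using cinv_cmap[OF c p(1)] by (metis imageI in_mono ball_subset_cball)
  qed
  then show "closure {p. chart_bump c x0 r p \<noteq> 0} \<subseteq> ?K"
    by (intro closure_minimal K) auto
  show "smooth_fun_on M UNIV (chart_bump c x0 r)"
  proof (rule smooth_fun_onI)
    fix p
    show "\<exists>c' W. c' \<in> M \<and> open W \<and> p \<in> W \<and> p \<in> cdom c' \<and>
        smooth_on (cmap c' ` (cdom c' \<inter> W)) (\<lambda>x. chart_bump c x0 r (cinv c' x))"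
    proof (cases "p \<in> cdom c")
      case True
      have "smooth_on (cmap c ` (cdom c \<inter> UNIV)) (ball_bump x0 r)"
        using smooth_on_ball_bump by (rule smooth_on_subset) simp
      then have "smooth_on (cmap c ` (cdom c \<inter> UNIV)) (\<lambda>x. chart_bump c x0 r (cinv c x))"
        by (rule smooth_on_cong[rotated 2])
          (auto simp: chart_bump_def cinv_cmap[OF c] open_cmap_image[OF c open_UNIV, simplified])
      with True c show ?thesis by blast
    next
      case False
      obtain c' where c': "c' \<in> M" "p \<in> cdom c'" by (rule charts_cover)
      have "smooth_on (cmap c' ` (cdom c' \<inter> - ?K)) (\<lambda>x. 0::real)" by (rule smooth_on_const)
      then have "smooth_on (cmap c' ` (cdom c' \<inter> - ?K)) (\<lambda>x. chart_bump c x0 r (cinv c' x))"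
      proof (rule smooth_on_cong[rotated 2])
        show "open (cmap c' ` (cdom c' \<inter> - ?K))"
          using K by (intro open_cmap_image[OF c'(1)]) auto
        fix x assume "x \<in> cmap c' ` (cdom c' \<inter> - ?K)"
        then have "cinv c' x \<notin> ?K" using cinv_cmap[OF c'(1)] by auto
        then show "0 = chart_bump c x0 r (cinv c' x)" using nz by metis
      qed
      moreover have "p \<in> - ?K" "open (- ?K)" using False Kc K by auto
      ultimately show ?thesis using c' by blast
    qed
  qed
  have "{p. chart_bump c x0 r p > 0} = cmap c -` ball x0 r \<inter> cdom c"
    by (auto simp: chart_bump_def ball_bump_pos_iff[OF r] split: if_splits)
  moreover have "open (cmap c -` ball x0 r \<inter> cdom c)"
    using continuous_on_open_vimage[OF open_cdom[OF c]] cont_cmap[OF c] by blast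
  ultimately show "open {p. chart_bump c x0 r p > 0}" by simp
qed

lemma smooth_fun_on_sum:
  "(\<And>i. i \<in> I \<Longrightarrow> smooth_fun_on M UNIV (f i)) \<Longrightarrow> smooth_fun_on M UNIV (\<lambda>p. \<Sum>i\<in>I. f i p)"
  unfolding smooth_fun_on_def
proof (intro ballI smooth_on_sum open_cmap_image open_UNIV)
  fix c i assume *: "\<And>i. i \<in> I \<Longrightarrow> \<forall>c\<in>M. smooth_on (cmap c ` (cdom c \<inter> UNIV)) (\<lambda>x. f i (cinv c x))"
    and "c \<in> M" "i \<in> I"
  then show "smooth_on (cmap c ` (cdom c \<inter> UNIV)) (\<lambda>x. f i (cinv c x))"
    using *[of i] by (rule_tac bspec)
qed

text \<open>By compactness finitely many bumps are enough to be positive everywhere; dividing by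
  their sum normalizes them.\<close>

lemma partition_of_unity_exists: "\<exists>F \<rho>. partition_of_unity M F \<rho>"
proof -
  have "\<exists>c x0 r. c \<in> M \<and> r > 0 \<and> cball x0 r \<subseteq> cran c \<and> chart_bump c x0 r p > 0" for p
  proof -
    obtain c where c: "c \<in> M" "p \<in> cdom c" by (rule charts_cover)
    then obtain r where "r > 0" "cball (cmap c p) r \<subseteq> cran c"
      using open_cran[OF c(1)] cmap_in[OF c(2)] open_contains_cball by blast
    with c show ?thesis
      by (intro exI[of _ c] exI[of _ "cmap c p"] exI[of _ r]) (simp add: chart_bump_def ball_bump_pos_iff)
  qed
  then obtain c x0 r where cxr: "\<And>p. c p \<in> M" "\<And>p. r p > 0" "\<And>p. cball (x0 p) (r p) \<subseteq> cran (c p)"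
      "\<And>p. chart_bump (c p) (x0 p) (r p) p > 0"
    by metis
  define b where "b p = chart_bump (c p) (x0 p) (r p)" for p
  have b_nonneg: "b p q \<ge> 0" for p q by (simp add: b_def chart_bump_nonneg)
  have b_smooth: "smooth_fun_on M UNIV (b p)" for p
    unfolding b_def by (rule smooth_chart_bump) (use cxr in auto)
  have "UNIV \<subseteq> (\<Union>p\<in>UNIV. {q. b p q > 0})" using cxr(4) by (auto simp: b_def)
  moreover have "open {q. b p q > 0}" for p
    unfolding b_def by (rule open_chart_bump) (use cxr in auto)
  ultimately obtain P where P: "finite P" "UNIV \<subseteq> (\<Union>p\<in>P. {q. b p q > 0})"
    using compactE_image[OF compact_UNIV, of UNIV "\<lambda>p. {q. b p q > 0}"] by (metis subset_UNIV)
  define tot where "tot q = (\<Sum>p\<in>P. b p q)" for q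
  have tot: "tot q > 0" for q
  proof -
    obtain p where p: "p \<in> P" "b p q > 0" using P(2) by blast
    have "b p q \<le> tot q" unfolding tot_def
      by (rule member_le_sum) (use P(1) p b_nonneg in auto)
    with p show ?thesis by linarith
  qed
  \<comment> \<open>The partition is indexed by charts, while several chosen bumps may belong to the
    same chart; they are added up chart by chart.\<close>
  define \<rho> where "\<rho> k q = (\<Sum>p\<in>{p\<in>P. c p = k}. b p q) * inverse (tot q)" for k q
  have "partition_of_unity M (c ` P) \<rho>"
    unfolding partition_of_unity_def
  proof (intro conjI ballI allI)
    show "finite (c ` P)" "c ` P \<subseteq> M" using P(1) cxr(1) by auto
    show "smooth_fun_on M UNIV (\<rho> k)" for k
      unfolding smooth_fun_on_def \<rho>_def
    proof (intro ballI smooth_on_mult smooth_on_inverse_compose)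
      show "open (cmap c ` (cdom c \<inter> UNIV))" if "c \<in> M" for c using that by (rule open_cmap_image) simp
      then show "open (cmap c ` (cdom c \<inter> UNIV))" if "c \<in> M" for c using that by blast
      show "smooth_on (cmap c' ` (cdom c' \<inter> UNIV)) (\<lambda>x. \<Sum>p\<in>{p\<in>P. c p = k}. b p (cinv c' x))" if "c' \<in> M" for c'
        using smooth_fun_on_sum[of "{p\<in>P. c p = k}" b, OF b_smooth] that by (auto simp: smooth_fun_on_def)
      show "smooth_on (cmap c' ` (cdom c' \<inter> UNIV)) (\<lambda>x. tot (cinv c' x))" if "c' \<in> M" for c'
        using smooth_fun_on_sum[of P b, OF b_smooth] that by (auto simp: smooth_fun_on_def tot_def)
      show "tot (cinv c' x) \<noteq> 0" for c' x using tot[of "cinv c' x"] by simp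
    qed
    show "\<rho> k p \<ge> 0" for k p
      using tot[of p] b_nonneg by (auto simp: \<rho>_def intro!: mult_nonneg_nonneg sum_nonneg)
    show "closure {q. \<rho> k q \<noteq> 0} \<subseteq> cdom k" for k
    proof -
      let ?K = "\<Union>p\<in>{p\<in>P. c p = k}. cinv (c p) ` cball (x0 p) (r p)"
      have cl: "closed ?K"
        by (rule closed_UN) (use P(1) closed_chart_ball[OF cxr(1-3)] in auto)
      have "{q. \<rho> k q \<noteq> 0} \<subseteq> ?K"
      proof
        fix q assume "q \<in> {q. \<rho> k q \<noteq> 0}"
        then have "(\<Sum>p\<in>{p\<in>P. c p = k}. b p q) * inverse (tot q) \<noteq> 0"
          unfolding \<rho>_def by (rule CollectD)
        then have "(\<Sum>p\<in>{p\<in>P. c p = k}. b p q) \<noteq> 0" by (rule mult_not_zero[THEN conjunct1])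
        then have "\<not> (\<forall>p\<in>{p\<in>P. c p = k}. b p q = 0)"
          by (rule contrapos_nn) (rule sum.neutral)
        then obtain p where "p \<in> {p\<in>P. c p = k}" "b p q \<noteq> 0" by blast
        moreover from this have "q \<in> closure {q. chart_bump (c p) (x0 p) (r p) q \<noteq> 0}"
          by (intro subsetD[OF closure_subset] CollectI) (simp add: b_def)
        ultimately show "q \<in> ?K" using closure_chart_bump[OF cxr(1-3), of p] by fastforce
      qed
      then have "closure {q. \<rho> k q \<noteq> 0} \<subseteq> ?K" by (rule closure_minimal[OF _ cl])
      also have "?K \<subseteq> cdom k" using chart_ball_subset[OF cxr(1-3)] by auto
      finally show ?thesis .
    qed
    show "(\<Sum>k\<in>c ` P. \<rho> k p) = 1" for p
    proof -
      have "(\<Sum>k\<in>c ` P. \<rho> k p) = (\<Sum>k\<in>c ` P. \<Sum>p'\<in>{p'\<in>P. c p' = k}. b p' p) * inverse (tot p)"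
        by (simp add: \<rho>_def sum_distrib_right)
      also have "(\<Sum>k\<in>c ` P. \<Sum>p'\<in>{p'\<in>P. c p' = k}. b p' p) = tot p"
        unfolding tot_def by (rule sum.image_gen[OF P(1), symmetric])
      finally show ?thesis using tot[of p] by simp
    qed
  qed
  then show ?thesis by blast
qed

end

section \<open>Alternation and the wedge product of covectors\<close>

text \<open>Without the usual factor 1/n!, so that the wedge product is \<open>Alt\<close> of a
  tensor product divided by the two factorials of its degrees, as in
  \<open>cwedge_eq_Alt\<close>.\<close>

definition Alt :: "('v list \<Rightarrow> real) \<Rightarrow> 'v list \<Rightarrow> real" where
  "Alt F vs = (\<Sum>\<sigma> | \<sigma> permutes {..<length vs}. real_of_int (sign \<sigma>) * F (permute_list \<sigma> vs))"

lemma permutes_lessThan_permutation: "\<sigma> permutes {..<n::nat} \<Longrightarrow> permutation \<sigma>"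
  by (rule permutes_imp_permutation) auto

lemma sign_compose_lessThan:
  "\<sigma> permutes {..<n::nat} \<Longrightarrow> \<tau> permutes {..<n} \<Longrightarrow> sign (\<sigma> \<circ> \<tau>) = sign \<sigma> * sign \<tau>"
  by (intro sign_compose permutes_lessThan_permutation)

lemma real_sign_square [simp]: "real_of_int (sign p) * real_of_int (sign p) = 1"
  by (simp flip: of_int_mult)

lemma real_sign_left [simp]: "real_of_int (sign p) * (real_of_int (sign p) * x) = x"
  by (simp flip: mult.assoc)

lemma Alt_cong:
  assumes "\<And>ws. length ws = length vs \<Longrightarrow> F ws = G ws"
  shows "Alt F vs = Alt G vs"
  unfolding Alt_def by (intro sum.cong refl) (simp add: assms)

lemma Alt_add: "Alt (\<lambda>ws. F ws + G ws) vs = Alt F vs + Alt G vs"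
  by (simp add: Alt_def algebra_simps sum.distrib)

lemma Alt_cmult: "Alt (\<lambda>ws. c * F ws) vs = c * Alt F vs"
  by (simp add: Alt_def algebra_simps sum_distrib_left)

lemma Alt_cmult_right: "Alt (\<lambda>ws. F ws * c) vs = Alt F vs * c"
  using Alt_cmult[of c F] by (simp add: mult.commute)

lemma Alt_sum: "finite I \<Longrightarrow> Alt (\<lambda>ws. \<Sum>i\<in>I. F i ws) vs = (\<Sum>i\<in>I. Alt (F i) vs)"
  by (induction I rule: finite_induct) (auto simp: Alt_add Alt_def)

lemma Alt_permute:
  assumes "\<pi> permutes {..<length vs}"
  shows "Alt F (permute_list \<pi> vs) = sign \<pi> * Alt F vs"
proof -
  have "Alt F vs = (\<Sum>\<sigma> | \<sigma> permutes {..<length vs}. real_of_int (sign (\<pi> \<circ> \<sigma>)) * F (permute_list (\<pi> \<circ> \<sigma>) vs))"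
    unfolding Alt_def by (rule setum_permutations_compose_left[OF assms])
  also have "\<dots> = (\<Sum>\<sigma> | \<sigma> permutes {..<length vs}. sign \<pi> * (sign \<sigma> * F (permute_list \<sigma> (permute_list \<pi> vs))))"
    by (intro sum.cong refl) (simp add: sign_compose_lessThan[OF assms] permute_list_compose)
  also have "\<dots> = sign \<pi> * Alt F (permute_list \<pi> vs)"
    by (simp add: Alt_def sum_distrib_left)
  finally have "sign \<pi> * Alt F vs = real_of_int (sign \<pi> * sign \<pi>) * Alt F (permute_list \<pi> vs)"
    by simp
  then show ?thesis by simp
qed

text \<open>Here the slots of \<open>F\<close> are permuted instead of the vectors, so the summation
  index is multiplied by \<pi> from the other side than in \<open>Alt_permute\<close>. Block
  exchanges and Leibniz signs are both obtained this way.\<close>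

lemma Alt_permute_arg:
  assumes "\<pi> permutes {..<length vs}"
  shows "Alt (\<lambda>ws. F (permute_list \<pi> ws)) vs = sign \<pi> * Alt F vs"
proof -
  have "Alt F vs = (\<Sum>\<sigma> | \<sigma> permutes {..<length vs}. real_of_int (sign (\<sigma> \<circ> \<pi>)) * F (permute_list (\<sigma> \<circ> \<pi>) vs))"
    unfolding Alt_def by (rule sum_permutations_compose_right[OF assms])
  also have "\<dots> = (\<Sum>\<sigma> | \<sigma> permutes {..<length vs}. sign \<pi> * (sign \<sigma> * F (permute_list \<pi> (permute_list \<sigma> vs))))"
    by (intro sum.cong refl) (simp add: sign_compose_lessThan[OF _ assms] permute_list_compose[OF assms])
  also have "\<dots> = sign \<pi> * Alt (\<lambda>ws. F (permute_list \<pi> ws)) vs"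
    by (simp add: Alt_def sum_distrib_left)
  finally have "sign \<pi> * Alt F vs = real_of_int (sign \<pi> * sign \<pi>) * Alt (\<lambda>ws. F (permute_list \<pi> ws)) vs"
    by simp
  then show ?thesis by simp
qed

lemma permute_list_transpose_same:
  assumes "vs ! i = vs ! j" "i < length vs" "j < length vs"
  shows "permute_list (Transposition.transpose i j) vs = vs"
  using assms by (intro nth_equalityI) (auto simp: permute_list_def Transposition.transpose_def)

lemma Alt_repeat:
  assumes "vs ! i = vs ! j" "i < length vs" "j < length vs" "i \<noteq> j"
  shows "Alt F vs = 0"
proof -
  have "Transposition.transpose i j permutes {..<length vs}" using assms by (intro permutes_swap_id) auto
  from Alt_permute[OF this, of F] permute_list_transpose_same[OF assms(1-3)] assms(4)
  show ?thesis by (simp add: sign_swap_id)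
qed

lemma permute_list_update:
  assumes "\<sigma> permutes {..<length vs}" "i < length vs"
  shows "permute_list \<sigma> (vs[i := v]) = (permute_list \<sigma> vs)[inv \<sigma> i := v]"
proof (rule nth_equalityI)
  fix j assume j: "j < length (permute_list \<sigma> (vs[i := v]))"
  have "inv \<sigma> i = j \<longleftrightarrow> \<sigma> j = i" using permutes_inv_eq[OF assms(1)] by metis
  moreover have "\<sigma> j < length vs" using permutes_in_image[OF assms(1), of j] j by simp
  ultimately show "permute_list \<sigma> (vs[i := v]) ! j = (permute_list \<sigma> vs)[inv \<sigma> i := v] ! j"
    using j assms(2) by (auto simp: permute_list_def nth_list_update)
qed simp

section \<open>Multilinear and alternating functions\<close>

definition multilin :: "nat \<Rightarrow> ('v::real_vector list \<Rightarrow> real) \<Rightarrow> bool" where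
  "multilin k f \<longleftrightarrow> (\<forall>vs. length vs = k \<longrightarrow> (\<forall>i<k. linear (\<lambda>v. f (vs[i := v]))))"

lemma alternating_multilin: "alternating k f \<Longrightarrow> multilin k f"
  by (simp add: alternating_def multilin_def)

lemma linear_real_sum: "(\<And>i. i \<in> I \<Longrightarrow> linear (f i)) \<Longrightarrow> linear (\<lambda>v. \<Sum>i\<in>I. f i v :: real)"
  by (rule linear_compose_sum) blast

lemma linear_real_cmult: "linear f \<Longrightarrow> linear (\<lambda>v. c * f v :: real)"
  using linear_compose_scale_right[of f c] by simp

lemma Alt_linear:
  assumes "multilin (length vs) F" "i < length vs"
  shows "linear (\<lambda>v. Alt F (vs[i := v]))"
proof -
  have "linear (\<lambda>v. \<Sum>\<sigma> | \<sigma> permutes {..<length vs}.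
      real_of_int (sign \<sigma>) * F ((permute_list \<sigma> vs)[inv \<sigma> i := v]))"
  proof (intro linear_real_sum linear_real_cmult)
    fix \<sigma> assume "\<sigma> \<in> {\<sigma>. \<sigma> permutes {..<length vs}}"
    then have "inv \<sigma> i < length vs"
      using permutes_in_image[OF permutes_inv, of \<sigma> "{..<length vs}" i] assms(2) by simp
    then show "linear (\<lambda>v. F ((permute_list \<sigma> vs)[inv \<sigma> i := v]))"
      using assms(1) by (simp add: multilin_def)
  qed
  moreover have "Alt F (vs[i := v]) = (\<Sum>\<sigma> | \<sigma> permutes {..<length vs}.
      real_of_int (sign \<sigma>) * F ((permute_list \<sigma> vs)[inv \<sigma> i := v]))" for v
    unfolding Alt_def length_list_update
    by (intro sum.cong refl) (simp add: permute_list_update assms(2))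
  ultimately show ?thesis by simp
qed

lemma alternating_Alt: "multilin k F \<Longrightarrow> alternating k (Alt F)"
  unfolding alternating_def by (auto intro: Alt_linear Alt_repeat)

lemma multilin_tensor:
  assumes "multilin p f" "multilin q g"
  shows "multilin (p + q) (\<lambda>ws. f (take p ws) * g (drop p ws))"
  unfolding multilin_def
proof (intro allI impI)
  fix vs :: "'a list" and i assume vs: "length vs = p + q" and i: "i < p + q"
  show "linear (\<lambda>v. f (take p (vs[i := v])) * g (drop p (vs[i := v])))"
  proof (cases "i < p")
    case True
    then have "linear (\<lambda>v. f ((take p vs)[i := v]))" using assms(1) vs by (simp add: multilin_def)
    then have "linear (\<lambda>v. g (drop p vs) * f ((take p vs)[i := v]))" by (rule linear_real_cmult)
    then show ?thesis using True by (simp add: take_update_swap mult.commute)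
  next
    case False
    then have "linear (\<lambda>v. g ((drop p vs)[i - p := v]))" using assms(2) vs i by (simp add: multilin_def)
    then have "linear (\<lambda>v. f (take p vs) * g ((drop p vs)[i - p := v]))" by (rule linear_real_cmult)
    then show ?thesis using False by (simp add: drop_update_swap)
  qed
qed

text \<open>Polarization: \<open>alternating\<close> only asks for zero on repeated arguments, and
  expanding the zero value with \<open>a + b\<close> in both slots gives the change of sign.\<close>

lemma alternating_swap:
  assumes f: "alternating k f" and vs: "length vs = k" and ij: "i < k" "j < k" "i \<noteq> j"
  shows "f (permute_list (Transposition.transpose i j) vs) = - f vs"
proof -
  define a where "a = vs ! i"
  define b where "b = vs ! j"
  define h where "h v w = f (vs[i := v, j := w])" for v w
  have lin1: "linear (\<lambda>v. h v w)" for w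
  proof -
    have "linear (\<lambda>v. f ((vs[j := w])[i := v]))" using f vs ij by (simp add: alternating_def)
    then show ?thesis using ij by (simp add: h_def list_update_swap)
  qed
  have lin2: "linear (\<lambda>w. h v w)" for v
    using f vs ij by (simp add: alternating_def h_def)
  have zero: "h v v = 0" for v
  proof -
    have "\<forall>i<k. \<forall>j<k. i \<noteq> j \<and> (vs[i := v, j := v]) ! i = (vs[i := v, j := v]) ! j \<longrightarrow> f (vs[i := v, j := v]) = 0" for i j
      using f vs by (simp add: alternating_def)
    then show ?thesis using f vs ij unfolding h_def alternating_def
      by (metis (no_types, lifting) length_list_update nth_list_update)
  qed
  have "0 = h (a + b) (a + b)" by (simp add: zero)
  also have "\<dots> = h a a + h a b + (h b a + h b b)"
    by (simp add: linear_add[OF lin1] linear_add[OF lin2])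
  finally have "h b a = - h a b" by (simp add: zero)
  moreover have "h a b = f vs" by (simp add: h_def a_def b_def)
  moreover have "vs[i := b, j := a] = permute_list (Transposition.transpose i j) vs"
    using vs ij by (intro nth_equalityI) (auto simp: permute_list_def Transposition.transpose_def nth_list_update a_def b_def)
  ultimately show ?thesis by (simp add: h_def)
qed

lemma alternating_permute:
  assumes "alternating k f" "length vs = k" "\<sigma> permutes {..<k}"
  shows "f (permute_list \<sigma> vs) = real_of_int (sign \<sigma>) * f vs"
  using finite_lessThan[of k] assms(3)
proof (induction \<sigma> rule: permutes_rev_induct)
  case id
  then show ?case by simp
next
  case (swap a b p)
  have tr: "Transposition.transpose a b permutes {..<k}" using swap by (intro permutes_swap_id) auto
  then have "f (permute_list (p \<circ> Transposition.transpose a b) vs) = f (permute_list (Transposition.transpose a b) (permute_list p vs))"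
    using assms(2) by (simp add: permute_list_compose)
  also have "\<dots> = - f (permute_list p vs)"
    using alternating_swap[OF assms(1)] assms(2) swap by simp
  finally have "f (permute_list (p \<circ> Transposition.transpose a b) vs) = - f (permute_list p vs)" .
  moreover have "sign (p \<circ> Transposition.transpose a b) = - sign p"
    using sign_compose_lessThan[OF swap(4) tr] swap(3) by (simp add: sign_swap_id)
  ultimately show ?case using swap(5) by (simp only: of_int_minus minus_mult_left)
qed

lemma Alt_alternating:
  assumes "alternating (length vs) f"
  shows "Alt f vs = fact (length vs) * f vs"
proof -
  have "Alt f vs = (\<Sum>\<sigma> | \<sigma> permutes {..<length vs}. real_of_int (sign \<sigma>) * (sign \<sigma> * f vs))"
    unfolding Alt_def by (intro sum.cong refl) (simp add: alternating_permute[OF assms refl])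
  also have "\<dots> = fact (length vs) * f vs"
    by (simp add: card_permutations[of "{..<length vs}" "length vs"])
  finally show ?thesis .
qed

subsection \<open>Expansion along the first argument\<close>

definition remove_at :: "nat \<Rightarrow> 'v list \<Rightarrow> 'v list" where
  "remove_at i vs = take i vs @ drop (Suc i) vs"

lemma length_remove_at: "i < length vs \<Longrightarrow> length (remove_at i vs) = length vs - 1"
  by (simp add: remove_at_def)

lemma nth_remove_at: "i < length vs \<Longrightarrow> k < length vs - 1 \<Longrightarrow>
  remove_at i vs ! k = (if k < i then vs ! k else vs ! Suc k)"
  by (auto simp: remove_at_def nth_append min_def)

text \<open>The cycle that moves position \<open>i\<close> to the front.\<close>

definition front_perm :: "nat \<Rightarrow> nat \<Rightarrow> nat" where
  "front_perm i k = (if k = 0 then i else if k \<le> i then k - 1 else k)"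

lemma front_perm_0: "front_perm 0 = id"
  by (auto simp: front_perm_def fun_eq_iff)

lemma front_perm_Suc: "front_perm (Suc i) = Transposition.transpose i (Suc i) \<circ> front_perm i"
  by (auto simp: front_perm_def fun_eq_iff Transposition.transpose_def)

lemma front_perm_permutes: "i < n \<Longrightarrow> front_perm i permutes {..<n}"
proof (induction i)
  case 0
  show ?case unfolding front_perm_0 by (rule permutes_id)
next
  case (Suc i)
  then show ?case unfolding front_perm_Suc by (intro permutes_compose permutes_swap_id) auto
qed

lemma sign_front_perm: "sign (front_perm i) = (- 1) ^ i"
proof (induction i)
  case 0
  then show ?case by (simp add: front_perm_0)
next
  case (Suc i)
  have "sign (front_perm (Suc i)) = sign (Transposition.transpose i (Suc i)) * sign (front_perm i)"
    unfolding front_perm_Suc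
    by (rule sign_compose_lessThan[of _ "Suc (Suc i)"]) (auto intro: permutes_swap_id front_perm_permutes)
  then show ?case by (simp add: Suc sign_swap_id)
qed

lemma permute_list_front: "i < length vs \<Longrightarrow> permute_list (front_perm i) vs = vs ! i # remove_at i vs"
  by (intro nth_equalityI)
    (auto simp: permute_list_def front_perm_def nth_remove_at length_remove_at nth_Cons split: nat.splits)

definition lift_perm :: "(nat \<Rightarrow> nat) \<Rightarrow> nat \<Rightarrow> nat" where
  "lift_perm \<sigma> k = (case k of 0 \<Rightarrow> 0 | Suc j \<Rightarrow> Suc (\<sigma> j))"

lemma lift_perm_id: "lift_perm id = id"
  and lift_perm_transpose: "lift_perm (Transposition.transpose a b \<circ> p) = Transposition.transpose (Suc a) (Suc b) \<circ> lift_perm p"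
  by (auto simp: lift_perm_def fun_eq_iff Transposition.transpose_def split: nat.splits)

lemma lift_perm:
  assumes "\<sigma> permutes {..<n}"
  shows "lift_perm \<sigma> permutes {..<Suc n}" "sign (lift_perm \<sigma>) = sign \<sigma>"
proof -
  have "lift_perm \<sigma> permutes {..<Suc n} \<and> sign (lift_perm \<sigma>) = sign \<sigma>"
    using assms finite_lessThan[of n]
  proof (induction \<sigma> rule: permutes_induct)
    case id
    show ?case unfolding lift_perm_id by (intro conjI permutes_id refl)
  next
    case (swap a b p)
    have tr: "Transposition.transpose (Suc a) (Suc b) permutes {..<Suc n}" "Transposition.transpose a b permutes {..<n}"
      using swap by (auto intro: permutes_swap_id)
    have IH: "lift_perm p permutes {..<Suc n}" "sign (lift_perm p) = sign p" using swap by auto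
    have "sign (Transposition.transpose (Suc a) (Suc b) \<circ> lift_perm p) = sign (Transposition.transpose a b \<circ> p)"
      unfolding sign_compose_lessThan[OF tr(1) IH(1)] sign_compose_lessThan[OF tr(2) swap(4)]
      using IH(2) by (simp add: sign_swap_id)
    then show ?case
      unfolding lift_perm_transpose using permutes_compose[OF IH(1) tr(1)] by blast
  qed
  then show "lift_perm \<sigma> permutes {..<Suc n}" "sign (lift_perm \<sigma>) = sign \<sigma>" by auto
qed

lemma permute_list_lift: "permute_list (lift_perm \<sigma>) (v # vs) = v # permute_list \<sigma> vs"
  by (simp add: permute_list_def upt_conv_Cons map_Suc_upt[symmetric] lift_perm_def o_def del: upt_Suc)

text \<open>A permutation of \<open>Suc n\<close> positions amounts to the position brought to the
  front together with a permutation of the rest. Injectivity is visible from the value at 0;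
  surjectivity follows by counting.\<close>

lemma bij_front_lift:
  "bij_betw (\<lambda>(i, \<sigma>). front_perm i \<circ> lift_perm \<sigma>) ({..<Suc n} \<times> {\<sigma>. \<sigma> permutes {..<n}}) {\<tau>. \<tau> permutes {..<Suc n}}"
proof -
  let ?A = "{..<Suc n} \<times> {\<sigma>. \<sigma> permutes {..<n}}" and ?h = "\<lambda>(i, \<sigma>). front_perm i \<circ> lift_perm \<sigma>"
  have inj: "inj_on ?h ?A"
  proof (rule inj_onI, clarify)
    fix i \<sigma> j \<tau>
    assume i: "i < Suc n" and j: "j < Suc n" and eq: "front_perm i \<circ> lift_perm \<sigma> = front_perm j \<circ> lift_perm \<tau>"
    have "(front_perm i \<circ> lift_perm \<sigma>) 0 = i" "(front_perm j \<circ> lift_perm \<tau>) 0 = j"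
      by (simp_all add: front_perm_def lift_perm_def)
    then have ij: "i = j" using eq by simp
    have "inj (front_perm i)" using front_perm_permutes[OF i] permutes_inj by blast
    then have l: "lift_perm \<sigma> = lift_perm \<tau>" using eq ij by (auto simp: fun_eq_iff inj_def)
    have "\<sigma> k = \<tau> k" for k using fun_cong[OF l, of "Suc k"] by (simp add: lift_perm_def)
    then show "i = j \<and> \<sigma> = \<tau>" using ij by auto
  qed
  have fin: "finite {\<tau>. \<tau> permutes {..<m}}" for m :: nat by (simp add: finite_permutations)
  have "?h ` ?A \<subseteq> {\<tau>. \<tau> permutes {..<Suc n}}"
    by (auto intro!: permutes_compose lift_perm front_perm_permutes)
  moreover have "card (?h ` ?A) = card {\<tau>. \<tau> permutes {..<Suc n}}"
    using card_image[OF inj] by (simp add: card_cartesian_product card_permutations)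
  ultimately have "?h ` ?A = {\<tau>. \<tau> permutes {..<Suc n}}"
    by (intro card_subset_eq fin)
  with inj show ?thesis by (simp add: bij_betw_def)
qed

text \<open>Laplace expansion: the permutations are grouped by the position they bring to the front,
  at the cost of a cycle of sign \<open>(- 1) ^ i\<close>.\<close>

lemma Alt_expand:
  assumes "length vs = Suc n"
  shows "Alt F vs = (\<Sum>i<Suc n. (- 1) ^ i * Alt (\<lambda>ws. F (vs ! i # ws)) (remove_at i vs))"
proof -
  define g where "g i \<sigma> = real_of_int (sign (front_perm i \<circ> lift_perm \<sigma>)) *
    F (permute_list (front_perm i \<circ> lift_perm \<sigma>) vs)" for i \<sigma>
  have "Alt F vs = (\<Sum>x\<in>{..<Suc n} \<times> {\<sigma>. \<sigma> permutes {..<n}}. g (fst x) (snd x))"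
    unfolding Alt_def assms g_def
    using sum.reindex_bij_betw[OF bij_front_lift, of "\<lambda>\<tau>. real_of_int (sign \<tau>) * F (permute_list \<tau> vs)" n]
    unfolding case_prod_unfold by (rule sym)
  also have "\<dots> = (\<Sum>i<Suc n. \<Sum>\<sigma> | \<sigma> permutes {..<n}. g i \<sigma>)"
    using sum.cartesian_product[of g "{\<sigma>. \<sigma> permutes {..<n}}" "{..<Suc n}"]
    unfolding case_prod_unfold by (rule sym)
  also have "\<dots> = (\<Sum>i<Suc n. (- 1) ^ i * Alt (\<lambda>ws. F (vs ! i # ws)) (remove_at i vs))"
  proof (rule sum.cong[OF refl])
    fix i assume i: "i \<in> {..<Suc n}"
    have "g i \<sigma> =
        (- 1) ^ i * (sign \<sigma> * F (vs ! i # permute_list \<sigma> (remove_at i vs)))" if "\<sigma> permutes {..<n}" for \<sigma>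
    proof -
      have "sign (front_perm i \<circ> lift_perm \<sigma>) = (- 1) ^ i * sign \<sigma>"
        using i that lift_perm[OF that] front_perm_permutes
        by (subst sign_compose_lessThan[of _ "Suc n"]) (auto simp: sign_front_perm)
      moreover have "permute_list (front_perm i \<circ> lift_perm \<sigma>) vs = vs ! i # permute_list \<sigma> (remove_at i vs)"
        using i assms lift_perm(1)[OF that]
        by (simp add: permute_list_compose permute_list_front permute_list_lift)
      ultimately show ?thesis by (simp add: g_def)
    qed
    then show "(\<Sum>\<sigma> | \<sigma> permutes {..<n}. g i \<sigma>) =
      (- 1) ^ i * Alt (\<lambda>ws. F (vs ! i # ws)) (remove_at i vs)"
      using i assms by (simp add: Alt_def length_remove_at sum_distrib_left)
  qed
  finally show ?thesis .
qed

subsection \<open>The wedge product of covectors\<close>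

text \<open>This is \<open>wedge\<close> at a fixed chart and point, so that the exterior algebra
  can be developed for single covectors.\<close>

definition cwedge :: "nat \<Rightarrow> nat \<Rightarrow> ('v list \<Rightarrow> real) \<Rightarrow> ('v list \<Rightarrow> real) \<Rightarrow> 'v list \<Rightarrow> real" where
  "cwedge p q f g vs = (\<Sum>\<sigma> | \<sigma> permutes {..<p + q}.
     real_of_int (sign \<sigma>) * f (map (\<lambda>i. vs ! \<sigma> i) [0..<p]) * g (map (\<lambda>i. vs ! \<sigma> i) [p..<p + q]))
     / (fact p * fact q)"

lemma wedge_eq_cwedge: "wedge p q \<alpha> \<beta> c x = cwedge p q (\<alpha> c x) (\<beta> c x)"
  unfolding wedge_def cwedge_def ..

lemma cwedge_eq_Alt:
  assumes "length vs = p + q"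
  shows "cwedge p q f g vs = Alt (\<lambda>ws. f (take p ws) * g (drop p ws)) vs / (fact p * fact q)"
proof -
  have t: "take p (permute_list \<sigma> vs) = map (\<lambda>i. vs ! \<sigma> i) [0..<p]" for \<sigma>
    by (rule nth_equalityI) (auto simp: permute_list_def assms)
  have d: "drop p (permute_list \<sigma> vs) = map (\<lambda>i. vs ! \<sigma> i) [p..<p + q]" for \<sigma>
    by (rule nth_equalityI) (auto simp: permute_list_def assms)
  show ?thesis unfolding cwedge_def Alt_def assms t d by (simp only: mult.assoc)
qed

lemma alternating_cong:
  assumes "\<And>vs. length vs = k \<Longrightarrow> f vs = g vs" "alternating k f"
  shows "alternating k g"
proof -
  have "linear (\<lambda>v. g (vs[i := v]))" if "length vs = k" "i < k" for vs i
  proof -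
    have "linear (\<lambda>v. f (vs[i := v]))" using assms(2) that by (simp add: alternating_def)
    moreover have "f (vs[i := v]) = g (vs[i := v])" for v using assms(1) that by simp
    ultimately show ?thesis by simp
  qed
  moreover have "g vs = 0" if "length vs = k" "i < k" "j < k" "i \<noteq> j" "vs ! i = vs ! j" for vs i j
    using assms that by (metis alternating_def)
  ultimately show ?thesis unfolding alternating_def by blast
qed

lemma alternating_cmult: "alternating k f \<Longrightarrow> alternating k (\<lambda>vs. c * f vs)"
  unfolding alternating_def by (auto intro: linear_real_cmult)

lemma alternating_diff: "alternating k f \<Longrightarrow> alternating k g \<Longrightarrow> alternating k (\<lambda>vs. f vs - g vs)"
  unfolding alternating_def by (auto intro: linear_compose_sub)

lemma alternating_cwedge:
  assumes "alternating p f" "alternating q g"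
  shows "alternating (p + q) (cwedge p q f g)"
proof -
  have "alternating (p + q) (\<lambda>vs. (1 / (fact p * fact q)) * Alt (\<lambda>ws. f (take p ws) * g (drop p ws)) vs)"
    by (intro alternating_cmult alternating_Alt multilin_tensor alternating_multilin assms)
  then show ?thesis by (rule alternating_cong[rotated]) (simp add: cwedge_eq_Alt)
qed

lemma cwedge_cong:
  assumes "\<And>vs. length vs = p \<Longrightarrow> f vs = f' vs" "\<And>vs. length vs = q \<Longrightarrow> g vs = g' vs"
  shows "cwedge p q f g = cwedge p q f' g'"
  unfolding cwedge_def by (simp add: assms)

lemma cwedge_pullback:
  assumes "length vs = p + q"
  shows "cwedge p q (\<lambda>ws. f (map A ws)) (\<lambda>ws. g (map A ws)) vs = cwedge p q f g (map A vs)"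
proof -
  have "map A vs ! \<sigma> i = A (vs ! \<sigma> i)" if "\<sigma> permutes {..<p + q}" "i < p + q" for \<sigma> i
    using permutes_in_image[OF that(1), of i] that assms by simp
  then show ?thesis unfolding cwedge_def by (auto intro!: arg_cong2[of _ _ _ _ "(/)"] sum.cong arg_cong2[of _ _ _ _ "(*)"] arg_cong[of _ _ f] arg_cong[of _ _ g])
qed

lemma cwedge_diff_left: "cwedge p q (\<lambda>vs. f vs - f' vs) g vs = cwedge p q f g vs - cwedge p q f' g vs"
  and cwedge_diff_right: "cwedge p q f (\<lambda>vs. g vs - g' vs) vs = cwedge p q f g vs - cwedge p q f g' vs"
  and cwedge_cmult_left: "cwedge p q (\<lambda>vs. c * f vs) g vs = c * cwedge p q f g vs"
  by (simp_all add: cwedge_def algebra_simps sum_subtractf sum_distrib_left diff_divide_distrib)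

lemma cwedge_0_left:
  assumes "alternating q g" "length vs = q"
  shows "cwedge 0 q f g vs = f [] * g vs"
  using assms Alt_alternating[of vs g] by (simp add: cwedge_eq_Alt Alt_cmult)

lemma cwedge_0_right:
  assumes "alternating p f" "length vs = p"
  shows "cwedge p 0 f g vs = f vs * g []"
proof -
  have "Alt (\<lambda>ws. f (take p ws) * g (drop p ws)) vs = Alt (\<lambda>ws. f ws * g []) vs"
    by (rule Alt_cong) (use assms in auto)
  then show ?thesis using assms Alt_alternating[of vs f] by (simp add: cwedge_eq_Alt Alt_cmult_right)
qed

text \<open>Two Laplace expansions take out the arguments of \<open>f\<close>. The alternation left
  over acts on \<open>g\<close> alone and contributes \<open>fact q\<close>, which cancels; the
  factor 1/2 remains from \<open>fact 2\<close> because the two arguments of \<open>f\<close> occur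
  in both orders.\<close>

lemma cwedge_2_expand:
  assumes "alternating q g" "length vs = Suc (Suc q)"
  shows "cwedge 2 q f g vs = (\<Sum>i<Suc (Suc q). \<Sum>j<Suc q. (- 1) ^ (i + j) *
    f [vs ! i, remove_at i vs ! j] * g (remove_at j (remove_at i vs))) / 2"
proof -
  have A: "Alt (\<lambda>ws. f (take 2 ws) * g (drop 2 ws)) vs = (\<Sum>i<Suc (Suc q). (- 1) ^ i * (\<Sum>j<Suc q. (- 1) ^ j *
      Alt (\<lambda>ws. f [vs ! i, remove_at i vs ! j] * g ws) (remove_at j (remove_at i vs))))"
    using assms(2) by (simp only: Alt_expand)
      (intro sum.cong refl, simp add: Alt_expand[of _ q] length_remove_at numeral_2_eq_2 del: sum.lessThan_Suc)
  have B: "Alt (\<lambda>ws. f [vs ! i, remove_at i vs ! j] * g ws) (remove_at j (remove_at i vs)) =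
      f [vs ! i, remove_at i vs ! j] * (fact q * g (remove_at j (remove_at i vs)))"
    if "i < Suc (Suc q)" "j < Suc q" for i j
    using Alt_alternating[of "remove_at j (remove_at i vs)" g] that assms
    by (simp add: Alt_cmult length_remove_at)
  have "Alt (\<lambda>ws. f (take 2 ws) * g (drop 2 ws)) vs = fact q * (\<Sum>i<Suc (Suc q). \<Sum>j<Suc q. (- 1) ^ (i + j) *
      f [vs ! i, remove_at i vs ! j] * g (remove_at j (remove_at i vs)))"
    unfolding A sum_distrib_left
    by (intro sum.cong refl) (subst B; simp add: power_add mult_ac)
  then show ?thesis using assms(2) by (simp add: cwedge_eq_Alt del: sum.lessThan_Suc)
qed

text \<open>Exchanging the two blocks is a rotation by \<open>q\<close> positions. For
  \<open>q = l + l\<close> it is the square of the rotation by \<open>l\<close>, hence of sign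
  1.\<close>

lemma cwedge_commute_even:
  assumes "even q" "length vs = p + q"
  shows "cwedge q p g f vs = cwedge p q f g vs"
proof -
  let ?n = "p + q"
  define r where "r m i = (if i < ?n then (i + m) mod ?n else i)" for m i
  have comp: "r m \<circ> r l = r (m + l)" for m l
  proof
    fix i
    show "(r m \<circ> r l) i = r (m + l) i"
    proof (cases "i < ?n")
      case True
      then have "(i + l) mod ?n < ?n" by (intro mod_less_divisor) linarith
      with True show ?thesis by (simp add: r_def mod_simps ac_simps)
    qed (simp add: r_def)
  qed
  have r: "r m permutes {..<?n}" for m
  proof (rule bij_imp_permutes)
    have "inj_on (r m) {..<?n}"
    proof (rule inj_on_inverseI)
      show "r (m * (?n - 1)) (r m i) = i" if "i \<in> {..<?n}" for i
      proof -
        \<comment> \<open>Rotating on by \<open>m * (?n - 1)\<close> positions completes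
          \<open>m\<close> full turns, which supplies a left inverse of \<open>r m\<close>.\<close>
        have "m * (?n - 1) + m = m * ?n" using that by (cases ?n) auto
        then have "r (m * (?n - 1)) (r m i) = r (m * ?n) i" using fun_cong[OF comp, of "m * (?n - 1)" m i] by (simp only: o_apply)
        also have "\<dots> = i" using that by (simp add: r_def)
        finally show ?thesis .
      qed
    qed
    moreover have "r m ` {..<?n} \<subseteq> {..<?n}" by (auto simp: r_def intro!: mod_less_divisor)
    ultimately show "bij_betw (r m) {..<?n} {..<?n}"
      by (simp add: bij_betw_def endo_inj_surj)
  qed (auto simp: r_def)
  obtain l where "q = l + l" using assms(1) by (auto simp: even_iff_mod_2_eq_zero dvd_def mult_2)
  then have "r q = r l \<circ> r l" by (simp add: comp)
  then have sgn: "sign (r q) = 1" using sign_compose_lessThan[OF r r] by simp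
  have rot: "permute_list (r q) ws = drop q ws @ take q ws" if "length ws = ?n" for ws :: "'a list"
  proof -
    have "permute_list (r q) ws = rotate q ws"
      using that by (intro nth_equalityI) (auto simp: permute_list_def r_def nth_rotate ac_simps)
    then show ?thesis using that by (cases "p = 0") (auto simp: rotate_drop_take)
  qed
  have "Alt (\<lambda>ws. g (take q ws) * f (drop q ws)) vs =
      Alt (\<lambda>ws. f (take p (permute_list (r q) ws)) * g (drop p (permute_list (r q) ws))) vs"
    by (rule Alt_cong) (use assms(2) in \<open>simp add: rot\<close>)
  also have "\<dots> = Alt (\<lambda>ws. f (take p ws) * g (drop p ws)) vs"
    using Alt_permute_arg[of "r q" vs] r assms(2) sgn by simp
  finally show ?thesis using assms(2) by (simp add: cwedge_eq_Alt mult.commute add.commute)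
qed

section \<open>Differential forms\<close>

lemma cwedge_has_derivative:
  fixes f g :: "'v list \<Rightarrow> 'w::real_normed_vector \<Rightarrow> real"
  assumes "\<And>us. length us = p \<Longrightarrow> (f us has_derivative f' us) (at x)"
    and "\<And>us. length us = q \<Longrightarrow> (g us has_derivative g' us) (at x)"
  shows "((\<lambda>y. cwedge p q (\<lambda>us. f us y) (\<lambda>us. g us y) ws) has_derivative
    (\<lambda>v. cwedge p q (\<lambda>us. f' us v) (\<lambda>us. g us x) ws + cwedge p q (\<lambda>us. f us x) (\<lambda>us. g' us v) ws)) (at x)"
proof -
  define A B where "A \<sigma> = map (\<lambda>i. ws ! \<sigma> i) [0..<p]" and "B \<sigma> = map (\<lambda>i. ws ! \<sigma> i) [p..<p + q]" for \<sigma> :: "nat \<Rightarrow> nat"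
  have len: "length (A \<sigma>) = p" "length (B \<sigma>) = q" for \<sigma> by (simp_all add: A_def B_def)
  define K where "K = (fact p * fact q :: real)"
  have "((\<lambda>y. inverse K * (\<Sum>\<sigma> | \<sigma> permutes {..<p + q}. real_of_int (sign \<sigma>) * (f (A \<sigma>) y * g (B \<sigma>) y))) has_derivative
    (\<lambda>v. inverse K * (\<Sum>\<sigma> | \<sigma> permutes {..<p + q}. real_of_int (sign \<sigma>) * (f (A \<sigma>) x * g' (B \<sigma>) v + f' (A \<sigma>) v * g (B \<sigma>) x)))) (at x)"
    by (intro has_derivative_mult_right has_derivative_sum has_derivative_mult assms len)
  moreover have "cwedge p q F G ws = inverse K * (\<Sum>\<sigma> | \<sigma> permutes {..<p + q}. real_of_int (sign \<sigma>) * (F (A \<sigma>) * G (B \<sigma>)))" for F G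
    by (simp add: cwedge_def A_def B_def K_def divide_inverse_commute mult.assoc)
  ultimately show ?thesis
    by (simp add: algebra_simps sum.distrib sum_distrib_left)
qed

text \<open>Moving the distinguished argument \<open>us ! j\<close> to the front is a cycle of sign \<open>(-1)\<^sup>j\<close>, which
  makes all terms of the inner sum contribute equally.\<close>

lemma cwedge_derivation_left:
  assumes vs: "length vs = Suc (p + q)"
  shows "(\<Sum>i<Suc (p + q). (- 1) ^ i * cwedge p q (D (vs ! i)) g (remove_at i vs)) =
    cwedge (Suc p) q (\<lambda>us. \<Sum>j<Suc p. (- 1) ^ j * D (us ! j) (remove_at j us)) g vs"
proof -
  define G where "G ws = D (hd ws) (take p (tl ws)) * g (drop p (tl ws))" for ws
  have L: "(\<Sum>i<Suc (p + q). (- 1) ^ i * cwedge p q (D (vs ! i)) g (remove_at i vs)) = Alt G vs / (fact p * fact q)"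
    using vs by (simp add: Alt_expand cwedge_eq_Alt length_remove_at G_def sum_divide_distrib del: sum.lessThan_Suc)
  have front: "D (take (Suc p) ws ! j) (remove_at j (take (Suc p) ws)) * g (drop (Suc p) ws) =
      G (permute_list (front_perm j) ws)" if "length ws = Suc (p + q)" "j < Suc p" for ws j
  proof -
    have "take p (remove_at j ws) = remove_at j (take (Suc p) ws)" "drop p (remove_at j ws) = drop (Suc p) ws"
      using that by (cases "j = p"; auto simp: remove_at_def take_drop min_def)+
    moreover have "permute_list (front_perm j) ws = ws ! j # remove_at j ws"
      using that by (intro permute_list_front) simp
    ultimately show ?thesis using that by (simp add: G_def)
  qed
  have "Alt (\<lambda>ws. (\<Sum>j<Suc p. (- 1) ^ j * D (take (Suc p) ws ! j) (remove_at j (take (Suc p) ws))) * g (drop (Suc p) ws)) vs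
      = Alt (\<lambda>ws. \<Sum>j<Suc p. (- 1) ^ j * G (permute_list (front_perm j) ws)) vs"
  proof (rule Alt_cong, unfold sum_distrib_right mult.assoc, intro sum.cong refl arg_cong[of _ _ "(*) _"] front)
    show "length ws = Suc (p + q)" if "length ws = length vs" for ws :: "'a list" using that vs by simp
  qed simp
  also have "\<dots> = (\<Sum>j<Suc p. (- 1) ^ j * (sign (front_perm j) * Alt G vs))"
    using vs by (simp add: Alt_sum Alt_cmult Alt_permute_arg front_perm_permutes del: sum.lessThan_Suc)
  also have "\<dots> = (\<Sum>j<Suc p. Alt G vs)"
    by (rule sum.cong) (auto simp: sign_front_perm simp flip: power_add mult.assoc)
  finally have "Alt (\<lambda>ws. (\<Sum>j<Suc p. (- 1) ^ j * D (take (Suc p) ws ! j) (remove_at j (take (Suc p) ws))) * g (drop (Suc p) ws)) vs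
      = real (Suc p) * Alt G vs" by simp
  then show ?thesis
    using vs by (simp add: L cwedge_eq_Alt field_simps del: sum.lessThan_Suc of_nat_Suc)
qed

text \<open>The distinguished argument now sits at position \<open>p + j\<close>, behind the
  \<open>p\<close> arguments of \<open>f\<close>. The sign of the cycle is accordingly
  \<open>(-1)^(p + j)\<close>, and the surplus \<open>(-1)^p\<close> is the sign of the Leibniz
  rule.\<close>

lemma cwedge_derivation_right:
  assumes vs: "length vs = Suc (p + q)"
  shows "(\<Sum>i<Suc (p + q). (- 1) ^ i * cwedge p q f (D (vs ! i)) (remove_at i vs)) =
    (- 1) ^ p * cwedge p (Suc q) f (\<lambda>us. \<Sum>j<Suc q. (- 1) ^ j * D (us ! j) (remove_at j us)) vs"
proof -
  define G where "G ws = f (take p (tl ws)) * D (hd ws) (drop p (tl ws))" for ws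
  have L: "(\<Sum>i<Suc (p + q). (- 1) ^ i * cwedge p q f (D (vs ! i)) (remove_at i vs)) = Alt G vs / (fact p * fact q)"
    using vs by (simp add: Alt_expand cwedge_eq_Alt length_remove_at G_def sum_divide_distrib del: sum.lessThan_Suc)
  have front: "f (take p ws) * D (drop p ws ! j) (remove_at j (drop p ws)) =
      G (permute_list (front_perm (p + j)) ws)" if "length ws = Suc (p + q)" "j < Suc q" for ws j
  proof -
    have "take p (remove_at (p + j) ws) = take p ws" "drop p (remove_at (p + j) ws) = remove_at j (drop p ws)"
      using that by (auto simp: remove_at_def drop_take min_def add.commute)
    moreover have "permute_list (front_perm (p + j)) ws = ws ! (p + j) # remove_at (p + j) ws"
      using that by (intro permute_list_front) simp
    ultimately show ?thesis using that by (simp add: G_def)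
  qed
  have "Alt (\<lambda>ws. f (take p ws) * (\<Sum>j<Suc q. (- 1) ^ j * D (drop p ws ! j) (remove_at j (drop p ws)))) vs
      = Alt (\<lambda>ws. \<Sum>j<Suc q. (- 1) ^ j * G (permute_list (front_perm (p + j)) ws)) vs"
  proof (rule Alt_cong, unfold sum_distrib_left mult.left_commute[of "f _"], intro sum.cong refl arg_cong[of _ _ "(*) _"] front)
    show "length ws = Suc (p + q)" if "length ws = length vs" for ws :: "'a list" using that vs by simp
  qed simp
  also have "\<dots> = (\<Sum>j<Suc q. (- 1) ^ j * (sign (front_perm (p + j)) * Alt G vs))"
    using vs by (simp add: Alt_sum Alt_cmult Alt_permute_arg front_perm_permutes del: sum.lessThan_Suc)
  also have "\<dots> = (\<Sum>j<Suc q. (- 1) ^ p * Alt G vs)"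
    by (rule sum.cong) (auto simp: sign_front_perm power_add simp flip: mult.assoc)
  finally have "Alt (\<lambda>ws. f (take p ws) * (\<Sum>j<Suc q. (- 1) ^ j * D (drop p ws ! j) (remove_at j (drop p ws)))) vs
      = real (Suc q) * ((- 1) ^ p * Alt G vs)" by simp
  then show ?thesis
    using vs by (simp add: L cwedge_eq_Alt field_simps del: sum.lessThan_Suc of_nat_Suc flip: power_add)
qed

lemma ext_d_remove_at: "ext_d \<eta> c x vs = (\<Sum>i<length vs.
    (- 1) ^ i * frechet_derivative (\<lambda>y. \<eta> c y (remove_at i vs)) (at x) (vs ! i))"
  by (simp add: ext_d_def remove_at_def)

context compact_complex_manifold
begin

lemma smooth_form_alternating: "smooth_form M k \<eta> \<Longrightarrow> c \<in> M \<Longrightarrow> x \<in> cran c \<Longrightarrow> alternating k (\<eta> c x)"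
  unfolding smooth_form_def by (drule conjunct1) simp

lemma smooth_form_smooth:
  "smooth_form M k \<eta> \<Longrightarrow> c \<in> M \<Longrightarrow> length vs = k \<Longrightarrow> smooth_on (cran c) (\<lambda>x. \<eta> c x vs)"
  unfolding smooth_form_def by (drule conjunct1) simp

lemma smooth_form_compat:
  assumes "smooth_form M k \<eta>" "c \<in> M" "c' \<in> M" "p \<in> cdom c" "p \<in> cdom c'" "length vs = k"
  shows "\<eta> c (cmap c p) vs =
    \<eta> c' (cmap c' p) (map (frechet_derivative (\<lambda>x. cmap c' (cinv c x)) (at (cmap c p))) vs)"
  using assms(1)[unfolded smooth_form_def, THEN conjunct2, rule_format, OF assms(2,3) IntI[OF assms(4,5)] assms(6)] .

lemma smooth_form_has_derivative:
  "smooth_form M k \<eta> \<Longrightarrow> c \<in> M \<Longrightarrow> length vs = k \<Longrightarrow> x \<in> cran c \<Longrightarrow>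
    ((\<lambda>x. \<eta> c x vs) has_derivative frechet_derivative (\<lambda>x. \<eta> c x vs) (at x)) (at x)"
  by (rule smooth_on_has_derivative[OF smooth_form_smooth])

section \<open>Operations on smooth forms\<close>

lemma smooth_form_wedge:
  assumes a: "smooth_form M p \<alpha>" and b: "smooth_form M q \<beta>"
  shows "smooth_form M (p + q) (wedge p q \<alpha> \<beta>)"
  unfolding smooth_form_def
proof (intro conjI ballI allI impI)
  fix c x assume "c \<in> M" "x \<in> cran c"
  then show "alternating (p + q) (wedge p q \<alpha> \<beta> c x)"
    unfolding wedge_eq_cwedge by (intro alternating_cwedge smooth_form_alternating[OF a] smooth_form_alternating[OF b])
next
  fix c and vs :: "(complex, 'n) vec list" assume c: "c \<in> M" and "length vs = p + q"
  show "smooth_on (cran c) (\<lambda>x. wedge p q \<alpha> \<beta> c x vs)"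
    unfolding wedge_def divide_inverse
    by (intro smooth_on_mult smooth_on_sum smooth_on_const open_cran[OF c]
        smooth_form_smooth[OF a c] smooth_form_smooth[OF b c]) auto
next
  fix c c' r and vs :: "(complex, 'n) vec list"
  assume c: "c \<in> M" "c' \<in> M" "r \<in> cdom c \<inter> cdom c'" and vs: "length vs = p + q"
  let ?A = "frechet_derivative (\<lambda>x. cmap c' (cinv c x)) (at (cmap c r))"
  have "cwedge p q (\<alpha> c (cmap c r)) (\<beta> c (cmap c r)) =
      cwedge p q (\<lambda>us. \<alpha> c' (cmap c' r) (map ?A us)) (\<lambda>us. \<beta> c' (cmap c' r) (map ?A us))"
    by (intro cwedge_cong smooth_form_compat[OF a] smooth_form_compat[OF b]) (use c in auto)
  then show "wedge p q \<alpha> \<beta> c (cmap c r) vs = wedge p q \<alpha> \<beta> c' (cmap c' r) (map ?A vs)"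
    unfolding wedge_eq_cwedge by (simp only: cwedge_pullback[OF vs])
qed

lemma smooth_formI:
  assumes "\<And>c x. c \<in> M \<Longrightarrow> x \<in> cran c \<Longrightarrow> alternating k (\<eta> c x)"
    and "\<And>c vs. c \<in> M \<Longrightarrow> length vs = k \<Longrightarrow> smooth_on (cran c) (\<lambda>x. \<eta> c x vs)"
    and "\<And>c c' p vs. c \<in> M \<Longrightarrow> c' \<in> M \<Longrightarrow> p \<in> cdom c \<Longrightarrow> p \<in> cdom c' \<Longrightarrow> length vs = k \<Longrightarrow>
      \<eta> c (cmap c p) vs =
      \<eta> c' (cmap c' p) (map (frechet_derivative (\<lambda>x. cmap c' (cinv c x)) (at (cmap c p))) vs)"
  shows "smooth_form M k \<eta>"
  unfolding smooth_form_def by (intro conjI ballI allI impI; (elim IntE)?; rule assms)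

lemma smooth_form_diff:
  assumes a: "smooth_form M k \<alpha>" and b: "smooth_form M k \<beta>"
  shows "smooth_form M k (form_diff \<alpha> \<beta>)"
  unfolding form_diff_def
  by (rule smooth_formI)
    (simp_all add: alternating_diff smooth_form_alternating[OF a] smooth_form_alternating[OF b]
      smooth_on_diff open_cran smooth_form_smooth[OF a] smooth_form_smooth[OF b],
     intro arg_cong2[of _ _ _ _ "(-)"] smooth_form_compat[OF a] smooth_form_compat[OF b])

lemma smooth_form_scale:
  assumes a: "smooth_form M k \<alpha>"
  shows "smooth_form M k (form_scale r \<alpha>)"
  unfolding form_scale_def
  by (rule smooth_formI)
    (simp_all add: alternating_cmult smooth_form_alternating[OF a]
      smooth_on_mult smooth_on_const open_cran smooth_form_smooth[OF a] smooth_form_compat[OF a, symmetric])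

lemma smooth_fun_on_UNIV_iff: "smooth_fun_on M UNIV f \<longleftrightarrow> (\<forall>c\<in>M. smooth_on (cran c) (\<lambda>x. f (cinv c x)))"
  by (simp add: smooth_fun_on_def cran_def)

lemma smooth_form_zero: "smooth_form M k form_zero"
  by (simp add: smooth_form_def form_zero_def smooth_on_const alternating_def linear_zero)

lemma smooth_form_one: "smooth_form M 0 form_one"
  by (simp add: smooth_form_def form_one_def smooth_on_const alternating_def)

section \<open>Rules for the exterior derivative\<close>

lemma ext_d_zero: "ext_d form_zero = (form_zero :: ('a, 'n) form)"
  by (simp add: ext_d_def form_zero_def fun_eq_iff)

lemma ext_d_one: "ext_d form_one = (form_zero :: ('a, 'n) form)"
  by (simp add: ext_d_def form_one_def form_zero_def fun_eq_iff)

lemma ext_d_scale: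
  assumes "smooth_form M k \<alpha>" "c \<in> M" "x \<in> cran c" "length vs = Suc k"
  shows "ext_d (form_scale r \<alpha>) c x vs = r * ext_d \<alpha> c x vs"
proof -
  have "frechet_derivative (\<lambda>y. r * \<alpha> c y (remove_at i vs)) (at x) = (\<lambda>v. r * frechet_derivative (\<lambda>y. \<alpha> c y (remove_at i vs)) (at x) v)"
    if "i < Suc k" for i
    using assms that
    by (intro frechet_derivative_at[symmetric] has_derivative_mult_right smooth_form_has_derivative[OF assms(1,2)])
      (auto simp: length_remove_at)
  then show ?thesis using assms(4)
    by (simp add: ext_d_remove_at form_scale_def sum_distrib_left mult_ac del: sum.lessThan_Suc)
qed

lemma ext_d_diff:
  assumes "smooth_form M k \<alpha>" "smooth_form M k \<beta>" "c \<in> M" "x \<in> cran c" "length vs = Suc k"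
  shows "ext_d (form_diff \<alpha> \<beta>) c x vs = ext_d \<alpha> c x vs - ext_d \<beta> c x vs"
proof -
  have "frechet_derivative (\<lambda>y. \<alpha> c y (remove_at i vs) - \<beta> c y (remove_at i vs)) (at x) =
      (\<lambda>v. frechet_derivative (\<lambda>y. \<alpha> c y (remove_at i vs)) (at x) v - frechet_derivative (\<lambda>y. \<beta> c y (remove_at i vs)) (at x) v)"
    if "i < Suc k" for i
    using assms that
    by (intro frechet_derivative_at[symmetric] has_derivative_diff
        smooth_form_has_derivative[OF assms(1,3)] smooth_form_has_derivative[OF assms(2,3)])
      (auto simp: length_remove_at)
  then show ?thesis using assms(5)
    by (simp add: ext_d_remove_at form_diff_def sum_subtractf right_diff_distrib del: sum.lessThan_Suc)
qed

text \<open>The product rule splits the derivative of every coefficient into two terms. Each of the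
  resulting alternating sums is reassembled into a wedge product by one of the two derivation
  identities for \<open>cwedge\<close>.\<close>

lemma ext_d_wedge:
  assumes a: "smooth_form M p \<alpha>" and b: "smooth_form M q \<beta>" and c: "c \<in> M" and x: "x \<in> cran c"
    and vs: "length vs = Suc (p + q)"
  shows "ext_d (wedge p q \<alpha> \<beta>) c x vs =
    wedge (Suc p) q (ext_d \<alpha>) \<beta> c x vs + (- 1) ^ p * wedge p (Suc q) \<alpha> (ext_d \<beta>) c x vs"
proof -
  define DA where "DA = (\<lambda>v us. frechet_derivative (\<lambda>y. \<alpha> c y us) (at x) v)"
  define DB where "DB = (\<lambda>v us. frechet_derivative (\<lambda>y. \<beta> c y us) (at x) v)"
  have "frechet_derivative (\<lambda>y. wedge p q \<alpha> \<beta> c y ws) (at x) =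
      (\<lambda>v. cwedge p q (DA v) (\<beta> c x) ws + cwedge p q (\<alpha> c x) (DB v) ws)" for ws
    unfolding wedge_eq_cwedge
    using frechet_derivative_at[OF cwedge_has_derivative[of p "\<lambda>us y. \<alpha> c y us" "\<lambda>us v. DA v us" x q "\<lambda>us y. \<beta> c y us" "\<lambda>us v. DB v us" ws]]
      smooth_form_has_derivative[OF a c _ x] smooth_form_has_derivative[OF b c _ x]
    by (simp add: DA_def DB_def)
  then have "ext_d (wedge p q \<alpha> \<beta>) c x vs =
      (\<Sum>i<Suc (p + q). (- 1) ^ i * cwedge p q (DA (vs ! i)) (\<beta> c x) (remove_at i vs)) +
      (\<Sum>i<Suc (p + q). (- 1) ^ i * cwedge p q (\<alpha> c x) (DB (vs ! i)) (remove_at i vs))"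
    by (simp add: ext_d_remove_at vs distrib_left sum.distrib del: sum.lessThan_Suc)
  also have "\<dots> = cwedge (Suc p) q (ext_d \<alpha> c x) (\<beta> c x) vs + (- 1) ^ p * cwedge p (Suc q) (\<alpha> c x) (ext_d \<beta> c x) vs"
  proof -
    have "cwedge (Suc p) q (\<lambda>us. \<Sum>j<Suc p. (- 1) ^ j * DA (us ! j) (remove_at j us)) (\<beta> c x) =
        cwedge (Suc p) q (ext_d \<alpha> c x) (\<beta> c x)"
      by (rule cwedge_cong) (simp_all add: ext_d_remove_at DA_def del: sum.lessThan_Suc)
    moreover have "cwedge p (Suc q) (\<alpha> c x) (\<lambda>us. \<Sum>j<Suc q. (- 1) ^ j * DB (us ! j) (remove_at j us)) =
        cwedge p (Suc q) (\<alpha> c x) (ext_d \<beta> c x)"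
      by (rule cwedge_cong) (simp_all add: ext_d_remove_at DB_def del: sum.lessThan_Suc)
    ultimately show ?thesis
      unfolding cwedge_derivation_left[OF vs] cwedge_derivation_right[OF vs] by simp
  qed
  finally show ?thesis by (simp add: wedge_eq_cwedge)
qed

lemma wedge_zero_left:
  assumes "form_eq M p \<alpha> form_zero" "c \<in> M" "x \<in> cran c"
  shows "wedge p q \<alpha> \<beta> c x vs = 0"
proof -
  have "cwedge p q (\<alpha> c x) (\<beta> c x) = cwedge p q (\<lambda>_. 0) (\<beta> c x)"
    by (rule cwedge_cong) (use assms in \<open>auto simp: form_eq_def form_zero_def\<close>)
  then show ?thesis by (simp add: wedge_eq_cwedge cwedge_def)
qed

lemma wedge_zero_right:
  assumes "form_eq M q \<beta> form_zero" "c \<in> M" "x \<in> cran c"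
  shows "wedge p q \<alpha> \<beta> c x vs = 0"
proof -
  have "cwedge p q (\<alpha> c x) (\<beta> c x) = cwedge p q (\<alpha> c x) (\<lambda>_. 0)"
    by (rule cwedge_cong) (use assms in \<open>auto simp: form_eq_def form_zero_def\<close>)
  then show ?thesis by (simp add: wedge_eq_cwedge cwedge_def)
qed

lemma wedge_form_eq_left: "form_eq M p \<alpha> \<alpha>' \<Longrightarrow> c \<in> M \<Longrightarrow> x \<in> cran c \<Longrightarrow> wedge p q \<alpha> \<beta> c x = wedge p q \<alpha>' \<beta> c x"
  and wedge_form_eq_right: "form_eq M q \<beta> \<beta>' \<Longrightarrow> c \<in> M \<Longrightarrow> x \<in> cran c \<Longrightarrow> wedge p q \<alpha> \<beta> c x = wedge p q \<alpha> \<beta>' c x"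
  unfolding wedge_eq_cwedge by (auto intro!: cwedge_cong simp: form_eq_def)

section \<open>Closed forms, exact forms and cohomology\<close>

lemma closed_form_wedge:
  assumes a: "closed_form M p \<alpha>" and b: "closed_form M q \<beta>"
  shows "closed_form M (p + q) (wedge p q \<alpha> \<beta>)"
proof -
  have "form_eq M (Suc (p + q)) (ext_d (wedge p q \<alpha> \<beta>)) form_zero"
    unfolding form_eq_def
    using a b by (auto simp: closed_form_def ext_d_wedge wedge_zero_left wedge_zero_right form_zero_def)
  then show ?thesis using a b by (simp add: closed_form_def smooth_form_wedge)
qed

lemma closed_form_one: "closed_form M 0 form_one"
  by (simp add: closed_form_def smooth_form_one ext_d_one form_eq_def)

lemma closed_form_scale: "closed_form M k \<alpha> \<Longrightarrow> closed_form M k (form_scale r \<alpha>)"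
  by (auto simp: closed_form_def smooth_form_scale form_eq_def ext_d_scale form_zero_def)

lemma closed_form_power: "closed_form M 2 \<alpha> \<Longrightarrow> closed_form M (2 * k) (form_power \<alpha> k)"
  using closed_form_wedge[of 2 \<alpha> "2 * _"] by (induction k) (auto simp: closed_form_one)

lemma exact_form_cong: "form_eq M k \<alpha> \<beta> \<Longrightarrow> exact_form M k \<alpha> \<Longrightarrow> exact_form M k \<beta>"
  by (cases k) (auto simp: exact_form_def form_eq_def)

lemma exact_form_zero: "exact_form M k form_zero"
proof (cases k)
  case 0
  then show ?thesis by (simp add: exact_form_def form_eq_def)
next
  case (Suc j)
  have "smooth_form M j form_zero \<and> form_eq M (Suc j) form_zero (ext_d form_zero)"
    by (simp add: smooth_form_zero ext_d_zero form_eq_def)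
  then show ?thesis using Suc by (auto simp: exact_form_def)
qed

lemma exact_form_diff:
  assumes "exact_form M k \<alpha>" "exact_form M k \<beta>"
  shows "exact_form M k (form_diff \<alpha> \<beta>)"
proof (cases k)
  case 0
  then show ?thesis using assms by (simp add: exact_form_def form_eq_def form_diff_def form_zero_def)
next
  case (Suc j)
  from assms Suc obtain \<xi> \<zeta> where "smooth_form M j \<xi>" "form_eq M k \<alpha> (ext_d \<xi>)"
      "smooth_form M j \<zeta>" "form_eq M k \<beta> (ext_d \<zeta>)"
    by (auto simp: exact_form_def)
  then have "smooth_form M j (form_diff \<xi> \<zeta>) \<and> form_eq M (Suc j) (form_diff \<alpha> \<beta>) (ext_d (form_diff \<xi> \<zeta>))"
    using Suc by (auto simp: smooth_form_diff form_eq_def ext_d_diff form_diff_def[of \<alpha>])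
  then show ?thesis using Suc by (auto simp: exact_form_def)
qed

lemma exact_form_scale:
  assumes "exact_form M k \<alpha>"
  shows "exact_form M k (form_scale r \<alpha>)"
proof (cases k)
  case 0
  then show ?thesis using assms by (simp add: exact_form_def form_eq_def form_scale_def form_zero_def)
next
  case (Suc j)
  from assms Suc obtain \<xi> where "smooth_form M j \<xi>" "form_eq M k \<alpha> (ext_d \<xi>)"
    by (auto simp: exact_form_def)
  then have "smooth_form M j (form_scale r \<xi>) \<and> form_eq M (Suc j) (form_scale r \<alpha>) (ext_d (form_scale r \<xi>))"
    using Suc by (auto simp: smooth_form_scale form_eq_def ext_d_scale form_scale_def[of r \<alpha>])
  then show ?thesis using Suc by (auto simp: exact_form_def)
qed

text \<open>If \<alpha> is the derivative of \<xi> and \<beta> is closed, then the wedge of \<xi>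
  and \<beta> is a primitive. In degree 0 exactness means vanishing, which is the separate first
  case.\<close>

lemma exact_form_wedge_left:
  assumes a: "exact_form M p \<alpha>" and b: "closed_form M q \<beta>"
  shows "exact_form M (p + q) (wedge p q \<alpha> \<beta>)"
proof (cases p)
  case 0
  then have "form_eq M (p + q) form_zero (wedge p q \<alpha> \<beta>)"
    using a by (auto simp: form_eq_def wedge_zero_left exact_form_def form_zero_def)
  then show ?thesis by (rule exact_form_cong) (rule exact_form_zero)
next
  case (Suc j)
  from a Suc obtain \<xi> where xi: "smooth_form M j \<xi>" "form_eq M (Suc j) \<alpha> (ext_d \<xi>)"
    by (auto simp: exact_form_def)
  have "form_eq M (Suc (j + q)) (wedge (Suc j) q \<alpha> \<beta>) (ext_d (wedge j q \<xi> \<beta>))"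
    unfolding form_eq_def using xi b
    by (auto simp: closed_form_def ext_d_wedge wedge_zero_right wedge_form_eq_left[OF xi(2)])
  moreover have "smooth_form M (j + q) (wedge j q \<xi> \<beta>)"
    using xi b by (simp add: closed_form_def smooth_form_wedge)
  ultimately show ?thesis using Suc by (auto simp: exact_form_def)
qed

lemma exact_form_wedge_right:
  assumes a: "closed_form M p \<alpha>" and b: "exact_form M q \<beta>"
  shows "exact_form M (p + q) (wedge p q \<alpha> \<beta>)"
proof (cases q)
  case 0
  then have "form_eq M (p + q) form_zero (wedge p q \<alpha> \<beta>)"
    using b by (auto simp: form_eq_def wedge_zero_right exact_form_def form_zero_def)
  then show ?thesis by (rule exact_form_cong) (rule exact_form_zero)
next
  case (Suc j)
  from b Suc obtain \<xi> where xi: "smooth_form M j \<xi>" "form_eq M (Suc j) \<beta> (ext_d \<xi>)"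
    by (auto simp: exact_form_def)
  have sm: "smooth_form M (p + j) (wedge p j \<alpha> \<xi>)"
    using xi a by (simp add: closed_form_def smooth_form_wedge)
  \<comment> \<open>The scalar \<open>(-1)^p\<close> in the primitive cancels the sign of the
    Leibniz rule.\<close>
  have "form_eq M (Suc (p + j)) (wedge p (Suc j) \<alpha> \<beta>) (ext_d (form_scale ((- 1) ^ p) (wedge p j \<alpha> \<xi>)))"
    unfolding form_eq_def using xi a
    by (auto simp: closed_form_def ext_d_wedge wedge_zero_left wedge_form_eq_right[OF xi(2)] ext_d_scale[OF sm]
        simp flip: mult.assoc power_add)
  then show ?thesis using Suc smooth_form_scale[OF sm] by (auto simp: exact_form_def)
qed

text \<open>Closedness of both forms is built in: a wedge with an exact factor is exact only against
  a closed factor, and this way the relation passes through products.\<close>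

definition cohomologous :: "nat \<Rightarrow> ('a, 'n) form \<Rightarrow> ('a, 'n) form \<Rightarrow> bool" where
  "cohomologous k \<alpha> \<beta> \<longleftrightarrow> closed_form M k \<alpha> \<and> closed_form M k \<beta> \<and> exact_form M k (form_diff \<alpha> \<beta>)"

lemma form_diff_self: "form_eq M k form_zero (form_diff \<alpha> \<alpha>)"
  by (simp add: form_eq_def form_diff_def form_zero_def)

lemma cohomologous_refl: "closed_form M k \<alpha> \<Longrightarrow> cohomologous k \<alpha> \<alpha>"
  unfolding cohomologous_def using exact_form_cong[OF form_diff_self exact_form_zero] by blast

lemma cohomologous_sym: "cohomologous k \<alpha> \<beta> \<Longrightarrow> cohomologous k \<beta> \<alpha>"
  unfolding cohomologous_def
  by (auto intro: exact_form_cong[OF _ exact_form_scale[of k "form_diff \<alpha> \<beta>" "-1"]]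
      simp: form_eq_def form_diff_def form_scale_def)

lemma cohomologous_trans: "cohomologous k \<alpha> \<beta> \<Longrightarrow> cohomologous k \<beta> \<gamma> \<Longrightarrow> cohomologous k \<alpha> \<gamma>"
  using cohomologous_sym[of k \<beta> \<gamma>] unfolding cohomologous_def
  by (auto intro: exact_form_cong[OF _ exact_form_diff[of k "form_diff \<alpha> \<beta>" "form_diff \<gamma> \<beta>"]]
      simp: form_eq_def form_diff_def)

text \<open>The factors are exchanged one at a time, through the intermediate product of \<alpha>'
  and \<beta>.\<close>

lemma cohomologous_wedge:
  assumes a: "cohomologous p \<alpha> \<alpha>'" and b: "cohomologous q \<beta> \<beta>'"
  shows "cohomologous (p + q) (wedge p q \<alpha> \<beta>) (wedge p q \<alpha>' \<beta>')"
proof (rule cohomologous_trans)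
  have a': "closed_form M p \<alpha>" "closed_form M p \<alpha>'" "exact_form M p (form_diff \<alpha> \<alpha>')"
    and b': "closed_form M q \<beta>" "closed_form M q \<beta>'" "exact_form M q (form_diff \<beta> \<beta>')"
    using a b by (auto simp: cohomologous_def)
  have "form_eq M (p + q) (wedge p q (form_diff \<alpha> \<alpha>') \<beta>) (form_diff (wedge p q \<alpha> \<beta>) (wedge p q \<alpha>' \<beta>))"
    by (simp add: form_eq_def form_diff_def wedge_eq_cwedge cwedge_diff_left)
  from exact_form_cong[OF this exact_form_wedge_left[OF a'(3) b'(1)]]
  show "cohomologous (p + q) (wedge p q \<alpha> \<beta>) (wedge p q \<alpha>' \<beta>)"
    by (simp add: cohomologous_def closed_form_wedge a' b')
  have "form_eq M (p + q) (wedge p q \<alpha>' (form_diff \<beta> \<beta>')) (form_diff (wedge p q \<alpha>' \<beta>) (wedge p q \<alpha>' \<beta>'))"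
    by (simp add: form_eq_def form_diff_def wedge_eq_cwedge cwedge_diff_right)
  from exact_form_cong[OF this exact_form_wedge_right[OF a'(2) b'(3)]]
  show "cohomologous (p + q) (wedge p q \<alpha>' \<beta>) (wedge p q \<alpha>' \<beta>')"
    by (simp add: cohomologous_def closed_form_wedge a' b')
qed

lemma cohomologous_scale:
  assumes "cohomologous k \<alpha> \<beta>"
  shows "cohomologous k (form_scale r \<alpha>) (form_scale r \<beta>)"
proof -
  have "form_eq M k (form_scale r (form_diff \<alpha> \<beta>)) (form_diff (form_scale r \<alpha>) (form_scale r \<beta>))"
    by (simp add: form_eq_def form_diff_def form_scale_def right_diff_distrib)
  from exact_form_cong[OF this exact_form_scale] assms show ?thesis
    by (simp add: cohomologous_def closed_form_scale)
qed

lemma cohomologous_power: "cohomologous 2 \<alpha> \<beta> \<Longrightarrow> cohomologous (2 * k) (form_power \<alpha> k) (form_power \<beta> k)"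
proof (induction k)
  case 0
  then show ?case by (simp add: cohomologous_refl closed_form_one)
next
  case (Suc k)
  from cohomologous_wedge[OF Suc.prems Suc.IH[OF Suc.prems]] show ?case by simp
qed

lemma dR_class_iff: "closed_form M k \<beta> \<Longrightarrow> \<beta>' \<in> dR_class M k \<beta> \<longleftrightarrow> cohomologous k \<beta>' \<beta>"
  by (simp add: dR_class_def cohomologous_def)

end

section \<open>Top forms and determinants\<close>

context
  fixes f :: "('n::finite) covec" and js :: "'m::finite list"
  assumes f: "alternating (length js) f" and js: "distinct js" "set js = UNIV"
begin

lemma alternating_family_linear: "linear (\<lambda>v. f (map (h(i := v)) js))"
proof -
  obtain k where k: "k < length js" "js ! k = i"
    using js(2) by (metis UNIV_I in_set_conv_nth)
  have "map (h(i := v)) js = (map h js)[k := v]" for v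
    using k js(1) by (intro nth_equalityI) (auto simp: nth_list_update nth_eq_iff_index_eq)
  then show ?thesis using f k by (simp add: alternating_def)
qed

lemma alternating_family_repeat:
  assumes "i \<noteq> j" "h i = h j"
  shows "f (map h js) = 0"
proof -
  obtain k l where "k < length js" "js ! k = i" "l < length js" "js ! l = j"
    using js(2) by (metis UNIV_I in_set_conv_nth)
  with assms f show ?thesis unfolding alternating_def
    by (metis (no_types, lifting) length_map nth_map)
qed

lemma alternating_family_add:
  "f (map (h(i := v + w)) js) = f (map (h(i := v)) js) + f (map (h(i := w)) js)"
  and alternating_family_scale: "f (map (h(i := c *\<^sub>R v)) js) = c * f (map (h(i := v)) js)"
  and alternating_family_0: "f (map (h(i := 0)) js) = 0"
  using linear_add[OF alternating_family_linear] linear_cmul[OF alternating_family_linear]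
    linear_0[OF alternating_family_linear] by auto

lemma alternating_family_scale_all:
  "finite S \<Longrightarrow> f (map (\<lambda>i. if i \<in> S then c i *\<^sub>R h i else h i) js) = prod c S * f (map h js)"
proof (induction S rule: finite_induct)
  case (insert i S)
  let ?g = "\<lambda>k. if k \<in> S then c k *\<^sub>R h k else h k"
  have "(\<lambda>k. if k \<in> insert i S then c k *\<^sub>R h k else h k) = ?g(i := c i *\<^sub>R h i)" "?g(i := h i) = ?g"
    using insert by auto
  then show ?case using insert alternating_family_scale[of ?g i "c i" "h i"] by simp
qed simp

lemma alternating_family_swap:
  assumes "i \<noteq> j"
  shows "f (map (h(i := h j, j := h i)) js) = - f (map h js)"
proof -
  let ?F = "\<lambda>v w. f (map (h(i := v, j := w)) js)"
  have add1: "?F (v + v') w = ?F v w + ?F v' w" for v v' w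
    using alternating_family_add[of "h(j := w)" i v v'] assms by (simp add: fun_upd_twist)
  have add2: "?F v (w + w') = ?F v w + ?F v w'" for v w w'
    by (rule alternating_family_add)
  have z: "?F v v = 0" for v by (rule alternating_family_repeat[OF assms]) (use assms in simp)
  have "0 = ?F (h i + h j) (h i + h j)" by (simp only: z)
  also have "\<dots> = ?F (h i) (h i + h j) + ?F (h j) (h i + h j)" by (rule add1)
  also have "\<dots> = (?F (h i) (h i) + ?F (h i) (h j)) + (?F (h j) (h i) + ?F (h j) (h j))"
    by (simp only: add2)
  also have "\<dots> = ?F (h i) (h j) + ?F (h j) (h i)" by (simp only: z add_0_left add_0_right)
  finally show ?thesis by simp
qed

end

text \<open>Induction over factorizations into elementary matrices. The linear map \<Phi> is
  quantified inside the induction: the rows of \<open>A ** B\<close> are the rows of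
  \<open>A\<close> mapped by \<open>B\<close>, so the right factor can be absorbed into \<Phi> when
  the hypothesis for \<open>A\<close> is used.\<close>

lemma alternating_rows_det:
  fixes B :: "real^'m^'m" and f :: "('n::finite) covec"
  assumes "alternating (length js) f" "distinct js" "set js = (UNIV :: 'm set)" "linear \<Phi>"
  shows "f (map (\<lambda>i. \<Phi> (row i B)) js) = det B * f (map (\<lambda>i. \<Phi> (axis i 1)) js)"
proof -
  note f = assms(1-3)
  have "\<forall>\<Phi>. linear \<Phi> \<longrightarrow> f (map (\<lambda>i. \<Phi> (row i B)) js) = det B * f (map (\<lambda>i. \<Phi> (axis i 1)) js)"
  proof (induction B rule: induct_matrix_elementary)
    case (1 A B)
    show ?case
    proof (intro allI impI)
      fix \<Phi> :: "real^'m \<Rightarrow> complex^'n" assume \<Phi>: "linear \<Phi>"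
      have lin: "linear (\<lambda>x. x v* B)" by (rule linearI) (simp_all add: vector_matrix_left_distrib scaleR_vector_matrix_assoc)
      have "row i (A ** B) = row i A v* B" for i
        by (simp add: vec_eq_iff row_def matrix_matrix_mult_def vector_matrix_mult_def mult.commute)
      moreover have "axis i 1 v* B = row i B" for i
        by (simp add: vec_eq_iff row_def vector_matrix_mult_def axis_def if_distrib if_distribR sum.delta cong: if_cong)
      moreover have "f (map (\<lambda>i. \<Phi> (row i A v* B)) js) = det A * f (map (\<lambda>i. \<Phi> (axis i 1 v* B)) js)"
        using 1(1)[rule_format, OF linear_compose[OF lin \<Phi>]] by (simp only: o_def)
      moreover have "f (map (\<lambda>i. \<Phi> (row i B)) js) = det B * f (map (\<lambda>i. \<Phi> (axis i 1)) js)"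
        using 1(2) \<Phi> by blast
      ultimately show "f (map (\<lambda>i. \<Phi> (row i (A ** B))) js) = det (A ** B) * f (map (\<lambda>i. \<Phi> (axis i 1)) js)"
        by (simp add: det_mul)
    qed
  next
    case (2 A i)
    have "(\<lambda>j. \<Phi> (row j A)) = (\<lambda>j. \<Phi> (row j A))(i := 0)" if "linear \<Phi>" for \<Phi> :: "real^'m \<Rightarrow> complex^'n"
      using 2 linear_0[OF that] by auto
    then show ?case
      using det_zero_row(1)[OF 2] alternating_family_0[OF f] by (metis mult_zero_left)
  next
    case (3 A)
    have "\<Phi> (row i A) = A$i$i *\<^sub>R \<Phi> (axis i 1)" if "linear \<Phi>" for \<Phi> :: "real^'m \<Rightarrow> complex^'n" and i
    proof -
      have "row i A = A$i$i *\<^sub>R axis i 1" using 3 by (auto simp: vec_eq_iff row_def axis_def)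
      then show ?thesis using linear_cmul[OF that] by simp
    qed
    then have "(\<lambda>i. \<Phi> (row i A)) = (\<lambda>i. A$i$i *\<^sub>R \<Phi> (axis i 1))" if "linear \<Phi>" for \<Phi> :: "real^'m \<Rightarrow> complex^'n"
      using that by blast
    then show ?case
      using alternating_family_scale_all[OF f, of UNIV "\<lambda>i. A$i$i"] by (simp add: det_diagonal[OF 3])
  next
    case (4 m n)
    have det: "det (\<chi> i j. mat 1 $ i $ Transposition.transpose m n j :: real^'m^'m) = - 1"
      using 4 det_permute_columns[of "Transposition.transpose m n" "mat 1 :: real^'m^'m"]
      by (simp add: permutes_swap_id sign_swap_id)
    have row: "row i (\<chi> i j. mat 1 $ i $ Transposition.transpose m n j :: real^'m^'m) = axis (Transposition.transpose m n i) 1" for i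
      by (auto simp: vec_eq_iff row_def mat_def axis_def)
    show ?case
      unfolding det row
    proof (intro allI impI)
      fix \<Phi> :: "real^'m \<Rightarrow> complex^'n"
      have "(\<lambda>i. \<Phi> (axis (Transposition.transpose m n i) 1)) =
          (\<lambda>i. \<Phi> (axis i 1))(m := \<Phi> (axis n 1), n := \<Phi> (axis m 1))"
        by (auto simp: Transposition.transpose_def)
      then show "f (map (\<lambda>i. \<Phi> (axis (Transposition.transpose m n i) 1)) js) =
          - 1 * f (map (\<lambda>i. \<Phi> (axis i 1)) js)"
        using alternating_family_swap[OF f 4, of "\<lambda>i. \<Phi> (axis i 1)"] by (simp only: mult_minus_left mult_1_left)
    qed
  next
    case (5 m n c)
    let ?B = "\<chi> i j. if i = m \<and> j = n then c else of_bool (i = j) :: real^'m^'m"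
    have "?B = (\<chi> k. if k = m then row m (mat 1) + c *s row n (mat 1) else row k (mat 1 :: real^'m^'m))"
      using 5 by (auto simp: vec_eq_iff row_def mat_def)
    then have det: "det ?B = 1" using det_row_operation[OF 5, of "mat 1 :: real^'m^'m" c] by simp
    have row: "row i ?B = (if i = m then axis m 1 + c *\<^sub>R axis n 1 else axis i 1)" for i
      using 5 by (auto simp: vec_eq_iff row_def axis_def)
    show ?case
    proof (intro allI impI)
      fix \<Phi> :: "real^'m \<Rightarrow> complex^'n" assume \<Phi>: "linear \<Phi>"
      let ?h = "\<lambda>i. \<Phi> (axis i 1)"
      have "(\<lambda>i. \<Phi> (row i ?B)) = ?h(m := ?h m + c *\<^sub>R ?h n)"
        unfolding row by (auto simp: linear_add[OF \<Phi>] linear_cmul[OF \<Phi>])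
      moreover have "f (map (?h(m := ?h n)) js) = 0"
        by (rule alternating_family_repeat[OF f 5]) (use 5 in auto)
      moreover have "?h(m := ?h m) = ?h" by auto
      ultimately show "f (map (\<lambda>i. \<Phi> (row i ?B)) js) = det ?B * f (map ?h js)"
        unfolding det by (simp add: alternating_family_add[OF f] alternating_family_scale[OF f])
    qed
  qed
  then show ?thesis using assms(4) by blast
qed

section \<open>Change of variables in complex coordinates\<close>

lemma oriented_basis:
  shows "distinct (oriented_basis :: (complex^'n::finite) list)"
    and "set (oriented_basis :: (complex^'n) list) = Basis"
    and "length (oriented_basis :: (complex^'n) list) = 2 * CARD('n)"
proof -
  obtain js :: "'n list" where js: "distinct js" "set js = UNIV"
      "(oriented_basis :: (complex^'n) list) = concat (map (\<lambda>j. [axis j 1, axis j \<i>]) js)"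
    using someI_ex[of "\<lambda>js. distinct js \<and> set js = (UNIV :: 'n set)"] finite_distinct_list[of "UNIV :: 'n set"]
    unfolding oriented_basis_def by (metis finite_class.finite_UNIV)
  have "distinct (concat (map (\<lambda>j. [axis j 1, axis j \<i>]) js) :: (complex^'n) list)"
    using js(1) by (induction js) (auto simp: axis_eq_axis)
  then show "distinct (oriented_basis :: (complex^'n) list)" using js(3) by simp
  show "set (oriented_basis :: (complex^'n) list) = Basis"
    using js(2) by (auto simp: js(3) Basis_vec_def Basis_complex_def)
  have "length (concat (map (\<lambda>j. [axis j 1, axis j \<i>]) js) :: (complex^'n) list) = 2 * length js"
    by (induction js) auto
  then show "length (oriented_basis :: (complex^'n) list) = 2 * CARD('n)"
    using js distinct_card[of js] by simp
qed

text \<open>As index type for real coordinates on \<open>complex^'n\<close> we take \<open>'n bit0\<close>: it has cardinality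
  \<open>2 * CARD('n)\<close> and carries the well-order which the change of variables theorem requires.\<close>

definition real_index :: "('n::finite) bit0 list" where
  "real_index = (SOME js. distinct js \<and> set js = UNIV)"

text \<open>Defined through list positions so that running through \<open>real_index\<close>
  reproduces \<open>oriented_basis\<close> in its order; determinants in the real coordinates then
  match evaluation on that tuple.\<close>

definition real_basis :: "'n::finite bit0 \<Rightarrow> complex^'n" where
  "real_basis i = oriented_basis ! (THE k. k < length (real_index :: 'n bit0 list) \<and> real_index ! k = i)"

definition of_real_coords :: "real^('n::finite bit0) \<Rightarrow> complex^'n" where
  "of_real_coords x = (\<Sum>i\<in>UNIV. x $ i *\<^sub>R real_basis i)"

definition real_coords :: "complex^'n::finite \<Rightarrow> real^('n bit0)" where
  "real_coords z = (\<chi> i. z \<bullet> real_basis i)"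

lemma real_index: "distinct (real_index :: ('n::finite) bit0 list)" "set (real_index :: 'n bit0 list) = UNIV"
    "length (real_index :: 'n bit0 list) = 2 * CARD('n)"
proof -
  have "\<exists>js :: 'n bit0 list. distinct js \<and> set js = UNIV"
    using finite_distinct_list[of "UNIV :: 'n bit0 set"] by auto
  from someI_ex[OF this] show *: "distinct (real_index :: 'n bit0 list)" "set (real_index :: 'n bit0 list) = UNIV"
    unfolding real_index_def by auto
  show "length (real_index :: 'n bit0 list) = 2 * CARD('n)"
    using distinct_card[OF *(1)] *(2) by simp
qed

lemma map_real_basis: "map real_basis real_index = (oriented_basis :: (complex^'n::finite) list)"
proof (rule nth_equalityI)
  fix k assume k: "k < length (map real_basis (real_index :: 'n bit0 list))"
  have "(THE l. l < length (real_index :: 'n bit0 list) \<and> real_index ! l = (real_index :: 'n bit0 list) ! k) = k"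
    using k real_index(1)[where 'n='n] by (intro the_equality) (auto simp: nth_eq_iff_index_eq)
  then show "map real_basis real_index ! k = (oriented_basis :: (complex^'n) list) ! k"
    using k by (simp add: real_basis_def)
qed (simp add: real_index oriented_basis)

lemma bij_real_basis: "bij_betw (real_basis :: 'n::finite bit0 \<Rightarrow> complex^'n) UNIV Basis"
proof -
  have "distinct (map real_basis (real_index :: 'n bit0 list))"
    unfolding map_real_basis by (rule oriented_basis)
  moreover have "real_basis ` (UNIV :: 'n bit0 set) = Basis"
    using oriented_basis(2)[where 'n='n] unfolding map_real_basis[symmetric] by (simp add: real_index)
  ultimately show ?thesis by (simp add: bij_betw_def distinct_map real_index)
qed

lemma real_basis_Basis: "real_basis i \<in> Basis"
  using bij_real_basis by (auto simp: bij_betw_def)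

lemma real_basis_inner: "real_basis i \<bullet> real_basis j = (if i = j then 1 else 0)"
proof -
  have "real_basis i = real_basis j \<longleftrightarrow> i = j"
    by (rule inj_eq[OF bij_betw_imp_inj_on[OF bij_real_basis]])
  then show ?thesis by (simp add: inner_Basis real_basis_Basis)
qed

lemma of_real_coords_inner: "of_real_coords x \<bullet> real_basis i = x $ i"
  by (simp add: of_real_coords_def inner_sum_left real_basis_inner if_distrib sum.delta cong: if_cong)

lemma real_coords_of_real_coords: "real_coords (of_real_coords x) = x"
  by (simp add: real_coords_def of_real_coords_inner vec_eq_iff)

lemma of_real_coords_real_coords: "of_real_coords (real_coords z) = z"
proof -
  have "of_real_coords (real_coords z) = (\<Sum>b\<in>Basis. (z \<bullet> b) *\<^sub>R b)"
    unfolding of_real_coords_def real_coords_def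
    using sum.reindex_bij_betw[OF bij_real_basis, of "\<lambda>b. (z \<bullet> b) *\<^sub>R b"] by simp
  then show ?thesis by (simp add: euclidean_representation)
qed

lemma linear_of_real_coords: "linear of_real_coords"
  by (rule linearI) (simp_all add: of_real_coords_def sum.distrib scaleR_left_distrib scaleR_sum_right)

lemma linear_real_coords: "linear real_coords"
  by (rule linearI) (simp_all add: real_coords_def vec_eq_iff inner_add_left)

lemma of_real_coords_axis: "of_real_coords (axis i 1) = real_basis i"
  by (simp add: of_real_coords_def axis_def if_distrib if_distribR sum.delta cong: if_cong)

lemma cont_of_real_coords: "continuous_on S of_real_coords"
  using linear_continuous_on linear_conv_bounded_linear linear_of_real_coords by blast

lemma cont_real_coords: "continuous_on S real_coords"
  using linear_continuous_on linear_conv_bounded_linear linear_real_coords by blast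

text \<open>The images of the basis vectors are the columns of the matrix, that is the rows of its
  transpose, so \<open>alternating_rows_det\<close> applies with \<open>of_real_coords\<close> as
  the linear map.\<close>

lemma alternating_oriented_basis:
  fixes A :: "complex^'n::finite \<Rightarrow> complex^'n"
  assumes "alternating (2 * CARD('n)) f" "linear A"
  shows "f (map A oriented_basis) =
    det (matrix (\<lambda>x. real_coords (A (of_real_coords x)))) * f oriented_basis"
proof -
  let ?A = "\<lambda>x. real_coords (A (of_real_coords x))"
  have "A (real_basis i) = of_real_coords (row i (transpose (matrix ?A)))" for i
  proof -
    have "row i (transpose (matrix ?A)) = ?A (axis i 1)"
      by (simp add: column_def vec_eq_iff matrix_def)
    then show ?thesis by (simp add: of_real_coords_real_coords of_real_coords_axis)
  qed
  then have "map A oriented_basis = map (\<lambda>i. of_real_coords (row i (transpose (matrix ?A)))) real_index"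
    unfolding map_real_basis[symmetric] by simp
  then show ?thesis
    using alternating_rows_det[OF _ real_index(1,2) linear_of_real_coords, of f "transpose (matrix ?A)"] assms(1)
    by (simp add: real_index det_transpose of_real_coords_axis map_real_basis)
qed

lemma of_real_coords_cbox: "of_real_coords ` cbox a b = cbox (of_real_coords a) (of_real_coords b)"
proof -
  have B: "(\<forall>u\<in>Basis. P u) \<longleftrightarrow> (\<forall>i. P (real_basis i))" for P :: "complex^'n \<Rightarrow> bool"
    using bij_real_basis[where 'n='n] unfolding bij_betw_def by (metis UNIV_I imageE imageI)
  have iff: "of_real_coords x \<in> cbox (of_real_coords a) (of_real_coords b) \<longleftrightarrow> x \<in> cbox a b" for x
    unfolding mem_box B of_real_coords_inner by (auto simp: Basis_vec_def cart_eq_inner_axis)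
  show ?thesis
  proof (intro set_eqI iffI)
    fix z assume "z \<in> cbox (of_real_coords a) (of_real_coords b)"
    then have "real_coords z \<in> cbox a b" using iff[of "real_coords z"] by (simp add: of_real_coords_real_coords)
    then show "z \<in> of_real_coords ` cbox a b" by (metis imageI of_real_coords_real_coords)
  qed (use iff in auto)
qed

lemma real_coords_cbox: "real_coords ` cbox a b = cbox (real_coords a) (real_coords b)"
proof -
  have "cbox a b = of_real_coords ` cbox (real_coords a) (real_coords b)"
    by (simp add: of_real_coords_cbox of_real_coords_real_coords)
  then show ?thesis by (simp add: image_comp o_def real_coords_of_real_coords)
qed

lemma content_of_real_coords: "measure lborel (of_real_coords ` cbox a b) = measure lborel (cbox a b)"
proof (cases "cbox a b = {}")
  case False
  then have "cbox (of_real_coords a) (of_real_coords b) \<noteq> {}"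
    unfolding of_real_coords_cbox[symmetric] by simp
  then have "measure lborel (of_real_coords ` cbox a b) = (\<Prod>u\<in>Basis. of_real_coords b \<bullet> u - of_real_coords a \<bullet> u)"
    unfolding of_real_coords_cbox by (rule content_cbox')
  also have "\<dots> = (\<Prod>i\<in>UNIV. b $ i - a $ i)"
    using prod.reindex_bij_betw[OF bij_real_basis, of "\<lambda>u. of_real_coords b \<bullet> u - of_real_coords a \<bullet> u"]
    by (simp add: of_real_coords_inner)
  finally show ?thesis using False by (simp add: content_cbox_cart)
qed simp

text \<open>Integrals over chart ranges become integrals over the whole space, where continuity
  together with compact support gives integrability and directional derivatives can be
  integrated.\<close>

definition zero_extend :: "'v set \<Rightarrow> ('v \<Rightarrow> real) \<Rightarrow> 'v \<Rightarrow> real" where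
  "zero_extend S f x = (if x \<in> S then f x else 0)"

lemma integral_zero_extend:
  fixes f :: "'v::euclidean_space \<Rightarrow> real"
  shows "integral UNIV (zero_extend S f) = integral S f"
  unfolding zero_extend_def by (rule Henstock_Kurzweil_Integration.integral_restrict_UNIV)

lemma zero_extend_continuous:
  fixes f :: "'v::t2_space \<Rightarrow> real"
  assumes "open S" "continuous_on S f" "compact K" "K \<subseteq> S" "\<And>x. x \<in> S - K \<Longrightarrow> f x = 0"
  shows "continuous_on UNIV (zero_extend S f)"
proof -
  have "continuous_on (S \<union> - K) (zero_extend S f)"
  proof (rule continuous_on_open_Un)
    show "open (- K)" using assms(3) compact_imp_closed by blast
    show "continuous_on S (zero_extend S f)"
      using assms(2) by (rule continuous_on_eq) (simp add: zero_extend_def)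
    show "continuous_on (- K) (zero_extend S f)"
      by (rule continuous_on_eq[OF continuous_on_const[of _ 0]]) (use assms(5) in \<open>auto simp: zero_extend_def\<close>)
  qed (use assms in auto)
  moreover have "S \<union> - K = UNIV" using assms(4) by auto
  ultimately show ?thesis by simp
qed

lemma integral_compact_support:
  fixes g :: "'v::euclidean_space \<Rightarrow> real"
  assumes "\<And>x. x \<notin> K \<Longrightarrow> g x = 0" "K \<subseteq> cbox a b"
  shows "integral UNIV g = integral (cbox a b) g"
proof -
  have "(\<lambda>x. if x \<in> cbox a b then g x else 0) = g" using assms by force
  then show ?thesis using Henstock_Kurzweil_Integration.integral_restrict_UNIV[of "cbox a b" g] by simp
qed

lemma absolutely_integrable_compact_support:
  fixes g :: "'v::euclidean_space \<Rightarrow> real"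
  assumes "continuous_on UNIV g" "compact K" "\<And>x. x \<notin> K \<Longrightarrow> g x = 0"
  shows "g absolutely_integrable_on UNIV"
proof -
  obtain a b where ab: "K \<subseteq> cbox a b" using bounded_subset_cbox_symmetric compact_imp_bounded[OF assms(2)] by blast
  have "g absolutely_integrable_on cbox a b"
    by (rule absolutely_integrable_continuous) (use assms(1) continuous_on_subset in blast)
  then have "(\<lambda>x. if x \<in> cbox a b then g x else 0) absolutely_integrable_on UNIV"
    by (simp only: absolutely_integrable_restrict_UNIV)
  moreover have "(\<lambda>x. if x \<in> cbox a b then g x else 0) = g" using assms(3) ab by force
  ultimately show ?thesis by simp
qed

text \<open>\<open>of_real_coords\<close> takes boxes to boxes of the same volume, so substitution
  in the gauge integral produces the factor 1.\<close>

lemma integral_real_coords: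
  fixes g :: "complex^'n::finite \<Rightarrow> real"
  assumes "continuous_on UNIV g" "compact K" "\<And>z. z \<notin> K \<Longrightarrow> g z = 0"
  shows "integral UNIV (\<lambda>x. g (of_real_coords x)) = integral UNIV g"
proof -
  obtain a b where ab: "K \<subseteq> cbox a b" using bounded_subset_cbox_symmetric compact_imp_bounded[OF assms(2)] by blast
  have "(g has_integral integral (cbox a b) g) (cbox a b)"
    using assms(1) by (intro integrable_integral integrable_continuous) (auto intro: continuous_on_subset)
  then have "((\<lambda>x. g (of_real_coords x)) has_integral (1 / 1) *\<^sub>R integral (cbox a b) g) (real_coords ` cbox a b)"
  proof (rule has_integral_twiddle[rotated -1])
    show "isCont of_real_coords x" for x :: "real^('n bit0)"
    proof -
      have "continuous_on UNIV (of_real_coords :: real^('n bit0) \<Rightarrow> complex^'n)" by (rule cont_of_real_coords)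
      then show ?thesis by (simp add: continuous_on_eq_continuous_at)
    qed
    show "\<exists>w z. of_real_coords ` cbox u v = cbox w z" for u v :: "real^('n bit0)"
      using of_real_coords_cbox by blast
    show "\<exists>w z. real_coords ` cbox u v = cbox w z" for u v :: "complex^'n"
      using real_coords_cbox by blast
  qed (simp_all add: real_coords_of_real_coords of_real_coords_real_coords content_of_real_coords)
  then have "integral (cbox (real_coords a) (real_coords b)) (\<lambda>x. g (of_real_coords x)) = integral (cbox a b) g"
    unfolding real_coords_cbox by (simp add: integral_unique)
  moreover have "integral UNIV g = integral (cbox a b) g"
    using integral_compact_support[OF assms(3) ab] .
  moreover have "integral UNIV (\<lambda>x. g (of_real_coords x)) = integral (cbox (real_coords a) (real_coords b)) (\<lambda>x. g (of_real_coords x))"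
  proof (rule integral_compact_support)
    show "g (of_real_coords x) = 0" if "x \<notin> real_coords ` K" for x
      using that assms(3) by (metis imageI real_coords_of_real_coords)
    show "real_coords ` K \<subseteq> cbox (real_coords a) (real_coords b)"
      using ab by (auto simp flip: real_coords_cbox)
  qed
  ultimately show ?thesis by simp
qed

text \<open>Transport to real coordinates reduces this to the change of variables theorem on
  \<open>real^('n bit0)\<close>. Compact supports inside the open sets provide the absolute
  integrability of both sides and allow them to be extended by zero.\<close>

lemma integral_change_of_variables_complex:
  fixes T :: "complex^'n::finite \<Rightarrow> complex^'n"
  assumes U: "open U" and V: "open V" "T ` U = V" "inj_on T U"
    and T: "\<And>x. x \<in> U \<Longrightarrow> (T has_derivative T' x) (at x)"
    and h: "continuous_on V h" "compact K" "K \<subseteq> V" "\<And>y. y \<in> V - K \<Longrightarrow> h y = 0"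
    and G: "continuous_on U G" "compact L" "L \<subseteq> U" "\<And>x. x \<in> U - L \<Longrightarrow> G x = 0"
    and eq: "\<And>x. x \<in> U \<Longrightarrow> G x = \<bar>det (matrix (\<lambda>v. real_coords (T' x (of_real_coords v))))\<bar> * h (T x)"
  shows "integral U G = integral V h"
proof -
  let ?\<Phi> = "of_real_coords :: real^('n bit0) \<Rightarrow> complex^'n" and ?\<Psi> = "real_coords :: complex^'n \<Rightarrow> real^('n bit0)"
  have img: "?\<Psi> ` S = {x. ?\<Phi> x \<in> S}" for S
    by (force simp: real_coords_of_real_coords of_real_coords_real_coords intro: image_eqI[where x="?\<Phi> _"])
  have transfer: "integral (?\<Psi> ` S) (\<lambda>x. k (?\<Phi> x)) = integral S k"
    "(\<lambda>x. k (?\<Phi> x)) absolutely_integrable_on (?\<Psi> ` S)"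
    if "open S" "continuous_on S k" "compact C" "C \<subseteq> S" "\<And>x. x \<in> S - C \<Longrightarrow> k x = 0"
    for S C and k :: "complex^'n \<Rightarrow> real"
  proof -
    have c: "continuous_on UNIV (zero_extend S k)" by (rule zero_extend_continuous[OF that])
    have z: "zero_extend S k z = 0" if "z \<notin> C" for z
      using that \<open>\<And>x. x \<in> S - C \<Longrightarrow> k x = 0\<close> by (auto simp: zero_extend_def)
    have e: "(\<lambda>x. zero_extend S k (?\<Phi> x)) = zero_extend (?\<Psi> ` S) (\<lambda>x. k (?\<Phi> x))"
      by (auto simp: zero_extend_def img)
    show "integral (?\<Psi> ` S) (\<lambda>x. k (?\<Phi> x)) = integral S k"
      using integral_real_coords[OF c that(3) z] by (simp add: e integral_zero_extend)
    have "zero_extend (?\<Psi> ` S) (\<lambda>x. k (?\<Phi> x)) absolutely_integrable_on UNIV"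
      unfolding e[symmetric]
    proof (rule absolutely_integrable_compact_support)
      show "continuous_on UNIV (\<lambda>x. zero_extend S k (?\<Phi> x))"
        by (rule continuous_on_compose2[OF c cont_of_real_coords]) auto
      show "compact (?\<Psi> ` C)" using that(3) cont_real_coords by (rule compact_continuous_image[rotated])
      show "zero_extend S k (?\<Phi> x) = 0" if "x \<notin> ?\<Psi> ` C" for x using that z by (simp add: img)
    qed
    then show "(\<lambda>x. k (?\<Phi> x)) absolutely_integrable_on (?\<Psi> ` S)"
      unfolding zero_extend_def by (simp only: absolutely_integrable_restrict_UNIV)
  qed
  define S where "S = ?\<Psi> ` U"
  define g where "g x = ?\<Psi> (T (?\<Phi> x))" for x
  define g' where "g' x v = ?\<Psi> (T' (?\<Phi> x) (?\<Phi> v))" for x v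
  have S_open: "open S"
    unfolding S_def img using open_vimage[OF U cont_of_real_coords] by (simp add: vimage_def)
  have gS: "g ` S = ?\<Psi> ` V"
    unfolding S_def g_def V(2)[symmetric] by (simp add: image_image of_real_coords_real_coords)
  have bl: "bounded_linear ?\<Phi>" "bounded_linear ?\<Psi>"
    using linear_of_real_coords linear_real_coords linear_conv_bounded_linear by blast+
  have der: "(g has_derivative g' x) (at x within S)" if "x \<in> S" for x
  proof -
    have "?\<Phi> x \<in> U" using that by (simp add: S_def img)
    then have "((\<lambda>x. T (?\<Phi> x)) has_derivative (\<lambda>v. T' (?\<Phi> x) (?\<Phi> v))) (at x)"
      using has_derivative_compose[OF bounded_linear.has_derivative[OF bl(1) has_derivative_ident], of T] T by simp
    from bounded_linear.has_derivative[OF bl(2) this] show ?thesis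
      unfolding g_def g'_def by (rule has_derivative_at_withinI)
  qed
  have inj: "inj_on g S"
    unfolding g_def S_def
    by (rule inj_onI) (use V(3) in \<open>auto simp: inj_on_def img, metis of_real_coords_real_coords real_coords_of_real_coords\<close>)
  \<comment> \<open>The change of variables theorem treats vector-valued functions, so the real
    integrand is viewed as one with values in \<open>real^1\<close>.\<close>
  define H :: "real^('n bit0) \<Rightarrow> real^1" where "H y = vec (h (?\<Phi> y))" for y
  define D :: "real^('n bit0) \<Rightarrow> real^1" where "D x = \<bar>det (matrix (g' x))\<bar> *\<^sub>R H (g x)" for x
  have "H absolutely_integrable_on (g ` S)"
    unfolding gS by (rule absolutely_integrable_componentwise)
      (use transfer(2)[OF V(1) h] in \<open>auto simp: H_def Basis_vec_def inner_axis\<close>)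
  then have "integral S D = integral (g ` S) H" and "D absolutely_integrable_on S"
    using has_absolute_integral_change_of_variables[of S g g' H "integral (g ` S) H", OF _ der inj]
      S_open lebesgue_openin by (auto simp: D_def[abs_def])
  moreover have "integral S D $ 1 = integral S (\<lambda>x. D x $ 1)" "integral (g ` S) H $ 1 = integral (g ` S) (\<lambda>x. H x $ 1)"
    using calculation \<open>H absolutely_integrable_on (g ` S)\<close>
    by (auto intro!: integral_component_eq_cart[symmetric] simp: absolutely_integrable_on_def)
  moreover have "integral S (\<lambda>x. D x $ 1) = integral S (\<lambda>x. G (?\<Phi> x))"
  proof (rule integral_cong)
    fix x assume "x \<in> S"
    then have "?\<Phi> x \<in> U" by (simp add: S_def img)
    from eq[OF this] show "D x $ 1 = G (?\<Phi> x)"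
      by (simp add: D_def H_def g_def g'_def[abs_def] of_real_coords_real_coords)
  qed
  moreover have "integral (g ` S) (\<lambda>x. H x $ 1) = integral (?\<Psi> ` V) (\<lambda>x. h (?\<Phi> x))"
    unfolding gS by (simp add: H_def)
  ultimately have "integral (?\<Psi> ` U) (\<lambda>x. G (?\<Phi> x)) = integral (?\<Psi> ` V) (\<lambda>x. h (?\<Phi> x))"
    unfolding S_def by metis
  with transfer(1)[OF U G] transfer(1)[OF V(1) h] show ?thesis by metis
qed

section \<open>Integrals of derivatives\<close>

lemma integral_translation:
  fixes g :: "'v::euclidean_space \<Rightarrow> real"
  assumes "integrable lborel g"
  shows "integrable lborel (\<lambda>x. g (c + x))" "(\<integral>x. g (c + x) \<partial>lborel) = (\<integral>x. g x \<partial>lborel)"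
proof -
  have m: "(+) c \<in> measurable lborel borel" by simp
  have g: "g \<in> borel_measurable borel" using assms by (simp add: borel_measurable_integrable)
  show "integrable lborel (\<lambda>x. g (c + x))"
    using integrable_distr_eq[OF m g] assms by (simp add: lborel_distr_plus)
  show "(\<integral>x. g (c + x) \<partial>lborel) = (\<integral>x. g x \<partial>lborel)"
    using integral_distr[OF m g] by (simp add: lborel_distr_plus)
qed

lemma frechet_derivative_outside_support:
  fixes g :: "'v::real_normed_vector \<Rightarrow> real"
  assumes "closed K" "\<And>x. x \<notin> K \<Longrightarrow> g x = 0" "x \<notin> K"
  shows "frechet_derivative g (at x) = (\<lambda>_. 0)"
proof -
  have "(g has_derivative (\<lambda>_. 0)) (at x)"
    by (rule has_derivative_transform_within_open[where f="\<lambda>_. 0" and s="- K", OF has_derivative_const])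
      (use assms in auto)
  from frechet_derivative_at[OF this] show ?thesis by simp
qed

text \<open>By translation invariance every difference quotient of \<open>g\<close> along
  \<open>v\<close> has integral 0, and dominated convergence passes to the derivative. The mean
  value theorem writes each quotient as a value of the derivative nearby, which yields the
  dominating function.\<close>

lemma integral_directional_derivative_0:
  fixes g :: "'v::euclidean_space \<Rightarrow> real"
  assumes g: "smooth_on UNIV g" and K: "compact K" "\<And>x. x \<notin> K \<Longrightarrow> g x = 0"
  shows "integral UNIV (\<lambda>x. frechet_derivative g (at x) v) = 0"
proof -
  let ?D = "\<lambda>x. frechet_derivative g (at x) v"
  have int: "integrable lborel k" if "continuous_on UNIV k" "compact C" "\<And>x. x \<notin> C \<Longrightarrow> k x = 0"
    for k :: "'v \<Rightarrow> real" and C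
  proof -
    have "(\<lambda>x. indicator C x *\<^sub>R k x) = k" using that(3) by (force simp: indicator_def)
    then show ?thesis using borel_integrable_compact[OF that(2), of k] that(1) continuous_on_subset by fastforce
  qed
  have gc: "continuous_on UNIV g" by (rule smooth_on_continuous[OF g])
  have Dc: "continuous_on UNIV ?D" by (rule smooth_on_continuous[OF smooth_on_frechet[OF g]])
  have D0: "?D x = 0" if "x \<notin> K" for x
    using frechet_derivative_outside_support[OF compact_imp_closed[OF K(1)] K(2) that] by simp
  obtain C where C: "\<And>x. \<bar>?D x\<bar> \<le> C" "C \<ge> 0"
  proof -
    have "bounded (?D ` K)"
      by (intro compact_imp_bounded compact_continuous_image continuous_on_subset[OF Dc] K(1)) simp
    then obtain C where "\<And>x. x \<in> K \<Longrightarrow> \<bar>?D x\<bar> \<le> C" by (auto simp: bounded_iff)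
    then have "\<bar>?D x\<bar> \<le> max C 0" for x using D0[of x] by (cases "x \<in> K") (auto simp: le_max_iff_disj)
    then show ?thesis using that[of "max C 0"] by auto
  qed
  \<comment> \<open>The points from which some \<open>t *\<^sub>R v\<close> with \<open>t\<close> in
    [0, 1] leads into \<open>K\<close>. The quotients use steps of size at most 1 and vanish off
    this compact set.\<close>
  define K' where "K' = (\<lambda>(x, t). x - t *\<^sub>R v) ` (K \<times> {0..1::real})"
  have "compact K'" unfolding K'_def
    by (intro compact_continuous_image compact_Times K(1)) (auto intro!: continuous_intros simp: case_prod_unfold)
  define q where "q k x = (g (inverse (Suc k) *\<^sub>R v + x) - g x) / inverse (Suc k)" for k :: nat and x
  have along: "((\<lambda>s. g (x + s *\<^sub>R v)) has_real_derivative ?D (x + t *\<^sub>R v)) (at t)" for x t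
    by (rule has_real_derivative_along) (use smooth_on_has_derivative[OF g] in \<open>auto simp: differentiable_def\<close>)
  have q_eq: "\<exists>t\<in>{0..1}. q k x = ?D (x + t *\<^sub>R v)" for k x
  proof -
    let ?h = "inverse (real (Suc k))"
    have "\<exists>t. 0 < t \<and> t < ?h \<and> g (x + ?h *\<^sub>R v) - g (x + 0 *\<^sub>R v) = (?h - 0) * ?D (x + t *\<^sub>R v)"
      by (rule MVT2) (use along in auto)
    then obtain t where "0 < t" "t < ?h" "g (x + ?h *\<^sub>R v) - g x = ?h * ?D (x + t *\<^sub>R v)" by auto
    moreover have "?h \<le> 1" by (simp add: field_simps)
    ultimately show ?thesis by (intro bexI[of _ t]) (auto simp: q_def add.commute)
  qed
  have "(\<lambda>k. \<integral>x. q k x \<partial>lborel) \<longlonglongrightarrow> (\<integral>x. ?D x \<partial>lborel)"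
  proof (rule integral_dominated_convergence)
    show "?D \<in> borel_measurable lborel" using int[OF Dc K(1) D0] by (rule borel_measurable_integrable)
    show "q k \<in> borel_measurable lborel" for k
      unfolding q_def using int[OF gc K] integral_translation(1)[OF int[OF gc K]]
      by (intro borel_measurable_divide borel_measurable_diff borel_measurable_const borel_measurable_integrable) auto
    show "integrable lborel (\<lambda>x. indicator K' x *\<^sub>R C)"
      by (rule borel_integrable_compact[OF \<open>compact K'\<close>]) simp
    show "AE x in lborel. (\<lambda>k. q k x) \<longlonglongrightarrow> ?D x"
    proof (rule AE_I2)
      fix x
      have "((\<lambda>h. (g (x + (0 + h) *\<^sub>R v) - g (x + 0 *\<^sub>R v)) / h) \<longlongrightarrow> ?D (x + 0 *\<^sub>R v)) (at 0)"
        using along[of x 0] unfolding DERIV_def .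
      moreover have "filterlim (\<lambda>k. inverse (real (Suc k))) (at 0) sequentially"
        using LIMSEQ_inverse_real_of_nat by (auto simp: filterlim_at)
      ultimately have "(\<lambda>k. (g (x + (0 + inverse (real (Suc k))) *\<^sub>R v) - g (x + 0 *\<^sub>R v)) / inverse (real (Suc k)))
          \<longlonglongrightarrow> ?D (x + 0 *\<^sub>R v)"
        by (rule filterlim_compose)
      then show "(\<lambda>k. q k x) \<longlonglongrightarrow> ?D x" by (simp add: q_def add.commute)
    qed
    show "AE x in lborel. norm (q k x) \<le> indicator K' x *\<^sub>R C" for k
    proof (rule AE_I2)
      fix x
      obtain t where t: "t \<in> {0..1}" "q k x = ?D (x + t *\<^sub>R v)" using q_eq by blast
      show "norm (q k x) \<le> indicator K' x *\<^sub>R C"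
      proof (cases "x + t *\<^sub>R v \<in> K")
        case True
        then have "x \<in> K'" unfolding K'_def using t(1) by (intro image_eqI[of _ _ "(x + t *\<^sub>R v, t)"]) auto
        then show ?thesis using C(1) t(2) by simp
      qed (use t(2) D0 C(2) in \<open>auto simp: indicator_def\<close>)
    qed
  qed
  moreover have "(\<integral>x. q k x \<partial>lborel) = 0" for k
    unfolding q_def using int[OF gc K] integral_translation[OF int[OF gc K]] by simp
  ultimately have "(\<lambda>k. 0) \<longlonglongrightarrow> (\<integral>x. ?D x \<partial>lborel)" by simp
  from LIMSEQ_unique[OF tendsto_const this] have "(\<integral>x. ?D x \<partial>lborel) = 0" by simp
  then show ?thesis using integral_lborel[OF int[OF Dc K(1) D0]] by simp
qed

section \<open>Integration and Stokes' theorem\<close>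

context compact_complex_manifold
begin

section \<open>Functions as forms of degree 0\<close>

definition fun_form :: "('a \<Rightarrow> real) \<Rightarrow> ('a, 'n) form" where
  "fun_form f = (\<lambda>c x vs. f (cinv c x))"

lemma smooth_form_fun:
  assumes "smooth_fun_on M UNIV f"
  shows "smooth_form M 0 (fun_form f)"
proof (rule smooth_formI)
  show "alternating 0 (fun_form f c x)" for c x by (simp add: alternating_def)
  show "smooth_on (cran c) (\<lambda>x. fun_form f c x vs)" if "c \<in> M" for c vs
    using assms that by (simp add: smooth_fun_on_UNIV_iff fun_form_def)
qed (simp add: fun_form_def cinv_cmap)

lemma ext_d_fun_form: "ext_d (fun_form f) c x [v] = frechet_derivative (\<lambda>y. f (cinv c y)) (at x) v"
  by (simp add: ext_d_def fun_form_def)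

lemma chain_rule_transition:
  assumes f: "smooth_fun_on M UNIV f" and c: "c \<in> M" "c' \<in> M" and p: "p \<in> cdom c" "p \<in> cdom c'"
  shows "frechet_derivative (\<lambda>y. f (cinv c y)) (at (cmap c p)) v =
    frechet_derivative (\<lambda>y. f (cinv c' y)) (at (cmap c' p))
      (frechet_derivative (\<lambda>x. cmap c' (cinv c x)) (at (cmap c p)) v)"
proof -
  let ?U = "cmap c ` (cdom c \<inter> cdom c')" and ?T = "\<lambda>x. cmap c' (cinv c x)"
  have U: "open ?U" using open_cmap_image[OF c(1) open_cdom[OF c(2)]] .
  have T: "(?T has_derivative frechet_derivative ?T (at (cmap c p))) (at (cmap c p))"
    by (rule smooth_on_has_derivative[OF smooth_on_transition[OF c]]) (use p in auto)
  have "((\<lambda>y. f (cinv c' y)) has_derivative frechet_derivative (\<lambda>y. f (cinv c' y)) (at (cmap c' p))) (at (cmap c' p))"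
    using f c cmap_in[OF p(2)] by (intro smooth_on_has_derivative) (auto simp: smooth_fun_on_UNIV_iff)
  then have g: "((\<lambda>y. f (cinv c' y)) has_derivative frechet_derivative (\<lambda>y. f (cinv c' y)) (at (cmap c' p))) (at (?T (cmap c p)))"
    using c p by (simp add: cinv_cmap)
  have "((\<lambda>x. f (cinv c' (?T x))) has_derivative (\<lambda>v. frechet_derivative (\<lambda>y. f (cinv c' y)) (at (cmap c' p))
      (frechet_derivative ?T (at (cmap c p)) v))) (at (cmap c p))"
    by (rule has_derivative_compose[OF T g])
  then have "((\<lambda>y. f (cinv c y)) has_derivative (\<lambda>v. frechet_derivative (\<lambda>y. f (cinv c' y)) (at (cmap c' p))
      (frechet_derivative ?T (at (cmap c p)) v))) (at (cmap c p))"
    by (rule has_derivative_transform_within_open[OF _ U]) (use p c in \<open>auto simp: cinv_cmap\<close>)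
  from frechet_derivative_at[OF this, symmetric] show ?thesis by simp
qed

lemma smooth_form_ext_d_fun:
  assumes f: "smooth_fun_on M UNIV f"
  shows "smooth_form M 1 (ext_d (fun_form f))"
proof (rule smooth_formI)
  have eq: "ext_d (fun_form f) c x vs = frechet_derivative (\<lambda>y. f (cinv c y)) (at x) (vs ! 0)" if "length vs = 1" for c x vs
    using that by (cases vs) (auto simp: ext_d_fun_form)
  fix c assume c: "c \<in> M"
  have f': "smooth_on (cran c) (\<lambda>y. f (cinv c y))" using f c by (simp add: smooth_fun_on_UNIV_iff)
  show "smooth_on (cran c) (\<lambda>x. ext_d (fun_form f) c x vs)" if "length vs = 1" for vs
    unfolding eq[OF that] by (rule smooth_on_frechet[OF f'])
  show "alternating 1 (ext_d (fun_form f) c x)" if x: "x \<in> cran c" for x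
  proof -
    have "linear (frechet_derivative (\<lambda>y. f (cinv c y)) (at x))"
      using has_derivative_linear[OF smooth_on_has_derivative[OF f' x]] .
    then show ?thesis unfolding alternating_def by (auto simp: eq)
  qed
  show "ext_d (fun_form f) c (cmap c p) vs = ext_d (fun_form f) c' (cmap c' p)
      (map (frechet_derivative (\<lambda>x. cmap c' (cinv c x)) (at (cmap c p))) vs)"
    if "c' \<in> M" "p \<in> cdom c" "p \<in> cdom c'" "length vs = 1" for c' p vs
    using that c by (simp add: eq chain_rule_transition[OF f c that(1-3)])
qed

lemma wedge_fun_form:
  assumes "smooth_form M k \<xi>" "c \<in> M" "x \<in> cran c" "length vs = k"
  shows "wedge 0 k (fun_form f) \<xi> c x vs = f (cinv c x) * \<xi> c x vs"
  unfolding wedge_eq_cwedge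
  by (subst cwedge_0_left[OF smooth_form_alternating[OF assms(1-3)] assms(4)]) (simp add: fun_form_def)

text \<open>By the Leibniz rule, compatibility of \<open>d (f \<xi>)\<close> with the transition maps follows from that of
  \<open>df\<close> and \<open>d \<xi>\<close>. Naturality of \<open>ext_d\<close> is thus needed for functions only.\<close>

lemma smooth_ext_d_fun_wedge:
  assumes f: "smooth_fun_on M UNIV f" and xi: "smooth_form M k \<xi>" and eta: "smooth_form M (Suc k) \<eta>"
    and eq: "form_eq M (Suc k) \<eta> (ext_d \<xi>)"
  shows "\<exists>\<tau>. smooth_form M (Suc k) \<tau> \<and> form_eq M (Suc k) \<tau> (ext_d (wedge 0 k (fun_form f) \<xi>)) \<and>
    (\<forall>c\<in>M. \<forall>x\<in>cran c. \<forall>vs. length vs = Suc k \<longrightarrow>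
      \<tau> c x vs = wedge 1 k (ext_d (fun_form f)) \<xi> c x vs + f (cinv c x) * \<eta> c x vs)"
proof -
  let ?a = "wedge 1 k (ext_d (fun_form f)) \<xi>" and ?b = "wedge 0 (Suc k) (fun_form f) \<eta>"
  let ?\<tau> = "form_diff ?a (form_scale (- 1) ?b)"
  have "smooth_form M (Suc k) ?a" "smooth_form M (Suc k) ?b"
    using smooth_form_wedge[OF smooth_form_ext_d_fun[OF f] xi] smooth_form_wedge[OF smooth_form_fun[OF f] eta] by auto
  then have s: "smooth_form M (Suc k) ?\<tau>" by (intro smooth_form_diff smooth_form_scale)
  have "form_eq M (Suc k) ?\<tau> (ext_d (wedge 0 k (fun_form f) \<xi>))"
    unfolding form_eq_def form_diff_def form_scale_def
    using wedge_form_eq_right[OF eq, of _ _ 0 "fun_form f"]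
    by (auto simp: ext_d_wedge[OF smooth_form_fun[OF f] xi])
  moreover have "?\<tau> c x vs = ?a c x vs + f (cinv c x) * \<eta> c x vs"
    if "c \<in> M" "x \<in> cran c" "length vs = Suc k" for c x vs
    using wedge_fun_form[OF eta that, of f] by (simp add: form_diff_def form_scale_def)
  ultimately show ?thesis using s by blast
qed

section \<open>Integrands with compact support in a chart\<close>

lemma compact_closed_subset: "closed K \<Longrightarrow> compact (K :: 'a set)"
  using compact_Int_closed[OF compact_UNIV, of K] by simp

lemma compact_cmap_image: "c \<in> M \<Longrightarrow> closed K \<Longrightarrow> K \<subseteq> cdom c \<Longrightarrow> compact (cmap c ` K)"
  by (intro compact_continuous_image compact_closed_subset continuous_on_subset[OF cont_cmap])

lemma zero_extend_smooth:
  fixes g :: "complex^'n \<Rightarrow> real"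
  assumes "open S" "smooth_on S g" "closed K" "K \<subseteq> S" "\<And>x. x \<in> S - K \<Longrightarrow> g x = 0"
  shows "smooth_on UNIV (zero_extend S g)"
proof (rule smooth_on_localI)
  fix x :: "complex^'n"
  show "\<exists>T. open T \<and> x \<in> T \<and> smooth_on T (zero_extend S g)"
  proof (cases "x \<in> S")
    case True
    have "smooth_on S (zero_extend S g)"
      using assms(2) by (rule smooth_on_cong[OF assms(1), rotated]) (simp add: zero_extend_def)
    then show ?thesis using True assms(1) by blast
  next
    case False
    have "smooth_on (- K) (zero_extend S g)"
      by (rule smooth_on_cong[OF _ _ smooth_on_const[of _ 0]]) (use assms in \<open>auto simp: zero_extend_def\<close>)
    moreover have "x \<in> - K" "open (- K)" using False assms by auto
    ultimately show ?thesis by blast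
  qed
qed

text \<open>Evaluated on the fixed basis, the exterior derivative is a signed sum of directional
  derivatives of compactly supported coefficients, and each of these integrates to 0.\<close>

lemma integral_ext_d_compact_support:
  assumes xi: "smooth_form M k \<xi>" and k: "Suc k = 2 * CARD('n)" and c: "c \<in> M"
    and K: "closed K" "K \<subseteq> cdom c"
    and supp: "\<And>p vs. p \<in> cdom c - K \<Longrightarrow> length vs = k \<Longrightarrow> \<xi> c (cmap c p) vs = 0"
  shows "integral (cran c) (\<lambda>x. ext_d \<xi> c x oriented_basis) = 0"
proof -
  let ?C = "cmap c ` K" and ?B = "oriented_basis :: (complex^'n) list"
  have C: "compact ?C" by (rule compact_cmap_image[OF c K])
  have CS: "?C \<subseteq> cran c" using K(2) by (auto simp: cmap_in)
  define g where "g i = zero_extend (cran c) (\<lambda>y. \<xi> c y (remove_at i ?B))" for i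
  have len: "length (remove_at i ?B) = k" if "i < Suc k" for i
    using that k by (simp add: length_remove_at oriented_basis)
  have z: "\<xi> c x (remove_at i ?B) = 0" if "x \<in> cran c - ?C" "i < Suc k" for x i
  proof -
    have "cinv c x \<in> cdom c - K" using that cinv_in[OF c] cmap_cinv[OF c] by (metis DiffE DiffI imageI)
    from supp[OF this len[OF that(2)]] show ?thesis using that cmap_cinv[OF c] by simp
  qed
  have g_smooth: "smooth_on UNIV (g i)" if "i < Suc k" for i
    unfolding g_def
    by (rule zero_extend_smooth[OF open_cran[OF c] smooth_form_smooth[OF xi c len[OF that]] compact_imp_closed[OF C] CS])
      (use z that in auto)
  have g0: "g i x = 0" if "i < Suc k" "x \<notin> ?C" for i x
    using z that by (auto simp: g_def zero_extend_def)
  have D0: "frechet_derivative (g i) (at x) v = 0" if "i < Suc k" "x \<notin> ?C" for i x v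
    using frechet_derivative_outside_support[OF compact_imp_closed[OF C], of "g i"] g0 that by simp
  have int: "(\<lambda>x. (- 1) ^ i * frechet_derivative (g i) (at x) (?B ! i)) integrable_on UNIV" if "i < Suc k" for i
    using absolutely_integrable_compact_support[OF smooth_on_continuous[OF smooth_on_frechet[OF g_smooth[OF that]]] C D0[OF that]]
    by (auto simp: absolutely_integrable_on_def)
  have "zero_extend (cran c) (\<lambda>x. ext_d \<xi> c x ?B) x = (\<Sum>i<Suc k. (- 1) ^ i * frechet_derivative (g i) (at x) (?B ! i))" for x
  proof (cases "x \<in> cran c")
    case True
    have "frechet_derivative (\<lambda>y. \<xi> c y (remove_at i ?B)) (at x) = frechet_derivative (g i) (at x)" if "i < Suc k" for i
    proof (rule frechet_derivative_transform_within_open[OF _ open_cran[OF c] True])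
      show "(\<lambda>y. \<xi> c y (remove_at i ?B)) differentiable at x"
        using smooth_form_has_derivative[OF xi c len[OF that] True] by (auto simp: differentiable_def)
    qed (simp add: g_def zero_extend_def)
    then show ?thesis using True k by (simp add: zero_extend_def ext_d_remove_at oriented_basis del: sum.lessThan_Suc)
  next
    case False
    then have "x \<notin> ?C" using CS by auto
    then show ?thesis using False D0 by (simp add: zero_extend_def del: sum.lessThan_Suc)
  qed
  then have "zero_extend (cran c) (\<lambda>x. ext_d \<xi> c x ?B) =
      (\<lambda>x. \<Sum>i<Suc k. (- 1) ^ i * frechet_derivative (g i) (at x) (?B ! i))" by (rule ext)
  then have "integral (cran c) (\<lambda>x. ext_d \<xi> c x ?B) =
      integral UNIV (\<lambda>x. \<Sum>i<Suc k. (- 1) ^ i * frechet_derivative (g i) (at x) (?B ! i))"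
    unfolding integral_zero_extend[of "cran c", symmetric] by (rule arg_cong)
  also have "\<dots> = (\<Sum>i<Suc k. integral UNIV (\<lambda>x. (- 1) ^ i * frechet_derivative (g i) (at x) (?B ! i)))"
    by (rule integral_sum) (use int in auto)
  also have "\<dots> = 0"
    using integral_directional_derivative_0[OF g_smooth C g0] by (intro sum.neutral) auto
  finally show ?thesis .
qed

text \<open>The support condition concerns the product, since in the proof of Stokes' theorem the
  vanishing is due sometimes to the partition function \<open>g\<close> and sometimes to the form
  \<tau>.\<close>

lemma
  assumes tau: "smooth_form M (2 * CARD('n)) \<tau>" and g: "smooth_fun_on M UNIV g" and c: "c \<in> M"
    and K: "closed K" "K \<subseteq> cdom c"
    and supp: "\<And>p. p \<in> cdom c - K \<Longrightarrow> g p * \<tau> c (cmap c p) oriented_basis = 0"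
  shows continuous_density: "continuous_on (cran c) (\<lambda>x. g (cinv c x) * \<tau> c x oriented_basis)"
    and density_support: "x \<in> cran c - cmap c ` K \<Longrightarrow> g (cinv c x) * \<tau> c x oriented_basis = 0"
    and density_integrable: "(\<lambda>x. g (cinv c x) * \<tau> c x oriented_basis) integrable_on cran c"
proof -
  let ?h = "\<lambda>x. g (cinv c x) * \<tau> c x oriented_basis"
  have "smooth_on (cran c) ?h"
    using g c by (intro smooth_on_mult open_cran smooth_form_smooth[OF tau]) (auto simp: smooth_fun_on_UNIV_iff oriented_basis)
  then show cont: "continuous_on (cran c) ?h" by (rule smooth_on_continuous)
  show supp': "?h x = 0" if "x \<in> cran c - cmap c ` K" for x
  proof -
    have "cinv c x \<in> cdom c - K" using that cinv_in[OF c] cmap_cinv[OF c] by (metis DiffE DiffI imageI)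
    from supp[OF this] show ?thesis using that cmap_cinv[OF c] by simp
  qed
  have C: "compact (cmap c ` K)" "cmap c ` K \<subseteq> cran c"
    using compact_cmap_image[OF c K] K(2) by (auto simp: cmap_in)
  have "zero_extend (cran c) ?h absolutely_integrable_on UNIV"
    by (rule absolutely_integrable_compact_support[OF zero_extend_continuous[OF open_cran[OF c] cont C supp'] C(1)])
      (use supp' in \<open>auto simp: zero_extend_def\<close>)
  then have "?h absolutely_integrable_on cran c"
    unfolding zero_extend_def by (simp only: absolutely_integrable_restrict_UNIV)
  then show "?h integrable_on cran c" by (simp add: absolutely_integrable_on_def)
qed

text \<open>The positive top form \<open>\<Omega>\<close> orients the atlas: it forces the transition maps to have
  positive Jacobian.\<close>

lemma integral_change_chart:
  assumes Om: "smooth_form M (2 * CARD('n)) \<Omega>" "\<And>c x. c \<in> M \<Longrightarrow> x \<in> cran c \<Longrightarrow> \<Omega> c x oriented_basis > 0"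
    and tau: "smooth_form M (2 * CARD('n)) \<tau>" and g: "smooth_fun_on M UNIV g"
    and c: "c \<in> M" "c' \<in> M" and K: "closed K" "K \<subseteq> cdom c \<inter> cdom c'"
    and supp: "\<And>p. p \<in> cdom c - K \<Longrightarrow> g p * \<tau> c (cmap c p) oriented_basis = 0"
      "\<And>p. p \<in> cdom c' - K \<Longrightarrow> g p * \<tau> c' (cmap c' p) oriented_basis = 0"
  shows "integral (cran c) (\<lambda>x. g (cinv c x) * \<tau> c x oriented_basis) =
    integral (cran c') (\<lambda>x. g (cinv c' x) * \<tau> c' x oriented_basis)"
proof -
  let ?B = "oriented_basis :: (complex^'n) list"
  let ?U = "cmap c ` (cdom c \<inter> cdom c')" and ?V = "cmap c' ` (cdom c \<inter> cdom c')"
  let ?T = "\<lambda>x. cmap c' (cinv c x)"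
  let ?G = "\<lambda>x. g (cinv c x) * \<tau> c x ?B" and ?H = "\<lambda>x. g (cinv c' x) * \<tau> c' x ?B"
  have Kc: "K \<subseteq> cdom c" "K \<subseteq> cdom c'" using K(2) by auto
  have U: "open ?U" using open_cmap_image[OF c(1) open_cdom[OF c(2)]] .
  have V: "open ?V" using open_cmap_image[OF c(2) open_cdom[OF c(1)]] by (simp add: Int_commute)
  have US: "?U \<subseteq> cran c" and VS: "?V \<subseteq> cran c'" by (auto simp: cmap_in)
  have "integral ?U ?G = integral ?V ?H"
  proof (rule integral_change_of_variables_complex[OF U V])
    show "?T ` ?U = ?V" using c by (auto simp: cinv_cmap image_iff)
    show "inj_on ?T ?U"
    proof (rule inj_onI)
      fix x y assume "x \<in> ?U" "y \<in> ?U" "?T x = ?T y"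
      then show "x = y" using c by (auto simp: cinv_cmap) (metis cinv_cmap)
    qed
    show der: "(?T has_derivative frechet_derivative ?T (at x)) (at x)" if "x \<in> ?U" for x
      by (rule smooth_on_has_derivative[OF smooth_on_transition[OF c] that])
    show "continuous_on ?V ?H"
      using continuous_density[OF tau g c(2) K(1) Kc(2) supp(2)] VS by (rule continuous_on_subset)
    show "continuous_on ?U ?G"
      using continuous_density[OF tau g c(1) K(1) Kc(1) supp(1)] US by (rule continuous_on_subset)
    show "compact (cmap c' ` K)" "compact (cmap c ` K)"
      using compact_cmap_image c K(1) Kc by auto
    show "cmap c' ` K \<subseteq> ?V" "cmap c ` K \<subseteq> ?U" using K(2) by auto
    show "?H y = 0" if "y \<in> ?V - cmap c' ` K" for y
      using density_support[OF tau g c(2) K(1) Kc(2) supp(2)] that VS by blast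
    show "?G x = 0" if "x \<in> ?U - cmap c ` K" for x
      using density_support[OF tau g c(1) K(1) Kc(1) supp(1)] that US by blast
    fix x assume x: "x \<in> ?U"
    then obtain p where p: "p \<in> cdom c" "p \<in> cdom c'" "x = cmap c p" by auto
    let ?A = "frechet_derivative ?T (at x)"
    let ?d = "det (matrix (\<lambda>v. real_coords (?A (of_real_coords v))))"
    have lin: "linear ?A" using has_derivative_linear[OF der[OF x]] .
    have pull: "\<eta> c x ?B = ?d * \<eta> c' (?T x) ?B" if eta: "smooth_form M (2 * CARD('n)) \<eta>" for \<eta>
    proof -
      have "\<eta> c x ?B = \<eta> c' (?T x) (map ?A ?B)"
        using smooth_form_compat[OF eta c p(1,2), of ?B] p c by (simp add: oriented_basis cinv_cmap)
      also have "\<dots> = ?d * \<eta> c' (?T x) ?B"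
        using p c by (intro alternating_oriented_basis lin smooth_form_alternating[OF eta]) (auto simp: cinv_cmap cmap_in)
      finally show ?thesis .
    qed
    have "\<Omega> c x ?B > 0" "\<Omega> c' (?T x) ?B > 0" using p c by (auto intro!: Om(2) simp: cmap_in cinv_cmap)
    then have "?d > 0" using pull[OF Om(1)] by (metis zero_less_mult_pos2)
    then show "?G x = \<bar>?d\<bar> * ?H (?T x)"
      using pull[OF tau] p c by (simp add: cinv_cmap mult_ac)
  qed
  moreover have "integral (cran c) ?G = integral ?U ?G"
  proof -
    have "zero_extend (cran c) ?G = zero_extend ?U ?G"
      using density_support[OF tau g c(1) K(1) Kc(1) supp(1)] US K(2) by (fastforce simp: zero_extend_def fun_eq_iff)
    then show ?thesis
      unfolding integral_zero_extend[of "cran c", symmetric] integral_zero_extend[of ?U, symmetric] by (rule arg_cong)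
  qed
  moreover have "integral (cran c') ?H = integral ?V ?H"
  proof -
    have "zero_extend (cran c') ?H = zero_extend ?V ?H"
      using density_support[OF tau g c(2) K(1) Kc(2) supp(2)] VS K(2) by (fastforce simp: zero_extend_def fun_eq_iff)
    then show ?thesis
      unfolding integral_zero_extend[of "cran c'", symmetric] integral_zero_extend[of ?V, symmetric] by (rule arg_cong)
  qed
  ultimately show ?thesis by simp
qed

text \<open>Literally the choice made inside \<open>form_integral\<close>, so that all integrals
  below refer to the same partition.\<close>

definition pou :: "('a, 'n) chart set \<times> (('a, 'n) chart \<Rightarrow> 'a \<Rightarrow> real)" where
  "pou = (SOME (F, \<rho>). partition_of_unity M F \<rho>)"

lemma pou: "partition_of_unity M (fst pou) (snd pou)"
proof -
  have "\<exists>x. (\<lambda>(F, \<rho>). partition_of_unity M F \<rho>) x" using partition_of_unity_exists by auto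
  from someI_ex[OF this] show ?thesis unfolding pou_def by (simp add: case_prod_unfold)
qed

lemma form_integral_pou: "form_integral M \<eta> =
    (\<Sum>c\<in>fst pou. integral (cran c) (\<lambda>x. snd pou c (cinv c x) * \<eta> c x oriented_basis))"
  unfolding form_integral_def pou_def[symmetric] by (simp add: Let_def case_prod_unfold)

definition pou_supp :: "('a, 'n) chart \<Rightarrow> 'a set" where
  "pou_supp c = closure {p. snd pou c p \<noteq> 0}"

lemma closed_pou_supp: "closed (pou_supp c)"
  by (simp add: pou_supp_def)

lemma pou_outside: "p \<notin> pou_supp c \<Longrightarrow> snd pou c p = 0"
  unfolding pou_supp_def using subsetD[OF closure_subset, of p "{p. snd pou c p \<noteq> 0}"] by auto

lemma
  assumes "c \<in> fst pou"
  shows pou_chart: "c \<in> M" and pou_smooth: "smooth_fun_on M UNIV (snd pou c)"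
    and pou_nonneg: "snd pou c p \<ge> 0" and pou_support: "pou_supp c \<subseteq> cdom c"
proof -
  have *: "fst pou \<subseteq> M" "smooth_fun_on M UNIV (snd pou c) \<and> (\<forall>p. snd pou c p \<ge> 0) \<and>
      closure {p. snd pou c p \<noteq> 0} \<subseteq> cdom c"
    using pou assms unfolding partition_of_unity_def by auto
  show "c \<in> M" using *(1) assms by (rule subsetD)
  show "smooth_fun_on M UNIV (snd pou c)" "snd pou c p \<ge> 0" "pou_supp c \<subseteq> cdom c"
    using *(2) by (auto simp: pou_supp_def)
qed

lemma pou_finite: "finite (fst pou)" and pou_sum: "(\<Sum>c\<in>fst pou. snd pou c p) = 1"
  using pou unfolding partition_of_unity_def by auto

section \<open>Linearity and positivity of the integral\<close>

lemma pou_integrable: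
  assumes "smooth_form M (2 * CARD('n)) \<tau>" "c \<in> fst pou"
  shows "(\<lambda>x. snd pou c (cinv c x) * \<tau> c x oriented_basis) integrable_on cran c"
  by (rule density_integrable[OF assms(1) pou_smooth[OF assms(2)] pou_chart[OF assms(2)] closed_pou_supp pou_support[OF assms(2)]])
    (simp add: pou_outside)

lemma form_integral_diff:
  assumes "smooth_form M (2 * CARD('n)) \<alpha>" "smooth_form M (2 * CARD('n)) \<beta>"
  shows "form_integral M (form_diff \<alpha> \<beta>) = form_integral M \<alpha> - form_integral M \<beta>"
  unfolding form_integral_pou form_diff_def right_diff_distrib
  by (simp add: integral_diff pou_integrable[OF assms(1)] pou_integrable[OF assms(2)] sum_subtractf)

lemma form_integral_scale: "form_integral M (form_scale r \<alpha>) = r * form_integral M \<alpha>"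
  unfolding form_integral_pou form_scale_def mult.left_commute[of _ r]
  by (simp add: sum_distrib_left)

text \<open>At any point some partition function is positive, so its integrand is positive there. A
  nonnegative continuous function on a box that is positive somewhere cannot have integral 0, and
  the other charts contribute nonnegative terms.\<close>

lemma form_integral_pos:
  assumes tau: "smooth_form M (2 * CARD('n)) \<tau>" and pos: "\<And>c x. c \<in> M \<Longrightarrow> x \<in> cran c \<Longrightarrow> \<tau> c x oriented_basis > 0"
  shows "form_integral M \<tau> > 0"
proof -
  let ?h = "\<lambda>c x. snd pou c (cinv c x) * \<tau> c x oriented_basis"
  have nonneg: "?h c x \<ge> 0" if "c \<in> fst pou" "x \<in> cran c" for c x
    using pos[OF pou_chart[OF that(1)] that(2)] pou_nonneg[OF that(1)] by (simp add: mult_nonneg_nonneg less_imp_le)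
  \<comment> \<open>Types are inhabited, so the manifold has a point.\<close>
  obtain p :: 'a where True by simp
  have "\<not> (\<forall>c\<in>fst pou. snd pou c p = 0)" using pou_sum[of p] by (metis sum.neutral zero_neq_one)
  then obtain c where c: "c \<in> fst pou" "snd pou c p \<noteq> 0" by blast
  have cM: "c \<in> M" using pou_chart c by blast
  have p: "p \<in> cdom c" using pou_support[OF c(1)] c(2) pou_outside by blast
  let ?x = "cmap c p"
  have "?h c ?x > 0"
    using pos[OF cM cmap_in[OF p]] c(2) pou_nonneg[OF c(1), of p] cinv_cmap[OF cM p] by simp
  moreover have "open (cran c)" "?x \<in> cran c" using open_cran[OF cM] cmap_in[OF p] by auto
  then obtain a b where ab: "?x \<in> box a b" "cbox a b \<subseteq> cran c"
    using open_contains_cbox by (metis)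
  moreover have cont: "continuous_on (cran c) (?h c)"
    by (rule continuous_density[OF tau pou_smooth[OF c(1)] cM closed_pou_supp pou_support[OF c(1)]])
      (simp add: pou_outside)
  ultimately have "integral (cbox a b) (?h c) \<noteq> 0"
    using has_integral_0_cbox_imp_0[of a b "?h c" ?x] nonneg[OF c(1)]
    by (metis (no_types, lifting) box_subset_cbox continuous_on_subset empty_iff integrable_continuous
        integrable_integral less_irrefl subset_iff)
  moreover have "integral (cbox a b) (?h c) \<ge> 0"
    by (rule integral_nonneg) (use ab cont nonneg[OF c(1)] in \<open>auto intro: integrable_continuous continuous_on_subset\<close>)
  moreover have "integral (cbox a b) (?h c) \<le> integral (cran c) (?h c)"
    by (rule integral_subset_le)
      (use ab nonneg[OF c(1)] pou_integrable[OF tau c(1)] cont in \<open>auto intro: integrable_continuous continuous_on_subset\<close>)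
  ultimately have "integral (cran c) (?h c) > 0" by linarith
  moreover have "integral (cran k) (?h k) \<ge> 0" if "k \<in> fst pou" for k
    by (rule integral_nonneg[OF pou_integrable[OF tau that]]) (use nonneg that in auto)
  ultimately show ?thesis
    unfolding form_integral_pou using pou_finite c(1) by (intro sum_pos2[of _ c]) auto
qed

text \<open>Put \<tau>_c = d(\<rho>_c \<xi>). Because the differentials of the \<rho>_c add up to 0,
  the \<tau>_c add up to \<eta>, and the integral becomes a double sum of the products \<rho>_c
  \<tau>_c' over the charts c. Each product is moved to the chart c', in which \<tau>_c' has compact
  support; there the weights \<rho>_c sum to 1, leaving derivatives of forms supported in a single
  chart.\<close>

theorem Stokes:
  assumes Om: "smooth_form M (2 * CARD('n)) \<Omega>" "\<And>c x. c \<in> M \<Longrightarrow> x \<in> cran c \<Longrightarrow> \<Omega> c x oriented_basis > 0"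
    and eta: "smooth_form M (2 * CARD('n)) \<eta>" "exact_form M (2 * CARD('n)) \<eta>"
  shows "form_integral M \<eta> = 0"
proof -
  let ?B = "oriented_basis :: (complex^'n) list" and ?F = "fst pou" and ?\<rho> = "snd pou"
  obtain k where k: "2 * CARD('n) = Suc k" by (cases "2 * CARD('n)") auto
  obtain \<xi> where xi: "smooth_form M k \<xi>" "form_eq M (Suc k) \<eta> (ext_d \<xi>)"
    using eta(2) by (auto simp: exact_form_def k)
  have eta': "smooth_form M (Suc k) \<eta>" using eta(1) k by simp
  \<comment> \<open>The \<tau>_c must be globally compatible forms, because they are integrated in
    charts other than c as well; the explicit Leibniz formula is kept for computing their sum and
    support.\<close>
  define P where "P c \<tau> \<longleftrightarrow> smooth_form M (Suc k) \<tau> \<and> form_eq M (Suc k) \<tau> (ext_d (wedge 0 k (fun_form (?\<rho> c)) \<xi>)) \<and>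
    (\<forall>c'\<in>M. \<forall>x\<in>cran c'. \<forall>vs. length vs = Suc k \<longrightarrow>
      \<tau> c' x vs = wedge 1 k (ext_d (fun_form (?\<rho> c))) \<xi> c' x vs + ?\<rho> c (cinv c' x) * \<eta> c' x vs)" for c \<tau>
  have "\<exists>\<tau>. \<forall>c\<in>?F. P c (\<tau> c)"
    unfolding P_def by (intro bchoice ballI smooth_ext_d_fun_wedge[OF pou_smooth xi(1) eta' xi(2)])
  then obtain \<tau> where tau: "\<And>c. c \<in> ?F \<Longrightarrow> P c (\<tau> c)" by blast
  have tau1: "smooth_form M (Suc k) (\<tau> c)" if "c \<in> ?F" for c using tau[OF that] by (simp add: P_def)
  have tau2: "\<tau> c c' x ?B = ext_d (wedge 0 k (fun_form (?\<rho> c)) \<xi>) c' x ?B" if "c \<in> ?F" "c' \<in> M" "x \<in> cran c'" for c c' x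
    using tau[OF that(1)] that(2,3) by (simp add: P_def form_eq_def oriented_basis k)
  have tau3: "\<tau> c c' x ?B = wedge 1 k (ext_d (fun_form (?\<rho> c))) \<xi> c' x ?B + ?\<rho> c (cinv c' x) * \<eta> c' x ?B"
    if "c \<in> ?F" "c' \<in> M" "x \<in> cran c'" for c c' x
    using tau[OF that(1)] that(2,3) by (simp add: P_def oriented_basis k)
  have rho_d: "((\<lambda>y. ?\<rho> c (cinv c' y)) has_derivative frechet_derivative (\<lambda>y. ?\<rho> c (cinv c' y)) (at x)) (at x)"
    if "c \<in> ?F" "c' \<in> M" "x \<in> cran c'" for c c' x
    using pou_smooth[OF that(1)] that(2,3) by (intro smooth_on_has_derivative) (auto simp: smooth_fun_on_UNIV_iff)
  have supp: "\<tau> c c' (cmap c' p) ?B = 0" if "c \<in> ?F" "c' \<in> M" "p \<in> cdom c'" "p \<notin> pou_supp c" for c c' p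
  proof -
    have op: "open (cmap c' ` (cdom c' \<inter> - pou_supp c))" by (rule open_cmap_image[OF that(2)]) (simp add: closed_pou_supp open_Compl)
    have "((\<lambda>y. ?\<rho> c (cinv c' y)) has_derivative (\<lambda>_. 0)) (at (cmap c' p))"
      by (rule has_derivative_transform_within_open[where f="\<lambda>_. 0", OF has_derivative_const op])
        (use that in \<open>auto simp: cinv_cmap pou_outside\<close>)
    from frechet_derivative_at[OF this, symmetric]
    have "ext_d (fun_form (?\<rho> c)) c' (cmap c' p) vs = 0" if "length vs = 1" for vs
      using that by (cases vs) (auto simp: ext_d_fun_form)
    then have "cwedge 1 k (ext_d (fun_form (?\<rho> c)) c' (cmap c' p)) (\<xi> c' (cmap c' p)) = cwedge 1 k (\<lambda>_. 0) (\<xi> c' (cmap c' p))"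
      by (intro cwedge_cong) auto
    then have "wedge 1 k (ext_d (fun_form (?\<rho> c))) \<xi> c' (cmap c' p) ?B = 0"
      by (simp add: wedge_eq_cwedge cwedge_def)
    then show ?thesis
      using tau3[OF that(1,2) cmap_in[OF that(3)]] that(2-4) by (simp add: cinv_cmap pou_outside)
  qed
  have tau_sum: "(\<Sum>c\<in>?F. \<tau> c c' x ?B) = \<eta> c' x ?B" if c': "c' \<in> M" and x: "x \<in> cran c'" for c' x
  proof -
    have "(\<Sum>c\<in>?F. frechet_derivative (\<lambda>y. ?\<rho> c (cinv c' y)) (at x) v) = 0" for v
    proof -
      have "((\<lambda>y. \<Sum>c\<in>?F. ?\<rho> c (cinv c' y)) has_derivative
          (\<lambda>v. \<Sum>c\<in>?F. frechet_derivative (\<lambda>y. ?\<rho> c (cinv c' y)) (at x) v)) (at x)"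
        by (intro has_derivative_sum rho_d c' x)
      then have "((\<lambda>y. 1::real) has_derivative (\<lambda>v. \<Sum>c\<in>?F. frechet_derivative (\<lambda>y. ?\<rho> c (cinv c' y)) (at x) v)) (at x)"
        by (simp add: pou_sum)
      from has_derivative_unique[OF this has_derivative_const] show ?thesis by metis
    qed
    then have d0: "(\<Sum>c\<in>?F. ext_d (fun_form (?\<rho> c)) c' x vs) = 0" if "length vs = 1" for vs
      using that by (cases vs) (auto simp: ext_d_fun_form)
    have "(\<Sum>c\<in>?F. wedge 1 k (ext_d (fun_form (?\<rho> c))) \<xi> c' x ?B) =
        cwedge 1 k (\<lambda>vs. \<Sum>c\<in>?F. ext_d (fun_form (?\<rho> c)) c' x vs) (\<xi> c' x) ?B"
      unfolding wedge_eq_cwedge cwedge_def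
      by (simp add: sum_distrib_left sum_distrib_right sum.swap[of _ _ ?F] flip: sum_divide_distrib)
    also have "\<dots> = cwedge 1 k (\<lambda>_. 0) (\<xi> c' x) ?B"
      using cwedge_cong[of 1 "\<lambda>vs. \<Sum>c\<in>?F. ext_d (fun_form (?\<rho> c)) c' x vs" "\<lambda>_. 0" k] d0 by metis
    also have "\<dots> = 0" by (simp add: cwedge_def)
    finally have "(\<Sum>c\<in>?F. \<tau> c c' x ?B) = (\<Sum>c\<in>?F. ?\<rho> c (cinv c' x)) * \<eta> c' x ?B"
      by (simp add: tau3 c' x sum.distrib sum_distrib_right)
    then show ?thesis by (simp add: pou_sum)
  qed
  have integ: "(\<lambda>x. ?\<rho> c (cinv c x) * \<tau> c' c x ?B) integrable_on cran c" if "c \<in> ?F" "c' \<in> ?F" for c c'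
    using pou_integrable[of "\<tau> c'", OF _ that(1)] tau1[OF that(2)] by (simp add: k)
  \<comment> \<open>The product vanishes off the intersection of the two supports, which is closed
    and lies in both chart domains.\<close>
  have change: "integral (cran c) (\<lambda>x. ?\<rho> c (cinv c x) * \<tau> c' c x ?B) =
      integral (cran c') (\<lambda>x. ?\<rho> c (cinv c' x) * \<tau> c' c' x ?B)" if "c \<in> ?F" "c' \<in> ?F" for c c'
  proof (rule integral_change_chart[OF Om])
    show "smooth_form M (2 * CARD('n)) (\<tau> c')" using tau1[OF that(2)] k by simp
    show "smooth_fun_on M UNIV (?\<rho> c)" "c \<in> M" "c' \<in> M" using pou_smooth pou_chart that by auto
    show "closed (pou_supp c \<inter> pou_supp c')" "pou_supp c \<inter> pou_supp c' \<subseteq> cdom c \<inter> cdom c'"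
      using pou_support[OF that(1)] pou_support[OF that(2)] by (auto simp: closed_pou_supp)
    show "?\<rho> c p * \<tau> c' c (cmap c p) ?B = 0" if "p \<in> cdom c - pou_supp c \<inter> pou_supp c'" for p
      using that supp[OF \<open>c' \<in> ?F\<close> pou_chart[OF \<open>c \<in> ?F\<close>]] by (auto simp: pou_outside)
    show "?\<rho> c p * \<tau> c' c' (cmap c' p) ?B = 0" if "p \<in> cdom c' - pou_supp c \<inter> pou_supp c'" for p
      using that supp[OF \<open>c' \<in> ?F\<close> pou_chart[OF \<open>c' \<in> ?F\<close>]] by (auto simp: pou_outside)
  qed
  have integ': "(\<lambda>x. ?\<rho> c (cinv c' x) * \<tau> c' c' x ?B) integrable_on cran c'" if "c \<in> ?F" "c' \<in> ?F" for c c'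
    by (rule density_integrable[of "\<tau> c'" "?\<rho> c" c' "pou_supp c'"])
      (use that tau1 k pou_smooth pou_chart pou_support[OF that(2)] supp in \<open>auto simp: closed_pou_supp\<close>)
  have "form_integral M \<eta> = (\<Sum>c\<in>?F. integral (cran c) (\<lambda>x. \<Sum>c'\<in>?F. ?\<rho> c (cinv c x) * \<tau> c' c x ?B))"
    unfolding form_integral_pou
    by (intro sum.cong refl integral_cong) (simp add: tau_sum pou_chart flip: sum_distrib_left)
  also have "\<dots> = (\<Sum>c\<in>?F. \<Sum>c'\<in>?F. integral (cran c) (\<lambda>x. ?\<rho> c (cinv c x) * \<tau> c' c x ?B))"
    by (intro sum.cong refl integral_sum pou_finite integ)
  also have "\<dots> = (\<Sum>c\<in>?F. \<Sum>c'\<in>?F. integral (cran c') (\<lambda>x. ?\<rho> c (cinv c' x) * \<tau> c' c' x ?B))"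
    by (intro sum.cong refl change)
  also have "\<dots> = (\<Sum>c'\<in>?F. \<Sum>c\<in>?F. integral (cran c') (\<lambda>x. ?\<rho> c (cinv c' x) * \<tau> c' c' x ?B))"
    by (rule sum.swap)
  also have "\<dots> = (\<Sum>c'\<in>?F. integral (cran c') (\<lambda>x. \<Sum>c\<in>?F. ?\<rho> c (cinv c' x) * \<tau> c' c' x ?B))"
    by (intro sum.cong refl integral_sum[symmetric] pou_finite integ')
  also have "\<dots> = (\<Sum>c'\<in>?F. integral (cran c') (\<lambda>x. ext_d (wedge 0 k (fun_form (?\<rho> c')) \<xi>) c' x ?B))"
    by (intro sum.cong refl integral_cong) (simp add: pou_sum tau2 pou_chart flip: sum_distrib_right)
  also have "\<dots> = 0"
  proof (intro sum.neutral ballI integral_ext_d_compact_support)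
    fix c assume c: "c \<in> ?F"
    show "smooth_form M k (wedge 0 k (fun_form (?\<rho> c)) \<xi>)"
      using smooth_form_wedge[OF smooth_form_fun[OF pou_smooth[OF c]] xi(1)] by simp
    show "closed (pou_supp c)" "pou_supp c \<subseteq> cdom c" "c \<in> M" using pou_support[OF c] pou_chart[OF c] closed_pou_supp by auto
    show "wedge 0 k (fun_form (?\<rho> c)) \<xi> c (cmap c p) vs = 0" if "p \<in> cdom c - pou_supp c" "length vs = k" for p vs
      using that pou_chart[OF c]
      by (subst wedge_fun_form[OF xi(1)]) (auto simp: cmap_in cinv_cmap pou_outside)
  qed (use k in auto)
  finally show ?thesis .
qed

end

section \<open>The pointwise computation in dimension three\<close>

lemma cos_negative: "pi / 2 < \<theta> \<Longrightarrow> \<theta> < 3 * pi / 2 \<Longrightarrow> cos \<theta> < 0"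
  using cos_gt_zero_pi[of "pi - \<theta>"] by (simp add: cos_diff)

lemma arctan_sum_facts:
  fixes a b c :: real
  assumes th: "arctan a + arctan b + arctan c = \<theta>" "pi / 2 < \<theta>" "\<theta> < 3 * pi / 2"
  defines "s1 \<equiv> a + b + c" and "s2 \<equiv> a * b + a * c + b * c" and "s3 \<equiv> a * b * c"
  shows "s2 > 1" "s1 * cos \<theta> < sin \<theta>" "(s1 - s3) * cos \<theta> = (1 - s2) * sin \<theta>"
proof -
  \<comment> \<open>The reciprocal of the modulus of (1 + \<i> a)(1 + \<i> b)(1 + \<i> c). Hence
    \<open>cos \<theta>\<close> and \<open>sin \<theta>\<close> are \<open>C\<close> times the real
    part \<open>1 - s2\<close> and the imaginary part \<open>s1 - s3\<close> of this
    product.\<close>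
  define C where "C = cos (arctan a) * cos (arctan b) * cos (arctan c)"
  have C: "C > 0" unfolding C_def by (intro mult_pos_pos) (simp_all add: cos_arctan add_pos_nonneg)
  have sin_t: "sin (arctan x) = x * cos (arctan x)" for x by (simp add: sin_arctan cos_arctan)
  have cos: "cos \<theta> = C * (1 - s2)"
    unfolding th(1)[symmetric] C_def s2_def by (simp add: cos_add sin_add sin_t algebra_simps)
  have sin: "sin \<theta> = C * (s1 - s3)"
    unfolding th(1)[symmetric] C_def s1_def s3_def by (simp add: cos_add sin_add sin_t algebra_simps)
  show "s2 > 1" using cos_negative[OF th(2,3)] C by (simp add: cos mult_less_0_iff)
  show "(s1 - s3) * cos \<theta> = (1 - s2) * sin \<theta>" by (simp add: cos sin)
  have pos: "x + y > 0" if "arctan x + arctan y + arctan z = \<theta>" for x y z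
  proof -
    have "arctan x > arctan (- y)" using that th(2) arctan_bounded[of z] by (simp add: arctan_minus)
    then show ?thesis by (simp add: arctan_less_iff)
  qed
  have "a + b > 0" "b + c > 0" "a + c > 0"
    using pos[of a b c] pos[of b c a] pos[of a c b] th(1) by (simp_all add: ac_simps)
  then have "0 < C * ((a + b) * (b + c) * (a + c))" using C by simp
  also have "\<dots> = sin \<theta> - s1 * cos \<theta>"
    by (simp add: cos sin s1_def s2_def s3_def algebra_simps)
  finally show "s1 * cos \<theta> < sin \<theta>" by simp
qed

subsection \<open>Coefficients of (1,1)-covectors\<close>

lemma has_coeffs_basis:
  assumes "has_coeffs f A"
  shows "complex_of_real (f [axis j 1, axis k 1]) = \<i> / 2 * (A $ j $ k - A $ k $ j)"
    and "complex_of_real (f [axis j 1, axis k \<i>]) = (A $ j $ k + A $ k $ j) / 2"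
    and "complex_of_real (f [axis j \<i>, axis k \<i>]) = \<i> / 2 * (A $ j $ k - A $ k $ j)"
proof -
  have s: "(\<Sum>l\<in>UNIV. \<Sum>m\<in>UNIV. A $ l $ m * dz_dzbar l m (axis j a) (axis k b)) =
      A $ j $ k * (a * cnj b) - A $ k $ j * (b * cnj a)" for a b
  proof -
    have "(\<Sum>l\<in>UNIV. \<Sum>m\<in>UNIV. A $ l $ m * (axis p x $ l * cnj (axis q y $ m))) = A $ p $ q * (x * cnj y)" for p q x y
    proof -
      have "(\<Sum>l\<in>UNIV. \<Sum>m\<in>UNIV. A $ l $ m * (axis p x $ l * cnj (axis q y $ m))) =
          (\<Sum>l\<in>UNIV. \<Sum>m\<in>UNIV. if l = p then (if m = q then A $ p $ q * (x * cnj y) else 0) else 0)"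
        by (intro sum.cong refl) (auto simp: axis_def)
      also have "\<dots> = (\<Sum>l\<in>UNIV. if l = p then A $ p $ q * (x * cnj y) else 0)"
        by (intro sum.cong refl) (auto simp: sum.delta)
      finally show ?thesis by (simp add: sum.delta)
    qed
    then show ?thesis by (simp add: dz_dzbar_def right_diff_distrib sum_subtractf)
  qed
  show "complex_of_real (f [axis j 1, axis k 1]) = \<i> / 2 * (A $ j $ k - A $ k $ j)"
    "complex_of_real (f [axis j 1, axis k \<i>]) = (A $ j $ k + A $ k $ j) / 2"
    "complex_of_real (f [axis j \<i>, axis k \<i>]) = \<i> / 2 * (A $ j $ k - A $ k $ j)"
    using assms unfolding has_coeffs_def by (simp_all add: s field_simps)
qed

text \<open>The values on pairs of basis vectors determine the sums and differences of
  \<open>A $ j $ k\<close> and \<open>A $ k $ j\<close>, hence the matrix. This is the uniqueness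
  behind the definite description in \<open>coeffs\<close>.\<close>

lemma coeffs_eq:
  assumes "has_coeffs f A"
  shows "coeffs f = A"
  unfolding coeffs_def
proof (rule the_equality)
  have "B $ j $ k = complex_of_real (f [axis j 1, axis k \<i>]) - \<i> * complex_of_real (f [axis j 1, axis k 1])"
    if "has_coeffs f B" for B j k
    unfolding has_coeffs_basis[OF that] by (simp add: field_simps)
  then show "B = A" if "has_coeffs f B" for B using that assms by (simp add: vec_eq_iff)
qed (rule assms)

text \<open>Positivity of \<omega> on pairs \<open>v\<close>, \<open>\<i> *s v\<close> thereby
  becomes positive definiteness of its coefficient matrix, and the real values of a covector show
  that the quadratic form is real.\<close>

lemma has_coeffs_hermitian_form:
  assumes "has_coeffs f A"
  shows "complex_of_real (f [v, \<i> *s v]) = (\<Sum>j\<in>UNIV. \<Sum>k\<in>UNIV. A $ j $ k * (v $ j * cnj (v $ k)))"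
proof -
  have "complex_of_real (f [v, \<i> *s v]) = \<i> / 2 * (\<Sum>j\<in>UNIV. \<Sum>k\<in>UNIV. A $ j $ k * dz_dzbar j k v (\<i> *s v))"
    using assms by (simp add: has_coeffs_def)
  also have "\<dots> = (\<Sum>j\<in>UNIV. \<Sum>k\<in>UNIV. A $ j $ k * (v $ j * cnj (v $ k)))"
    unfolding sum_distrib_left by (intro sum.cong refl) (simp add: dz_dzbar_def field_simps)
  finally show ?thesis .
qed

subsection \<open>Eigenvalues of 3 by 3 matrices\<close>

lemma poly_det: "poly (det M) x = det (\<chi> i j. poly (M $ i $ j) x)"
  for M :: "complex poly^'n^'n"
  by (simp add: det_def poly_sum poly_prod)

lemma poly_charpoly: "poly (charpoly E) x = det (mat x - E)"
proof -
  have "(\<chi> i j. poly ((\<chi> i j. (if i = j then [:0, 1:] else 0) - [:E $ i $ j:]) $ i $ j) x) = mat x - E"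
    by (simp add: vec_eq_iff mat_def)
  then show ?thesis by (simp add: charpoly_def poly_det)
qed

text \<open>Written out, the characteristic polynomial is monic of degree 3, so over the complex
  numbers it splits into three linear factors, with multiplicity.\<close>

lemma eigenvalues_3:
  fixes E :: "complex^3^3"
  obtains a b c where "eigenvalues E = {#a, b, c#}" "\<And>x. det (mat x - E) = (x - a) * (x - b) * (x - c)"
proof -
  let ?p = "charpoly E"
  obtain u v w where p: "?p = [:u, v, w, 1:]"
  proof -
    have "?p = [:- det E, E$1$1 * E$2$2 + E$1$1 * E$3$3 + E$2$2 * E$3$3 - E$1$2 * E$2$1 - E$1$3 * E$3$1 - E$2$3 * E$3$2,
        - (E$1$1 + E$2$2 + E$3$3), 1:]"
      by (rule poly_ext) (simp add: poly_charpoly det_3 mat_def algebra_simps)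
    then show ?thesis using that by blast
  qed
  have d: "degree ?p = 3" "lead_coeff ?p = 1" using p by simp_all
  then have "size (eigenvalues E) = 3" unfolding eigenvalues_def by (simp add: size_proots_complex)
  moreover have split: "\<exists>a N. N' = add_mset a N \<and> size N = n" if sz: "size N' = Suc n" for N' :: "complex multiset" and n
  proof -
    obtain a N where "N' = add_mset a N" using size_eq_Suc_imp_eq_union[OF sz] by blast
    moreover from this have "size N = n" using sz by simp
    ultimately show ?thesis by blast
  qed
  ultimately obtain a N where "eigenvalues E = add_mset a N" "size N = Suc (Suc 0)"
    by (metis numeral_3_eq_3)
  moreover from this(2) obtain b N2 where "N = add_mset b N2" "size N2 = Suc 0" by (metis split)
  moreover from this(2) obtain c N3 where "N2 = add_mset c N3" "size N3 = 0" by (metis split)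
  ultimately have e: "eigenvalues E = {#a, b, c#}" by simp
  have "?p = [:- a, 1:] * ([:- b, 1:] * [:- c, 1:])"
    using complex_poly_decompose_multiset[of ?p] d e by (simp add: eigenvalues_def)
  then have "det (mat x - E) = (x - a) * (x - b) * (x - c)" for x
    unfolding poly_charpoly[symmetric] by (simp add: algebra_simps)
  with e show thesis by (rule that)
qed


lemma eigenvalue_eigenvector:
  fixes E :: "complex^'n^'n"
  assumes "det (mat x - E) = 0"
  obtains v where "v \<noteq> 0" "E *v v = x *s v"
proof -
  have "\<not> (\<exists>B. B ** (mat x - E) = mat 1)"
    using assms invertible_det_nz[of "mat x - E"] matrix_left_right_inverse by (metis invertible_def)
  then obtain v where "v \<noteq> 0" "(mat x - E) *v v = 0"
    using matrix_left_invertible_ker[of "mat x - E"] by blast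
  moreover have "mat x *v v = x *s v"
    by (simp add: vec_eq_iff matrix_vector_mult_def mat_def if_distrib if_distribR cong: if_cong)
  ultimately show thesis using that[of v] by (simp add: matrix_vector_mult_diff_rdistrib)
qed

definition hform :: "complex^'n^'n \<Rightarrow> complex^'n \<Rightarrow> complex" where
  "hform A v = (\<Sum>j\<in>UNIV. \<Sum>k\<in>UNIV. A $ j $ k * (v $ j * cnj (v $ k)))"

lemma hform_transpose: "hform A v = (\<Sum>k\<in>UNIV. (transpose A *v v) $ k * cnj (v $ k))"
  unfolding hform_def
  by (subst sum.swap) (simp add: matrix_vector_mult_def transpose_def sum_distrib_left sum_distrib_right mult_ac)

text \<open>Rayleigh quotient: pairing the eigenvector equation with \<open>v\<close> exhibits
  \<open>x\<close> as the quotient of the real numbers \<open>hform A v\<close> and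
  \<open>hform G v\<close>.\<close>

lemma relative_eigenvalue_real:
  fixes A G :: "complex^'n^'n"
  assumes "transpose A *v v = x *s (transpose G *v v)" "hform A v \<in> \<real>" "hform G v \<in> \<real>" "Re (hform G v) > 0"
  shows "x \<in> \<real>"
proof -
  have "hform A v = x * hform G v"
    unfolding hform_transpose assms(1) by (simp add: sum_distrib_left mult_ac)
  moreover have "hform G v \<noteq> 0" using assms(4) by auto
  ultimately have "x = hform A v / hform G v" by simp
  then show ?thesis using assms(2,3) by simp
qed

lemma hform_mat_1: "hform (mat 1) v = complex_of_real ((norm v)\<^sup>2)"
proof -
  have "hform (mat 1) v = (\<Sum>k\<in>UNIV. complex_of_real ((norm (v $ k))\<^sup>2))"
    unfolding hform_transpose complex_norm_square by (simp add: transpose_mat)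
  also have "\<dots> = complex_of_real ((norm v)\<^sup>2)"
    by (simp add: norm_vec_def L2_set_def sum_nonneg)
  finally show ?thesis .
qed

text \<open>The eigenvalues of the transpose are Rayleigh quotients against the standard Hermitian
  form, hence positive reals. The determinant is their product, read off at \<open>x = 0\<close> up
  to the sign (-1)^3.\<close>

lemma det_positive_definite_3:
  fixes G :: "complex^3^3"
  assumes "\<And>v. v \<noteq> 0 \<Longrightarrow> hform G v \<in> \<real> \<and> Re (hform G v) > 0"
  shows "det G \<in> \<real>" "Re (det G) > 0"
proof -
  obtain a b c where e: "\<And>x. det (mat x - transpose G) = (x - a) * (x - b) * (x - c)"
    by (rule eigenvalues_3[of "transpose G"]) blast
  have pos: "x \<in> \<real> \<and> Re x > 0" if r: "det (mat x - transpose G) = 0" for x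
  proof -
    obtain v where v: "v \<noteq> 0" "transpose G *v v = x *s v" by (rule eigenvalue_eigenvector[OF r])
    have "hform G v = x * hform (mat 1) v"
      unfolding hform_transpose v(2) by (simp add: transpose_mat sum_distrib_left mult_ac)
    then have h: "hform G v = x * complex_of_real ((norm v)\<^sup>2)" by (simp only: hform_mat_1)
    then have "x = hform G v / complex_of_real ((norm v)\<^sup>2)" using v(1) by simp
    moreover have "hform G v \<in> \<real>" using assms v(1) by blast
    ultimately have "x \<in> \<real>" by simp
    moreover have "Re x * (norm v)\<^sup>2 > 0" using assms[OF v(1)] h by simp
    ultimately show ?thesis by (simp add: zero_less_mult_iff)
  qed
  have "a \<in> \<real> \<and> Re a > 0" "b \<in> \<real> \<and> Re b > 0" "c \<in> \<real> \<and> Re c > 0"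
    by (rule pos; simp add: e)+
  then obtain a' b' c' where abc: "a = complex_of_real a'" "b = complex_of_real b'" "c = complex_of_real c'"
      "a' > 0" "b' > 0" "c' > 0"
    by (auto elim!: Reals_cases)
  have "det (mat 0 - transpose G) = - det G"
    by (simp add: det_3 mat_def transpose_def algebra_simps)
  then have "det G = complex_of_real (a' * b' * c')" using e[of 0] by (simp add: abc)
  then show "det G \<in> \<real>" "Re (det G) > 0" using abc(4-6) by auto
qed

subsection \<open>Top degree wedge products in dimension three\<close>

lemma alternating_2_swap: "alternating 2 f \<Longrightarrow> f [w, v] = - f [v, w]"
  using alternating_swap[of 2 f "[v, w]" 0 1]
  by (simp add: permute_list_def Transposition.transpose_def numeral_2_eq_2)

text \<open>The twelve ordered pairs of \<open>cwedge_2_expand\<close> match up in twos by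
  antisymmetry of \<open>f\<close>, which cancels the factor 1/2 and leaves the six shuffles. In
  \<open>cwedge_2_4\<close> thirty pairs reduce to fifteen in the same way.\<close>

lemma cwedge_2_2:
  assumes f: "alternating 2 f" and g: "alternating 2 g"
  shows "cwedge 2 2 f g [a, b, c, d] = f [a, b] * g [c, d] - f [a, c] * g [b, d] + f [a, d] * g [b, c]
    + f [b, c] * g [a, d] - f [b, d] * g [a, c] + f [c, d] * g [a, b]"
  using cwedge_2_expand[OF g, of "[a, b, c, d]" f]
    alternating_2_swap[OF f, of b a] alternating_2_swap[OF f, of c a] alternating_2_swap[OF f, of d a]
    alternating_2_swap[OF f, of c b] alternating_2_swap[OF f, of d b] alternating_2_swap[OF f, of d c]
  by (simp add: numeral_2_eq_2 remove_at_def)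

lemma cwedge_2_4:
  assumes f: "alternating 2 f" and g: "alternating 4 g"
  shows "cwedge 2 4 f g [a, b, c, d, e, h] =
    f [a, b] * g [c, d, e, h] - f [a, c] * g [b, d, e, h] + f [a, d] * g [b, c, e, h] - f [a, e] * g [b, c, d, h]
    + f [a, h] * g [b, c, d, e] + f [b, c] * g [a, d, e, h] - f [b, d] * g [a, c, e, h] + f [b, e] * g [a, c, d, h]
    - f [b, h] * g [a, c, d, e] + f [c, d] * g [a, b, e, h] - f [c, e] * g [a, b, d, h] + f [c, h] * g [a, b, d, e]
    + f [d, e] * g [a, b, c, h] - f [d, h] * g [a, b, c, e] + f [e, h] * g [a, b, c, d]"
  using cwedge_2_expand[OF g, of "[a, b, c, d, e, h]" f]
    alternating_2_swap[OF f, of b a] alternating_2_swap[OF f, of c a] alternating_2_swap[OF f, of d a]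
    alternating_2_swap[OF f, of e a] alternating_2_swap[OF f, of h a]
    alternating_2_swap[OF f, of c b] alternating_2_swap[OF f, of d b] alternating_2_swap[OF f, of e b]
    alternating_2_swap[OF f, of h b] alternating_2_swap[OF f, of d c] alternating_2_swap[OF f, of e c]
    alternating_2_swap[OF f, of h c] alternating_2_swap[OF f, of e d] alternating_2_swap[OF f, of h d]
    alternating_2_swap[OF f, of h e]
  by (simp add: eval_nat_numeral remove_at_def)

definition std_basis :: "(complex^3) list" where
  "std_basis = [axis 1 1, axis 1 \<i>, axis 2 1, axis 2 \<i>, axis 3 1, axis 3 \<i>]"

text \<open>\<open>oriented_basis\<close> relies on an unspecified enumeration of the index type.
  Exchanging two blocks consisting of e_j and \<i> e_j costs two transpositions, so all six orders
  of the three blocks give the same value.\<close>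

lemma alternating_6_oriented_basis:
  fixes f :: "3 covec"
  assumes f: "alternating 6 f"
  shows "f oriented_basis = f std_basis"
proof -
  have s12: "f [c, d, a, b, e, h] = f [a, b, c, d, e, h]" for a b c d e h
    using alternating_swap[OF f, of "[a, b, c, d, e, h]" 0 2] alternating_swap[OF f, of "[c, b, a, d, e, h]" 1 3]
    by (simp add: permute_list_def Transposition.transpose_def eval_nat_numeral)
  have s23: "f [a, b, e, h, c, d] = f [a, b, c, d, e, h]" for a b c d e h
    using alternating_swap[OF f, of "[a, b, c, d, e, h]" 2 4] alternating_swap[OF f, of "[a, b, e, d, c, h]" 3 5]
    by (simp add: permute_list_def Transposition.transpose_def eval_nat_numeral)
  define js where "js = (SOME js. distinct js \<and> set js = (UNIV :: 3 set))"
  have "\<exists>js. distinct js \<and> set js = (UNIV :: 3 set)" using finite_distinct_list[of "UNIV :: 3 set"] by auto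
  from someI_ex[OF this] have js: "distinct js" "set js = UNIV" by (auto simp: js_def)
  then have "length js = 3" using distinct_card[of js] by simp
  then obtain i j k where ijk: "js = [i, j, k]" by (auto simp: numeral_3_eq_3 length_Suc_conv)
  have ob: "oriented_basis = [axis i 1, axis i \<i>, axis j 1, axis j \<i>, axis k 1, axis k \<i>]"
    by (simp add: oriented_basis_def js_def[symmetric] ijk)
  have "i \<noteq> j" "i \<noteq> k" "j \<noteq> k" using js(1) by (auto simp: ijk)
  moreover have "i = 1 \<or> i = 2 \<or> i = 3" "j = 1 \<or> j = 2 \<or> j = 3" "k = 1 \<or> k = 2 \<or> k = 3"
    using exhaust_3 by auto
  ultimately have "(i, j, k) \<in> {(1,2,3), (1,3,2), (2,1,3), (2,3,1), (3,1,2), (3,2,1)}" by auto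
  then show ?thesis
    unfolding ob std_basis_def
    by (elim insertE emptyE; simp only: prod.inject; elim conjE; hypsubst) (metis s12 s23)+
qed

text \<open>The coefficient of \<open>s\<close> in \<open>det (G + s F)\<close>.\<close>

definition det_deriv :: "complex^3^3 \<Rightarrow> complex^3^3 \<Rightarrow> complex" where
  "det_deriv F G = det (\<chi> i. if i = 1 then F $ i else G $ i) + det (\<chi> i. if i = 2 then F $ i else G $ i)
    + det (\<chi> i. if i = 3 then F $ i else G $ i)"

lemma det_pencil:
  "det (\<chi> i j. x * G $ i $ j - A $ i $ j) = x ^ 3 * det G - x ^ 2 * det_deriv A G + x * det_deriv G A - det A"
  for A G :: "complex^3^3"
  unfolding det_deriv_def det_3 by (simp add: power2_eq_square power3_eq_cube algebra_simps)

lemma det_deriv_self: "det_deriv G G = 3 * det G"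
  by (simp add: det_deriv_def det_3 algebra_simps)

text \<open>The cube of a (1,1)-covector is 6 times the determinant of its coefficients, since
  \<omega>^3 is 3! times the volume form. Polarization explains the 2: the derivative of (g + s f)^3
  at s = 0 is three times the mixed product and equals \<open>6 * det_deriv F G\<close>. The proof
  compares the two expansions directly.\<close>

lemma cwedge_top_det_deriv:
  assumes f: "alternating 2 f" "has_coeffs f F" and g: "alternating 2 g" "has_coeffs g G"
  shows "complex_of_real (cwedge 2 4 f (cwedge 2 2 g g) std_basis) = 2 * det_deriv F G"
proof -
  note fs = has_coeffs_basis[OF f(2)] and gs = has_coeffs_basis[OF g(2)]
  have fn: "complex_of_real (f [axis j \<i>, axis k 1]) = - ((F $ k $ j + F $ j $ k) / 2)" for j k
    using fs(2)[of k j] alternating_2_swap[OF f(1), of "axis j \<i>" "axis k 1"] by simp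
  have gn: "complex_of_real (g [axis j \<i>, axis k 1]) = - ((G $ k $ j + G $ j $ k) / 2)" for j k
    using gs(2)[of k j] alternating_2_swap[OF g(1), of "axis j \<i>" "axis k 1"] by simp
  have g4: "alternating 4 (cwedge 2 2 g g)" using alternating_cwedge[OF g(1) g(1)] by simp
  show ?thesis
    unfolding std_basis_def cwedge_2_4[OF f(1) g4] cwedge_2_2[OF g(1) g(1)]
      of_real_add of_real_diff of_real_mult fs fn gs gn det_deriv_def det_3
    by (simp add: field_simps)
qed


text \<open>With d the determinant of the matrix of \<omega>, the four densities are 6d,
  \<open>2 * d * \<sigma>\<^sub>1\<close>, \<open>2 * d * \<sigma>\<^sub>2\<close> and
  \<open>6 * d * \<sigma>\<^sub>3\<close>. The conclusions are therefore those of
  \<open>arctan_sum_facts\<close> multiplied by 6d; the mixed densities account for the factors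
  3.\<close>

lemma dHYM_pointwise:
  fixes \<omega> \<alpha> :: "3 covec"
  assumes w: "alternating 2 \<omega>" "has_coeffs \<omega> G" and a: "alternating 2 \<alpha>" "has_coeffs \<alpha> A"
    and pos: "\<And>v. v \<noteq> 0 \<Longrightarrow> \<omega> [v, \<i> *s v] > 0"
    and th: "Theta \<omega> \<alpha> = \<theta>" "pi / 2 < \<theta>" "\<theta> < 3 * pi / 2"
  defines "w0 \<equiv> cwedge 2 4 \<omega> (cwedge 2 2 \<omega> \<omega>) oriented_basis"
    and "w1 \<equiv> cwedge 2 4 \<alpha> (cwedge 2 2 \<omega> \<omega>) oriented_basis"
    and "w2 \<equiv> cwedge 2 4 \<omega> (cwedge 2 2 \<alpha> \<alpha>) oriented_basis"
    and "w3 \<equiv> cwedge 2 4 \<alpha> (cwedge 2 2 \<alpha> \<alpha>) oriented_basis"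
  shows "w0 > 0" "w0 < 3 * w2" "3 * w1 * cos \<theta> < w0 * sin \<theta>"
    "(3 * w1 - w3) * cos \<theta> = (w0 - 3 * w2) * sin \<theta>"
proof -
  have hG: "hform G v = complex_of_real (\<omega> [v, \<i> *s v])" and hA: "hform A v = complex_of_real (\<alpha> [v, \<i> *s v])" for v
    using has_coeffs_hermitian_form[OF w(2)] has_coeffs_hermitian_form[OF a(2)] by (simp_all add: hform_def)
  have G: "det G \<in> \<real>" "Re (det G) > 0"
    using det_positive_definite_3[of G] pos by (auto simp: hG)
  then obtain d where d: "det G = complex_of_real d" "d > 0" by (auto elim!: Reals_cases)
  define E where "E = relative_endo \<omega> \<alpha>"
  have "invertible (transpose G)" using d by (simp add: invertible_det_nz det_transpose)
  then have "transpose G ** matrix_inv (transpose G) = mat 1"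
    unfolding invertible_def matrix_inv_def by (metis (mono_tags, lifting) someI_ex)
  then have GE: "transpose G ** E = transpose A"
    unfolding E_def relative_endo_def coeffs_eq[OF w(2)] coeffs_eq[OF a(2)] by (simp add: matrix_mul_assoc)
  obtain l1 l2 l3 where e: "eigenvalues E = {#l1, l2, l3#}" "\<And>x. det (mat x - E) = (x - l1) * (x - l2) * (x - l3)"
    by (rule eigenvalues_3[of E]) (rule that)
  have real: "x \<in> \<real>" if r: "det (mat x - E) = 0" for x
  proof -
    obtain v where v: "v \<noteq> 0" "E *v v = x *s v" by (rule eigenvalue_eigenvector[OF r])
    have "transpose A *v v = x *s (transpose G *v v)"
      unfolding GE[symmetric] matrix_vector_mul_assoc[symmetric] v(2) by (simp add: vector_scalar_commute)
    then show ?thesis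
      by (rule relative_eigenvalue_real) (use pos[OF v(1)] in \<open>simp_all add: hG hA\<close>)
  qed
  have "l1 \<in> \<real>" "l2 \<in> \<real>" "l3 \<in> \<real>" by (rule real; simp add: e)+
  then obtain x y z where l: "l1 = complex_of_real x" "l2 = complex_of_real y" "l3 = complex_of_real z"
    by (auto elim!: Reals_cases)
  have "arctan x + arctan y + arctan z = \<theta>"
    using th(1) by (simp add: Theta_def E_def[symmetric] e(1) l)
  note facts = arctan_sum_facts[OF this th(2,3)]
  \<comment> \<open>The characteristic polynomial of \<open>E\<close> times \<open>det G\<close> is
    the determinant of tG - A. Its coefficients are the mixed determinants on one side and the
    symmetric functions of the eigenvalues on the other.\<close>
  have pencil: "det G * ((t - l1) * (t - l2) * (t - l3)) =
      t ^ 3 * det G - t ^ 2 * det_deriv A G + t * det_deriv G A - det A" for t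
  proof -
    have "transpose G ** (mat t - E) = transpose (\<chi> i j. t * G $ i $ j - A $ i $ j)"
    proof -
      have "transpose G ** mat t = transpose (\<chi> i j. t * G $ i $ j)"
        by (simp add: vec_eq_iff matrix_matrix_mult_def mat_def transpose_def if_distrib mult.commute cong: if_cong)
      then have "transpose G ** (mat t - E) = transpose (\<chi> i j. t * G $ i $ j) - transpose A"
        unfolding GE[symmetric]
        by (simp add: vec_eq_iff matrix_matrix_mult_def right_diff_distrib sum_subtractf)
      then show ?thesis by (simp add: vec_eq_iff transpose_def)
    qed
    from arg_cong[OF this, of det]
    have "det G * det (mat t - E) = det (\<chi> i j. t * G $ i $ j - A $ i $ j)"
      by (simp only: det_mul det_transpose)
    then show ?thesis by (simp only: e(2) det_pencil)
  qed
  have s3: "det A = complex_of_real (d * (x * y * z))"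
    using pencil[of 0] by (simp add: l d)
  \<comment> \<open>The two middle coefficients of the cubic in \<open>t\<close> are isolated by
    adding and subtracting its values at 1 and -1; the value at 0 has given the last one.\<close>
  have p1: "complex_of_real d * ((1 - l1) * (1 - l2) * (1 - l3)) = complex_of_real d - det_deriv A G + det_deriv G A - det A"
    and p2: "complex_of_real d * ((- 1 - l1) * (- 1 - l2) * (- 1 - l3)) = - complex_of_real d - det_deriv A G - det_deriv G A - det A"
    using pencil[of 1] pencil[of "- 1"] by (simp_all add: d)
  have "2 * det_deriv A G = complex_of_real (2 * d * (x + y + z))"
    using arg_cong2[OF p1 p2, of "(+)"] unfolding s3 l by (simp add: algebra_simps)
  then have s1: "det_deriv A G = complex_of_real (d * (x + y + z))" by simp
  have "2 * det_deriv G A = complex_of_real (2 * d * (x * y + x * z + y * z))"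
    using arg_cong2[OF p1 p2, of "(-)"] unfolding s3 l by (simp add: algebra_simps)
  then have s2: "det_deriv G A = complex_of_real (d * (x * y + x * z + y * z))" by simp
  have ob: "cwedge 2 4 f (cwedge 2 2 g g) oriented_basis = cwedge 2 4 f (cwedge 2 2 g g) std_basis"
    if "alternating 2 f" "alternating 2 g" for f g :: "3 covec"
    using alternating_cwedge[OF that(1) alternating_cwedge[OF that(2) that(2)]]
    by (intro alternating_6_oriented_basis) simp
  have "complex_of_real w0 = complex_of_real (6 * d)"
    unfolding w0_def ob[OF w(1) w(1)] cwedge_top_det_deriv[OF w w] det_deriv_self d by simp
  then have w0: "w0 = 6 * d" by (simp only: of_real_eq_iff)
  have "complex_of_real w1 = complex_of_real (2 * (d * (x + y + z)))"
    unfolding w1_def ob[OF a(1) w(1)] cwedge_top_det_deriv[OF a w] s1 by simp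
  then have w1: "w1 = 2 * (d * (x + y + z))" by (simp only: of_real_eq_iff)
  have "complex_of_real w2 = complex_of_real (2 * (d * (x * y + x * z + y * z)))"
    unfolding w2_def ob[OF w(1) a(1)] cwedge_top_det_deriv[OF w a] s2 by simp
  then have w2: "w2 = 2 * (d * (x * y + x * z + y * z))" by (simp only: of_real_eq_iff)
  have "complex_of_real w3 = complex_of_real (6 * (d * (x * y * z)))"
    unfolding w3_def ob[OF a(1) a(1)] cwedge_top_det_deriv[OF a a] det_deriv_self s3 by simp
  then have w3: "w3 = 6 * (d * (x * y * z))" by (simp only: of_real_eq_iff)
  show "w0 > 0" using d(2) by (simp add: w0)
  show "w0 < 3 * w2" using mult_strict_left_mono[OF facts(1) d(2)] by (simp add: w0 w2)
  show "3 * w1 * cos \<theta> < w0 * sin \<theta>"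
    using mult_strict_left_mono[OF facts(2) d(2)] by (simp add: w0 w1 algebra_simps)
  show "(3 * w1 - w3) * cos \<theta> = (w0 - 3 * w2) * sin \<theta>"
    using arg_cong[OF facts(3), of "\<lambda>u. 6 * (d * u)"] by (simp add: w0 w1 w2 w3 algebra_simps)
qed

section \<open>Chern forms of different metrics are cohomologous\<close>

definition D2 :: "('v::real_normed_vector \<Rightarrow> real) \<Rightarrow> 'v \<Rightarrow> 'v \<Rightarrow> 'v \<Rightarrow> real" where
  "D2 u x v w = frechet_derivative (\<lambda>y. frechet_derivative u (at y) w) (at x) v"

context
  fixes S :: "'v::real_normed_vector set" and x :: 'v
  assumes S: "open S" and x: "x \<in> S"
begin

lemma D2_linear_left:
  assumes "smooth_on S u"
  shows "linear (\<lambda>v. D2 u x v w)"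
  unfolding D2_def using has_derivative_linear[OF smooth_on_has_derivative[OF smooth_on_frechet[OF assms] x]] .

lemma D2_linear_right:
  assumes "smooth_on S u"
  shows "linear (\<lambda>w. D2 u x v w)"
proof (rule linearI)
  have lin: "linear (frechet_derivative u (at y))" if "y \<in> S" for y
    using has_derivative_linear[OF smooth_on_has_derivative[OF assms that]] .
  note d = smooth_on_has_derivative[OF smooth_on_frechet[OF assms] x]
  show "D2 u x v (w + w') = D2 u x v w + D2 u x v w'" for w w'
  proof -
    have "((\<lambda>y. frechet_derivative u (at y) (w + w')) has_derivative (\<lambda>v. D2 u x v w + D2 u x v w')) (at x)"
      by (rule has_derivative_transform_within_open[OF _ S x, of "\<lambda>y. frechet_derivative u (at y) w + frechet_derivative u (at y) w'"])
        (auto simp: D2_def linear_add[OF lin] intro!: has_derivative_add d)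
    from frechet_derivative_at[OF this, symmetric] show ?thesis unfolding D2_def[of u x v "w + w'"] by simp
  qed
  show "D2 u x v (r *\<^sub>R w) = r *\<^sub>R D2 u x v w" for r w
  proof -
    have "((\<lambda>y. frechet_derivative u (at y) (r *\<^sub>R w)) has_derivative (\<lambda>v. r * D2 u x v w)) (at x)"
      by (rule has_derivative_transform_within_open[OF _ S x, of "\<lambda>y. r * frechet_derivative u (at y) w"])
        (auto simp: D2_def linear_cmul[OF lin] intro!: has_derivative_mult_right d)
    from frechet_derivative_at[OF this, symmetric] show ?thesis unfolding D2_def[of u x v "r *\<^sub>R w"] by simp
  qed
qed

lemma D2_sym: "smooth_on S u \<Longrightarrow> D2 u x v w = D2 u x w v"
  unfolding D2_def using second_derivative_symmetric[OF S _ x] by (auto simp: smooth_on_def)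

lemma D2_diff:
  assumes "smooth_on S u" "smooth_on S u'" "\<And>y. y \<in> S \<Longrightarrow> f y = u y - u' y"
  shows "D2 f x v w = D2 u x v w - D2 u' x v w"
proof -
  have f: "smooth_on S f"
    by (rule smooth_on_cong[OF S _ smooth_on_diff[OF S assms(1,2)]]) (simp add: assms(3))
  have "frechet_derivative f (at y) w = frechet_derivative u (at y) w - frechet_derivative u' (at y) w" if "y \<in> S" for y
  proof -
    have "(f has_derivative (\<lambda>w. frechet_derivative u (at y) w - frechet_derivative u' (at y) w)) (at y)"
      by (rule has_derivative_transform_within_open[OF has_derivative_diff[OF smooth_on_has_derivative[OF assms(1) that]
              smooth_on_has_derivative[OF assms(2) that]] S that]) (simp add: assms(3))
    from frechet_derivative_at[OF this, symmetric] show ?thesis by simp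
  qed
  then have "((\<lambda>y. frechet_derivative f (at y) w) has_derivative (\<lambda>v. D2 u x v w - D2 u' x v w)) (at x)"
    unfolding D2_def
    by (intro has_derivative_transform_within_open[OF has_derivative_diff[OF smooth_on_has_derivative[OF smooth_on_frechet[OF assms(1)] x]
          smooth_on_has_derivative[OF smooth_on_frechet[OF assms(2)] x]] S x]) simp
  from frechet_derivative_at[OF this, symmetric] show ?thesis unfolding D2_def[of f] by simp
qed

end

text \<open>The component of the real bilinear form \<open>H\<close> that is complex linear in
  \<open>v\<close> and conjugate linear in \<open>w\<close>. For \<open>H\<close> the second
  derivative of a function, its value on \<open>axis j 1\<close> and \<open>axis k 1\<close> is the
  mixed derivative in \<open>z\<^sub>j\<close> and the conjugate of
  \<open>z\<^sub>k\<close>.\<close>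

definition sesqui :: "(complex^'n \<Rightarrow> complex^'n \<Rightarrow> real) \<Rightarrow> complex^'n \<Rightarrow> complex^'n \<Rightarrow> complex" where
  "sesqui H v w = (complex_of_real (H v w) + complex_of_real (H (\<i> *s v) (\<i> *s w))
    + \<i> * (complex_of_real (H v (\<i> *s w)) - complex_of_real (H (\<i> *s v) w))) / 4"

context
  fixes H :: "complex^'n \<Rightarrow> complex^'n \<Rightarrow> real"
  assumes lin: "\<And>w. linear (\<lambda>v. H v w)" "\<And>v. linear (\<lambda>w. H v w)"
begin

lemma complex_smult_eq: "a *s v = Re a *\<^sub>R v + Im a *\<^sub>R (\<i> *s v)" for v :: "complex^'n"
  by (simp add: vec_eq_iff complex_eq_iff)

lemma i_smult: "\<i> *s (v + w) = \<i> *s v + \<i> *s w" "\<i> *s (r *\<^sub>R v) = r *\<^sub>R (\<i> *s v)" "\<i> *s (\<i> *s v) = - v"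
  for v w :: "complex^'n"
  by (simp_all add: vec_eq_iff algebra_simps)

lemmas H_simps = linear_add[OF lin(1)] linear_add[OF lin(2)] linear_cmul[OF lin(1)] linear_cmul[OF lin(2)]
  linear_neg[OF lin(1)] linear_neg[OF lin(2)]

lemma sesqui_add: "sesqui H (v + v') w = sesqui H v w + sesqui H v' w" "sesqui H v (w + w') = sesqui H v w + sesqui H v w'"
  by (simp_all add: sesqui_def i_smult H_simps field_simps)

lemma sesqui_smult: "sesqui H (a *s v) w = a * sesqui H v w" "sesqui H v (a *s w) = cnj a * sesqui H v w"
proof -
  have i: "sesqui H (\<i> *s v) w = \<i> * sesqui H v w" "sesqui H v (\<i> *s w) = - \<i> * sesqui H v w" for v w
    by (simp_all add: sesqui_def i_smult H_simps field_simps)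
  have r: "sesqui H (r *\<^sub>R v) w = complex_of_real r * sesqui H v w" "sesqui H v (r *\<^sub>R w) = complex_of_real r * sesqui H v w" for r v w
    by (simp_all add: sesqui_def i_smult H_simps field_simps)
  show "sesqui H (a *s v) w = a * sesqui H v w"
    unfolding complex_smult_eq[of a v] sesqui_add r i by (subst (3) complex_eq) (simp add: algebra_simps)
  show "sesqui H v (a *s w) = cnj a * sesqui H v w"
    unfolding complex_smult_eq[of a w] sesqui_add r i by (simp add: complex_eq_iff)
qed

lemma sesqui_sum: "finite I \<Longrightarrow> sesqui H (\<Sum>i\<in>I. f i) w = (\<Sum>i\<in>I. sesqui H (f i) w)"
  "finite I \<Longrightarrow> sesqui H v (\<Sum>i\<in>I. f i) = (\<Sum>i\<in>I. sesqui H v (f i))"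
proof -
  have z: "sesqui H 0 w = 0" "sesqui H v 0 = 0" for v w
    using sesqui_smult(1)[of 0 0 w] sesqui_smult(2)[of v 0 0] by simp_all
  show "finite I \<Longrightarrow> sesqui H (\<Sum>i\<in>I. f i) w = (\<Sum>i\<in>I. sesqui H (f i) w)"
    "finite I \<Longrightarrow> sesqui H v (\<Sum>i\<in>I. f i) = (\<Sum>i\<in>I. sesqui H v (f i))"
    by (induction I rule: finite_induct) (simp_all add: sesqui_add z)
qed

lemma sesqui_expand:
  "(\<Sum>j\<in>UNIV. \<Sum>k\<in>UNIV. sesqui H (axis j 1) (axis k 1) * (v $ j * cnj (w $ k))) = sesqui H v w"
proof -
  have "sesqui H v w = sesqui H (\<Sum>j\<in>UNIV. v $ j *s axis j 1) (\<Sum>k\<in>UNIV. w $ k *s axis k 1)"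
    by (simp only: basis_expansion)
  also have "\<dots> = (\<Sum>j\<in>UNIV. sesqui H (v $ j *s axis j 1) (\<Sum>k\<in>UNIV. w $ k *s axis k 1))"
    by (rule sesqui_sum) simp
  also have "\<dots> = (\<Sum>j\<in>UNIV. \<Sum>k\<in>UNIV. cnj (w $ k) * (v $ j * sesqui H (axis j 1) (axis k 1)))"
    by (simp only: sesqui_sum(2)[OF finite_class.finite_UNIV] sesqui_smult sum_distrib_left)
  finally show ?thesis by (simp add: mult_ac)
qed

end

text \<open>For symmetric \<open>H\<close>, exchanging the arguments conjugates
  \<open>sesqui H\<close>, so the difference is 2\<i> times the imaginary part.\<close>

lemma sesqui_antisym:
  assumes "\<And>v w. H v w = H w v"
  shows "sesqui H v w - sesqui H w v = \<i> / 2 * complex_of_real (H v (\<i> *s w) - H w (\<i> *s v))"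
  using assms[of "\<i> *s w" v] assms[of "\<i> *s v" w] assms[of w v] assms[of "\<i> *s w" "\<i> *s v"]
  by (simp add: sesqui_def field_simps)

lemma i_axis: "\<i> *s axis j 1 = (axis j \<i> :: complex^'n)"
  by (simp add: vec_eq_iff axis_def)

lemma ddbar_eq_sesqui:
  fixes u :: "complex^'n \<Rightarrow> real"
  assumes S: "open S" "x \<in> S" and u: "smooth_on S u"
  shows "d_dz j (d_dzbar k (\<lambda>y. complex_of_real (u y))) x = sesqui (D2 u x) (axis j 1) (axis k 1)"
proof -
  let ?q = "\<lambda>y. (complex_of_real (frechet_derivative u (at y) (axis k 1)) +
      \<i> * complex_of_real (frechet_derivative u (at y) (axis k \<i>))) / 2"
  have first: "frechet_derivative (\<lambda>y. complex_of_real (u y)) (at y) = (\<lambda>v. complex_of_real (frechet_derivative u (at y) v))"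
    if "y \<in> S" for y
    using frechet_derivative_at[OF has_derivative_of_real[OF smooth_on_has_derivative[OF u that]], symmetric] .
  have q: "(?q has_derivative (\<lambda>v. (complex_of_real (D2 u x v (axis k 1)) + \<i> * complex_of_real (D2 u x v (axis k \<i>))) / 2)) (at x)"
    unfolding D2_def
    by (intro bounded_linear.has_derivative[OF bounded_linear_divide] has_derivative_add has_derivative_mult_right has_derivative_of_real
        smooth_on_has_derivative[OF smooth_on_frechet[OF u] S(2)])
  have "(d_dzbar k (\<lambda>y. complex_of_real (u y)) has_derivative
      (\<lambda>v. (complex_of_real (D2 u x v (axis k 1)) + \<i> * complex_of_real (D2 u x v (axis k \<i>))) / 2)) (at x)"
    by (rule has_derivative_transform_within_open[OF q S]) (simp add: d_dzbar_def first)
  from frechet_derivative_at[OF this, symmetric] show ?thesis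
    by (simp add: d_dz_def sesqui_def i_axis field_simps)
qed

text \<open>In real terms the local Chern form is d(du \<circ> J) / (4 pi), as comparison with
  \<open>ext_d_dc_form\<close> shows, where the constant is the product of -\<i> / (2 pi) and \<i> /
  2. A globally defined \<open>u\<close> thus contributes an exact form.\<close>

lemma chern_form_local:
  fixes u :: "complex^'n \<Rightarrow> real"
  assumes S: "open S" "x \<in> S" and u: "smooth_on S u"
    and F: "complex_of_real r = - (\<i> / (2 * of_real pi)) * (\<Sum>j\<in>UNIV. \<Sum>k\<in>UNIV.
      d_dz j (d_dzbar k (\<lambda>y. complex_of_real (u y))) x * dz_dzbar j k v w)"
  shows "r = (D2 u x v (\<i> *s w) - D2 u x w (\<i> *s v)) / (4 * pi)"
proof -
  let ?H = "D2 u x"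
  have lin: "linear (\<lambda>v. ?H v w)" "linear (\<lambda>w. ?H v w)" for v w
    using D2_linear_left[OF S u] D2_linear_right[OF S u] by auto
  have "(\<Sum>j\<in>UNIV. \<Sum>k\<in>UNIV. d_dz j (d_dzbar k (\<lambda>y. complex_of_real (u y))) x * dz_dzbar j k v w) =
      sesqui ?H v w - sesqui ?H w v"
    unfolding ddbar_eq_sesqui[OF S u] dz_dzbar_def sesqui_expand[OF lin, symmetric, of v w] sesqui_expand[OF lin, symmetric, of w v]
    by (simp add: right_diff_distrib sum_subtractf)
  also have "\<dots> = \<i> / 2 * complex_of_real (?H v (\<i> *s w) - ?H w (\<i> *s v))"
    by (rule sesqui_antisym) (rule D2_sym[OF S u])
  finally have S: "(\<Sum>j\<in>UNIV. \<Sum>k\<in>UNIV. d_dz j (d_dzbar k (\<lambda>y. complex_of_real (u y))) x * dz_dzbar j k v w) =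
      \<i> / 2 * complex_of_real (?H v (\<i> *s w) - ?H w (\<i> *s v))" .
  have "complex_of_real r = complex_of_real ((?H v (\<i> *s w) - ?H w (\<i> *s v)) / (4 * pi))"
    unfolding F S by (simp add: field_simps)
  then show ?thesis by (simp only: of_real_eq_iff)
qed

context compact_complex_manifold
begin

text \<open>Holomorphy of the atlas enters here: differentials of transition maps commute with J,
  which makes df \<circ> J compatible between charts.\<close>

lemma transition_complex_linear:
  assumes c: "c \<in> M" "c' \<in> M" and x: "x \<in> cmap c ` (cdom c \<inter> cdom c')"
  shows "frechet_derivative (\<lambda>x. cmap c' (cinv c x)) (at x) (\<i> *s v) =
    \<i> *s frechet_derivative (\<lambda>x. cmap c' (cinv c x)) (at x) v"
proof -
  let ?T = "\<lambda>x. cmap c' (cinv c x)"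
  have T: "(?T has_derivative frechet_derivative ?T (at x)) (at x)"
    by (rule smooth_on_has_derivative[OF smooth_on_transition[OF c] x])
  have comp: "frechet_derivative (\<lambda>x. ?T x $ j) (at x) = (\<lambda>v. frechet_derivative ?T (at x) v $ j)" for j
    using frechet_derivative_at[OF bounded_linear.has_derivative[OF bounded_linear_vec_nth T]] by simp
  have "frechet_derivative (\<lambda>x. ?T x $ j) (at x) (\<i> *s v) = \<i> * frechet_derivative (\<lambda>x. ?T x $ j) (at x) v" for j
    using atlas c x unfolding complex_atlas_def holo_on_def by blast
  then show ?thesis unfolding comp by (simp add: vec_eq_iff)
qed

text \<open>\<open>dc_form f\<close> is $df \circ J$, where $J$ is the complex structure.\<close>

definition dc_form :: "('a \<Rightarrow> real) \<Rightarrow> ('a, 'n) form" where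
  "dc_form f = (\<lambda>c x vs. frechet_derivative (\<lambda>y. f (cinv c y)) (at x) (\<i> *s (vs ! 0)))"

lemma linear_i_smult: "linear (\<lambda>v :: complex^'n. \<i> *s v)"
  by (rule linearI) (simp_all add: vec_eq_iff algebra_simps scaleR_conv_of_real)

lemma smooth_form_dc:
  assumes f: "smooth_fun_on M UNIV f"
  shows "smooth_form M 1 (dc_form f)"
proof (rule smooth_formI)
  fix c assume c: "c \<in> M"
  have f': "smooth_on (cran c) (\<lambda>y. f (cinv c y))" using f c by (simp add: smooth_fun_on_UNIV_iff)
  show "smooth_on (cran c) (\<lambda>x. dc_form f c x vs)" for vs
    unfolding dc_form_def by (rule smooth_on_frechet[OF f'])
  show "alternating 1 (dc_form f c x)" if x: "x \<in> cran c" for x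
  proof -
    have "linear (frechet_derivative (\<lambda>y. f (cinv c y)) (at x))"
      using has_derivative_linear[OF smooth_on_has_derivative[OF f' x]] .
    from linear_compose[OF linear_i_smult this] show ?thesis
      unfolding alternating_def dc_form_def by (auto simp: o_def)
  qed
  show "dc_form f c (cmap c p) vs = dc_form f c' (cmap c' p)
      (map (frechet_derivative (\<lambda>x. cmap c' (cinv c x)) (at (cmap c p))) vs)"
    if "c' \<in> M" "p \<in> cdom c" "p \<in> cdom c'" "length vs = 1" for c' p vs
    using that transition_complex_linear[OF c that(1), of "cmap c p"]
    by (simp add: dc_form_def chain_rule_transition[OF f c that(1-3)])
qed

lemma ext_d_dc_form:
  "ext_d (dc_form f) c x [v, w] = D2 (\<lambda>y. f (cinv c y)) x v (\<i> *s w) - D2 (\<lambda>y. f (cinv c y)) x w (\<i> *s v)"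
  by (simp add: ext_d_def dc_form_def D2_def numeral_2_eq_2)

section \<open>Comparison of Hermitian metrics on the line bundle\<close>

lemma unit_section:
  assumes "holo_line_bundle M pr L" "(U, \<tau>) \<in> L" "p \<in> U"
  shows "pr (unit_section pr (U, \<tau>) p) = p"
proof -
  have "bij_betw (\<lambda>e. (pr e, \<tau> e)) (pr -` U) (U \<times> UNIV)"
    using assms(1,2) unfolding holo_line_bundle_def by blast
  then have "(p, 1) \<in> (\<lambda>e. (pr e, \<tau> e)) ` (pr -` U)" using assms(3) by (auto simp: bij_betw_def)
  from f_inv_into_f[OF this] show ?thesis by (simp add: unit_section_def)
qed

lemma
  assumes "hermitian_metric M pr L h" "(U, \<tau>) \<in> L"
  shows metric_smooth: "smooth_fun_on M U (\<lambda>p. h (unit_section pr (U, \<tau>) p))"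
    and metric_pos: "p \<in> U \<Longrightarrow> h (unit_section pr (U, \<tau>) p) > 0"
    and metric_eq: "pr e \<in> U \<Longrightarrow> h e = h (unit_section pr (U, \<tau>) (pr e)) * (cmod (\<tau> e))\<^sup>2"
proof -
  note * = bspec[OF assms(1)[unfolded hermitian_metric_def] assms(2), unfolded prod.case]
  show "smooth_fun_on M U (\<lambda>p. h (unit_section pr (U, \<tau>) p))" by (rule *[THEN conjunct1])
  show "h (unit_section pr (U, \<tau>) p) > 0" if "p \<in> U"
    by (rule *[THEN conjunct2, THEN conjunct1, rule_format, OF that])
  show "h e = h (unit_section pr (U, \<tau>) (pr e)) * (cmod (\<tau> e))\<^sup>2" if "pr e \<in> U"
    by (rule *[THEN conjunct2, THEN conjunct2, rule_format]) (simp add: that)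
qed

text \<open>Passing between the two unit sections multiplies both squared norms by the same
  \<open>(cmod (\<tau> ?e))\<^sup>2\<close>, so the quotient of the metrics is independent of the
  trivialization.\<close>

lemma metric_ratio:
  assumes L: "holo_line_bundle M pr L" and h: "hermitian_metric M pr L h" and h': "hermitian_metric M pr L h'"
    and U: "(U, \<tau>) \<in> L" "p \<in> U" and V: "(V, \<sigma>) \<in> L" "p \<in> V"
  shows "ln (h (unit_section pr (V, \<sigma>) p)) - ln (h' (unit_section pr (V, \<sigma>) p)) =
    ln (h (unit_section pr (U, \<tau>) p)) - ln (h' (unit_section pr (U, \<tau>) p))"
proof -
  let ?e = "unit_section pr (V, \<sigma>) p"
  have e: "pr ?e = p" by (rule unit_section[OF L V])
  have pos: "g (unit_section pr (V, \<sigma>) p) > 0" "g (unit_section pr (U, \<tau>) p) > 0"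
    if "hermitian_metric M pr L g" for g
    by (rule metric_pos[OF that V]) (rule metric_pos[OF that U])
  have eq: "g ?e = g (unit_section pr (U, \<tau>) p) * (cmod (\<tau> ?e))\<^sup>2"
    if "hermitian_metric M pr L g" for g
    by (rule metric_eq[OF that U(1), of ?e, unfolded e, OF U(2)])
  have "\<tau> ?e \<noteq> 0" using pos(1)[OF h] eq[OF h] by auto
  then have "ln (g ?e) = ln (g (unit_section pr (U, \<tau>) p)) + ln ((cmod (\<tau> ?e))\<^sup>2)" if "hermitian_metric M pr L g" for g
    unfolding eq[OF that] using pos(2)[OF that] by (intro ln_mult_pos) auto
  from this[OF h] this[OF h'] show ?thesis by simp
qed

text \<open>The logarithm \<phi> of the quotient of the two metrics is a global smooth function,
  although defined through chosen trivializations. The Chern forms then differ by the derivative of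
  d\<phi> \<circ> J, divided by 4 pi.\<close>

lemma exact_chern_form_diff:
  assumes L: "holo_line_bundle M pr L" and h: "hermitian_metric M pr L h" "chern_form M pr L h F"
    and h': "hermitian_metric M pr L h'" "chern_form M pr L h' F'"
  shows "exact_form M 2 (form_diff F F')"
proof -
  define \<phi> where "\<phi> p = (let s = unit_section pr (SOME (U, \<tau>). (U, \<tau>) \<in> L \<and> p \<in> U) in ln (h (s p)) - ln (h' (s p)))" for p
  have cover: "\<exists>U \<tau>. (U, \<tau>) \<in> L \<and> p \<in> U" for p
  proof -
    have "p \<in> (\<Union>(U, \<tau>)\<in>L. U)" using L[unfolded holo_line_bundle_def, THEN conjunct1] by simp
    then show ?thesis by auto
  qed
  have phi: "\<phi> p = ln (h (unit_section pr (U, \<tau>) p)) - ln (h' (unit_section pr (U, \<tau>) p))" if "(U, \<tau>) \<in> L" "p \<in> U" for p U \<tau>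
  proof -
    have "\<exists>z. case z of (U, \<tau>) \<Rightarrow> (U, \<tau>) \<in> L \<and> p \<in> U" using cover[of p] by auto
    note some = someI_ex[OF this]
    obtain V \<sigma> where V1: "(SOME (U, \<tau>). (U, \<tau>) \<in> L \<and> p \<in> U) = (V, \<sigma>)"
      by (cases "SOME (U, \<tau>). (U, \<tau>) \<in> L \<and> p \<in> U")
    have V: "(SOME (U, \<tau>). (U, \<tau>) \<in> L \<and> p \<in> U) = (V, \<sigma>)" "(V, \<sigma>) \<in> L" "p \<in> V"
      using some unfolding V1 by simp_all
    show ?thesis unfolding \<phi>_def V(1) Let_def by (rule metric_ratio[OF L h(1) h'(1) that V(2,3)])
  qed
  have U_open: "open U" if "(U, \<tau>) \<in> L" for U \<tau>
    using L that unfolding holo_line_bundle_def by blast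
  have smooth: "smooth_on (cmap c ` (cdom c \<inter> U)) (\<lambda>x. ln (g (unit_section pr (U, \<tau>) (cinv c x))))"
    if "hermitian_metric M pr L g" "(U, \<tau>) \<in> L" "c \<in> M" for g U \<tau> c
  proof -
    have g: "smooth_fun_on M U (\<lambda>p. g (unit_section pr (U, \<tau>) p))" "\<And>p. p \<in> U \<Longrightarrow> g (unit_section pr (U, \<tau>) p) > 0"
      using metric_smooth[OF that(1,2)] metric_pos[OF that(1,2)] by auto
    show ?thesis
      by (rule smooth_on_ln_compose[OF open_cmap_image[OF that(3) U_open[OF that(2)]]])
        (use g that(3) in \<open>auto simp: smooth_fun_on_def cinv_cmap\<close>)
  qed
  have phi_smooth: "smooth_fun_on M UNIV \<phi>"
  proof (rule smooth_fun_onI)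
    fix p
    obtain U \<tau> where U: "(U, \<tau>) \<in> L" "p \<in> U" using cover by blast
    obtain c where c: "c \<in> M" "p \<in> cdom c" by (rule charts_cover)
    have op: "open (cmap c ` (cdom c \<inter> U))" by (rule open_cmap_image[OF c(1) U_open[OF U(1)]])
    have "smooth_on (cmap c ` (cdom c \<inter> U)) (\<lambda>x. \<phi> (cinv c x))"
      by (rule smooth_on_cong[OF op _ smooth_on_diff[OF op smooth[OF h(1) U(1) c(1)] smooth[OF h'(1) U(1) c(1)]]])
        (use c in \<open>auto simp: phi[OF U(1)] cinv_cmap\<close>)
    then show "\<exists>c W. c \<in> M \<and> open W \<and> p \<in> W \<and> p \<in> cdom c \<and> smooth_on (cmap c ` (cdom c \<inter> W)) (\<lambda>x. \<phi> (cinv c x))"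
      using U c U_open by blast
  qed
  let ?\<xi> = "form_scale (1 / (4 * pi)) (dc_form \<phi>)"
  have xi: "smooth_form M 1 ?\<xi>" by (rule smooth_form_scale[OF smooth_form_dc[OF phi_smooth]])
  have "form_diff F F' c x vs = ext_d ?\<xi> c x vs" if c: "c \<in> M" and x: "x \<in> cran c" and vs: "length vs = 2" for c x vs
  proof -
    obtain v w where vw: "vs = [v, w]" using vs by (auto simp: numeral_2_eq_2 length_Suc_conv)
    obtain U \<tau> where U: "(U, \<tau>) \<in> L" "cinv c x \<in> U" using cover by blast
    let ?S = "cmap c ` (cdom c \<inter> U)"
    have S: "open ?S" "x \<in> ?S"
      using open_cmap_image[OF c U_open[OF U(1)]] x U(2) c by (auto simp: cmap_image_eq)
    let ?u = "\<lambda>g y. ln (g (unit_section pr (U, \<tau>) (cinv c y)))"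
    have F: "F c x [v, w] = (D2 (?u h) x v (\<i> *s w) - D2 (?u h) x w (\<i> *s v)) / (4 * pi)"
      by (rule chern_form_local[OF S smooth[OF h(1) U(1) c]])
        (use h(2) U(1) c S(2) in \<open>auto simp: chern_form_def\<close>)
    have F': "F' c x [v, w] = (D2 (?u h') x v (\<i> *s w) - D2 (?u h') x w (\<i> *s v)) / (4 * pi)"
      by (rule chern_form_local[OF S smooth[OF h'(1) U(1) c]])
        (use h'(2) U(1) c S(2) in \<open>auto simp: chern_form_def\<close>)
    have D: "D2 (\<lambda>y. \<phi> (cinv c y)) x a b = D2 (?u h) x a b - D2 (?u h') x a b" for a b
      by (rule D2_diff[OF S smooth[OF h(1) U(1) c] smooth[OF h'(1) U(1) c]])
        (use c in \<open>auto simp: phi[OF U(1)] cinv_cmap\<close>)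
    have E: "ext_d ?\<xi> c x [v, w] = 1 / (4 * pi) * ext_d (dc_form \<phi>) c x [v, w]"
      by (rule ext_d_scale[OF smooth_form_dc[OF phi_smooth] c x]) simp
    show ?thesis unfolding vw form_diff_def F F' E ext_d_dc_form D by (simp add: field_simps)
  qed
  then have "form_eq M 2 (form_diff F F') (ext_d ?\<xi>)" by (simp add: form_eq_def)
  then show ?thesis using xi by (auto simp: exact_form_def numeral_2_eq_2)
qed

lemma c1_cohomologous:
  assumes L: "holo_line_bundle M pr L" and "\<alpha> \<in> c1 M pr L" "\<beta> \<in> c1 M pr L"
  shows "cohomologous 2 \<beta> \<alpha>"
proof -
  from assms(2) obtain h F where h: "hermitian_metric M pr L h" "chern_form M pr L h F" "\<alpha> \<in> dR_class M 2 F"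
    by (auto simp: c1_def)
  from assms(3) obtain h' F' where h': "hermitian_metric M pr L h'" "chern_form M pr L h' F'" "\<beta> \<in> dR_class M 2 F'"
    by (auto simp: c1_def)
  have "exact_form M 2 (form_diff \<beta> F')" "exact_form M 2 (form_diff \<alpha> F)"
    using h(3) h'(3) by (auto simp: dR_class_def)
  from exact_form_diff[OF exact_form_diff[OF this] exact_chern_form_diff[OF L h(1,2) h'(1,2)]]
  have "exact_form M 2 (form_diff \<beta> \<alpha>)"
    by (rule exact_form_cong[rotated]) (simp add: form_eq_def form_diff_def)
  then show ?thesis using h(3) h'(3) by (auto simp: cohomologous_def dR_class_def)
qed

end

section \<open>Chern numbers and the inequality\<close>

context compact_complex_manifold
begin

lemma form_integral_cohomologous:
  assumes Om: "smooth_form M (2 * CARD('n)) \<Omega>" "\<And>c x. c \<in> M \<Longrightarrow> x \<in> cran c \<Longrightarrow> \<Omega> c x oriented_basis > 0"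
    and "cohomologous (2 * CARD('n)) \<alpha> \<beta>"
  shows "form_integral M \<alpha> = form_integral M \<beta>"
proof -
  have ab: "smooth_form M (2 * CARD('n)) \<alpha>" "smooth_form M (2 * CARD('n)) \<beta>" "exact_form M (2 * CARD('n)) (form_diff \<alpha> \<beta>)"
    using assms(3) by (auto simp: cohomologous_def closed_form_def)
  then show ?thesis
    using Stokes[OF Om smooth_form_diff[OF ab(1,2)] ab(3)] form_integral_diff[OF ab(1,2)] by simp
qed

lemma form_integral_cong_basis:
  assumes "\<And>c x. c \<in> M \<Longrightarrow> x \<in> cran c \<Longrightarrow> \<alpha> c x oriented_basis = \<beta> c x oriented_basis"
  shows "form_integral M \<alpha> = form_integral M \<beta>"
  unfolding form_integral_pou by (intro sum.cong refl integral_cong) (simp add: assms pou_chart)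

text \<open>A Chern number involves choices of a metric, of a Chern form and of representatives for
  each class and product. All outcomes are cohomologous to the form built from \<alpha>, which is
  itself among them, so the set of integrals is a singleton and the definite description
  evaluates.\<close>

lemma ch_number_eq:
  assumes Om: "smooth_form M (2 * CARD('n)) \<Omega>" "\<And>c x. c \<in> M \<Longrightarrow> x \<in> cran c \<Longrightarrow> \<Omega> c x oriented_basis > 0"
    and L: "holo_line_bundle M pr L" and alpha: "\<alpha> \<in> c1 M pr L" and w: "closed_form M 2 \<omega>" and k: "k \<le> CARD('n)"
  shows "ch_number M \<omega> pr L k = form_integral M (wedge (2 * k) (2 * (CARD('n) - k))
    (form_scale (1 / fact k) (form_power \<alpha> k)) (form_power \<omega> (CARD('n) - k)))"
proof -
  let ?m = "CARD('n) - k"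
  let ?a = "\<lambda>\<beta>. form_scale (1 / fact k) (form_power \<beta> k)" and ?b = "form_power \<omega> ?m"
  let ?C = "cup M (2 * k) (2 * ?m) (ch M pr L k) (dR_class M (2 * ?m) ?b)"
  have deg: "2 * k + 2 * ?m = 2 * CARD('n)" using k by simp
  have ca: "closed_form M (2 * k) (?a \<beta>)" if "closed_form M 2 \<beta>" for \<beta>
    by (intro closed_form_scale closed_form_power that)
  have cb: "closed_form M (2 * ?m) ?b" by (rule closed_form_power[OF w])
  have c1: "cohomologous 2 \<beta> \<alpha>" if "\<beta> \<in> c1 M pr L" for \<beta> by (rule c1_cohomologous[OF L alpha that])
  then have closed_alpha: "closed_form M 2 \<alpha>" using alpha by (auto simp: cohomologous_def)
  let ?\<tau> = "wedge (2 * k) (2 * ?m) (?a \<alpha>) ?b"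
  have int_eq: "form_integral M \<eta> = form_integral M ?\<tau>" if eta: "\<eta> \<in> ?C" for \<eta>
  proof -
    from eta obtain a b where a: "a \<in> ch M pr L k" and b: "b \<in> dR_class M (2 * ?m) ?b"
      and ab: "\<eta> \<in> dR_class M (2 * k + 2 * ?m) (wedge (2 * k) (2 * ?m) a b)"
      unfolding cup_def by blast
    from a obtain \<beta> where beta: "\<beta> \<in> c1 M pr L" "a \<in> dR_class M (2 * k) (?a \<beta>)"
      unfolding ch_def by blast
    have "closed_form M 2 \<beta>" using c1[OF beta(1)] by (simp add: cohomologous_def)
    then have "cohomologous (2 * k) a (?a \<beta>)" using beta(2) by (simp only: dR_class_iff[OF ca])
    moreover have "cohomologous (2 * k) (?a \<beta>) (?a \<alpha>)"
      by (intro cohomologous_scale cohomologous_power c1 beta)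
    ultimately have a': "cohomologous (2 * k) a (?a \<alpha>)" by (rule cohomologous_trans)
    have b': "cohomologous (2 * ?m) b ?b" using b by (simp only: dR_class_iff[OF cb])
    have "closed_form M (2 * k) a" "closed_form M (2 * ?m) b"
      using a' b' by (auto simp: cohomologous_def)
    from closed_form_wedge[OF this] ab
    have "cohomologous (2 * k + 2 * ?m) \<eta> (wedge (2 * k) (2 * ?m) a b)" by (simp only: dR_class_iff)
    from cohomologous_trans[OF this cohomologous_wedge[OF a' b']]
    have coh: "cohomologous (2 * CARD('n)) \<eta> ?\<tau>" unfolding deg .
    show ?thesis by (rule form_integral_cohomologous[OF Om coh])
  qed
  have mem: "?\<tau> \<in> ?C"
  proof -
    have "?a \<alpha> \<in> dR_class M (2 * k) (?a \<alpha>)" "?b \<in> dR_class M (2 * ?m) ?b"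
      "?\<tau> \<in> dR_class M (2 * k + 2 * ?m) ?\<tau>"
      using ca[OF closed_alpha] cb closed_form_wedge[OF ca[OF closed_alpha] cb]
      by (simp_all only: dR_class_iff cohomologous_refl)
    then show ?thesis using alpha unfolding cup_def ch_def by blast
  qed
  have "form_integral M ` ?C = {form_integral M ?\<tau>}"
  proof
    show "form_integral M ` ?C \<subseteq> {form_integral M ?\<tau>}"
      by (rule image_subsetI) (simp only: int_eq singleton_iff)
    show "{form_integral M ?\<tau>} \<subseteq> form_integral M ` ?C"
      using imageI[OF mem, of "form_integral M"] by (simp only: insert_subset empty_subsetI simp_thms)
  qed
  then have "(THE r. r \<in> form_integral M ` ?C) = form_integral M ?\<tau>"
    by (simp only: singleton_iff the_eq_trivial)
  then show ?thesis unfolding ch_number_def class_integral_def Let_def .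
qed

text \<open>\<open>form_power\<close> ends in a wedge with the constant form 1, so its first power
  agrees with \<alpha> on lists of length 2 but is not the same function on lists.\<close>

lemma form_power_1: "alternating 2 (\<alpha> c x) \<Longrightarrow> length vs = 2 \<Longrightarrow> form_power \<alpha> 1 c x vs = \<alpha> c x vs"
  by (simp add: wedge_eq_cwedge cwedge_0_right form_one_def)

lemma form_power_2:
  assumes "alternating 2 (\<alpha> c x)"
  shows "form_power \<alpha> 2 c x = cwedge 2 2 (\<alpha> c x) (\<alpha> c x)"
proof -
  have "form_power \<alpha> (Suc 1) c x = cwedge 2 (2 * 1) (\<alpha> c x) (form_power \<alpha> 1 c x)"
    by (simp only: form_power.simps(2) wedge_eq_cwedge)
  also have "\<dots> = cwedge 2 (2 * 1) (\<alpha> c x) (\<alpha> c x)"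
    by (rule cwedge_cong) (simp_all only: mult_1_right form_power_1[of \<alpha> c x, OF assms])
  finally show ?thesis by (simp only: Suc_1 mult_1_right)
qed

lemma form_power_3: "alternating 2 (\<alpha> c x) \<Longrightarrow> form_power \<alpha> 3 c x = cwedge 2 4 (\<alpha> c x) (cwedge 2 2 (\<alpha> c x) (\<alpha> c x))"
proof -
  assume a: "alternating 2 (\<alpha> c x)"
  have "form_power \<alpha> (Suc 2) c x = cwedge 2 (2 * 2) (\<alpha> c x) (form_power \<alpha> 2 c x)"
    by (simp only: form_power.simps wedge_eq_cwedge)
  then show ?thesis by (simp add: form_power_2[of \<alpha> c x, OF a])
qed

end

theorem proposition3p3:
  fixes M :: "('a::t2_space, 3) chart set"
    and \<omega> \<alpha> :: "('a, 3) form"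
    and pr :: "'e \<Rightarrow> 'a"
    and L :: "('e, 'a) trivialization set"
    and \<theta> :: real
  assumes "compact (UNIV :: 'a set)"
    and "complex_atlas M"
    and "kaehler_form M \<omega>"
    and "holo_line_bundle M pr L"
    and "closed_form M 2 \<alpha>"
    and "type_11 M \<alpha>"
    and "\<alpha> \<in> c1 M pr L"
    and "\<theta> \<in> {pi / 2 <..< 3 * pi / 2}"
    and "\<forall>c\<in>M. \<forall>x\<in>cran c. Theta (\<omega> c x) (\<alpha> c x) = \<theta>"
  shows "form_integral M (form_power \<omega> 3) * ch_number M \<omega> pr L 3
           < 3 * ch_number M \<omega> pr L 2 * ch_number M \<omega> pr L 1
         \<and> (\<forall>t\<in>{1..}. gamma_curve M \<omega> pr L t \<noteq> 0)"
proof -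
  interpret compact_complex_manifold M by unfold_locales (rule assms)+
  have th: "pi / 2 < \<theta>" "\<theta> < 3 * pi / 2" using assms(8) by auto
  have w: "closed_form M 2 \<omega>" "type_11 M \<omega>"
    and w_pos: "\<And>c x v. c \<in> M \<Longrightarrow> x \<in> cran c \<Longrightarrow> v \<noteq> 0 \<Longrightarrow> \<omega> c x [v, \<i> *s v] > 0"
    using assms(3) by (auto simp: kaehler_form_def)
  have alt_w: "alternating 2 (\<omega> c x)" and alt_a: "alternating 2 (\<alpha> c x)" if "c \<in> M" "x \<in> cran c" for c x
    using w(1) assms(5) that by (auto simp: closed_form_def intro: smooth_form_alternating)
  let ?B = "oriented_basis :: (complex^3) list"
  \<comment> \<open>The representative of the k-th Chern number built from \<alpha>, in the shape
    given by \<open>ch_number_eq\<close>.\<close>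
  define \<tau> where "\<tau> k = wedge (2 * k) (2 * (3 - k)) (form_scale (1 / fact k) (form_power \<alpha> k)) (form_power \<omega> (3 - k))" for k
  have B: "length ?B = 6" by (simp add: oriented_basis)
  have tau_smooth: "smooth_form M (2 * CARD(3)) (\<tau> k)" if "k \<le> 3" for k
  proof -
    have "closed_form M (2 * k + 2 * (3 - k)) (\<tau> k)"
      unfolding \<tau>_def by (intro closed_form_wedge closed_form_scale closed_form_power assms w)
    moreover have "2 * k + 2 * (3 - k) = 2 * CARD(3)" using that by simp
    ultimately show ?thesis by (simp only: closed_form_def)
  qed
  \<comment> \<open>The factors 2 and 6 clear the factorials of \<open>ch\<close> in degrees 2 and
    3.\<close>
  have tau_values:
    "\<tau> 0 c x ?B = cwedge 2 4 (\<omega> c x) (cwedge 2 2 (\<omega> c x) (\<omega> c x)) ?B" (is ?t0)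
    "\<tau> 1 c x ?B = cwedge 2 4 (\<alpha> c x) (cwedge 2 2 (\<omega> c x) (\<omega> c x)) ?B" (is ?t1)
    "2 * \<tau> 2 c x ?B = cwedge 2 4 (\<omega> c x) (cwedge 2 2 (\<alpha> c x) (\<alpha> c x)) ?B" (is ?t2)
    "6 * \<tau> 3 c x ?B = cwedge 2 4 (\<alpha> c x) (cwedge 2 2 (\<alpha> c x) (\<alpha> c x)) ?B" (is ?t3)
    if c: "c \<in> M" "x \<in> cran c" for c x
  proof -
    note W = alt_w[OF c] and A = alt_a[OF c]
    have W6: "alternating 6 (form_power \<omega> 3 c x)" and A6: "alternating 6 (form_power \<alpha> 3 c x)"
      using closed_form_power[OF w(1), of 3] closed_form_power[OF assms(5), of 3] c
      by (auto simp: closed_form_def intro: smooth_form_alternating)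
    show ?t0
      unfolding \<tau>_def wedge_eq_cwedge using W6 B
      by (simp add: cwedge_0_left form_scale_def form_one_def form_power_3[of \<omega> c x, OF W])
    have "cwedge 2 4 (form_scale 1 (form_power \<alpha> 1) c x) (form_power \<omega> 2 c x) =
        cwedge 2 4 (\<alpha> c x) (cwedge 2 2 (\<omega> c x) (\<omega> c x))"
      by (rule cwedge_cong) (simp_all only: form_scale_def mult_1_left form_power_1[of \<alpha> c x, OF A] form_power_2[of \<omega> c x, OF W])
    then show ?t1 unfolding \<tau>_def wedge_eq_cwedge by simp
    \<comment> \<open>Here the square of \<alpha> stands on the left; the pointwise lemma has the
      single factor first, and forms of even degree commute.\<close>
    have "cwedge 4 2 (form_scale (1 / 2) (form_power \<alpha> 2) c x) (form_power \<omega> 1 c x) =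
        cwedge 4 2 (\<lambda>vs. 1 / 2 * cwedge 2 2 (\<alpha> c x) (\<alpha> c x) vs) (\<omega> c x)"
      by (rule cwedge_cong) (simp_all only: form_scale_def form_power_1[of \<omega> c x, OF W] form_power_2[of \<alpha> c x, OF A])
    then have "cwedge 4 2 (form_scale (1 / 2) (form_power \<alpha> 2) c x) (form_power \<omega> 1 c x) ?B =
        1 / 2 * cwedge 2 4 (\<omega> c x) (cwedge 2 2 (\<alpha> c x) (\<alpha> c x)) ?B"
      using cwedge_commute_even[of 2 ?B 4 "\<omega> c x" "cwedge 2 2 (\<alpha> c x) (\<alpha> c x)"] B
      by (simp only: cwedge_cmult_left) simp
    then show ?t2 unfolding \<tau>_def wedge_eq_cwedge by (simp add: fact_numeral)
    have "cwedge 6 0 (form_scale (1 / 6) (form_power \<alpha> 3) c x) (form_power \<omega> 0 c x) ?B = 1 / 6 * form_power \<alpha> 3 c x ?B"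
      using cwedge_0_right[of 6 "form_scale (1 / 6) (form_power \<alpha> 3) c x" ?B "form_power \<omega> 0 c x"]
        alternating_cmult[OF A6, of "1 / 6"] B by (simp add: form_scale_def form_one_def)
    then show ?t3 unfolding \<tau>_def wedge_eq_cwedge by (simp add: fact_numeral form_power_3[of \<alpha> c x, OF A])
  qed
  have pointwise: "\<tau> 0 c x ?B > 0" "\<tau> 0 c x ?B < 6 * \<tau> 2 c x ?B"
      "3 * \<tau> 1 c x ?B * cos \<theta> < \<tau> 0 c x ?B * sin \<theta>"
      "(3 * \<tau> 1 c x ?B - 6 * \<tau> 3 c x ?B) * cos \<theta> = (\<tau> 0 c x ?B - 6 * \<tau> 2 c x ?B) * sin \<theta>"
    if c: "c \<in> M" "x \<in> cran c" for c x
  proof -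
    obtain G A where "has_coeffs (\<omega> c x) G" "has_coeffs (\<alpha> c x) A"
      using w(2) assms(6) c unfolding type_11_def by blast
    note facts = dHYM_pointwise[OF alt_w[OF c] this(1) alt_a[OF c] this(2) w_pos[OF c] _ th]
    have "Theta (\<omega> c x) (\<alpha> c x) = \<theta>" using assms(9) c by blast
    note facts = facts[OF _ this, folded tau_values[OF c]]
    show "\<tau> 0 c x ?B > 0" "\<tau> 0 c x ?B < 6 * \<tau> 2 c x ?B"
      "3 * \<tau> 1 c x ?B * cos \<theta> < \<tau> 0 c x ?B * sin \<theta>"
      "(3 * \<tau> 1 c x ?B - 6 * \<tau> 3 c x ?B) * cos \<theta> = (\<tau> 0 c x ?B - 6 * \<tau> 2 c x ?B) * sin \<theta>"
      using facts by simp_all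
  qed
  \<comment> \<open>In terms of the averages: \<open>3 * J 1\<close>, \<open>6 * J 2\<close> and
    \<open>6 * J 3\<close> are \<open>s\<^sub>1\<close>, \<open>s\<^sub>2\<close> and
    \<open>s\<^sub>3\<close> times \<open>J 0\<close>. All constants below come from this.\<close>
  define J where "J k = form_integral M (\<tau> k)" for k
  have lin: "form_integral M (form_diff (form_scale r (\<tau> i)) (form_scale s (\<tau> j))) = r * J i - s * J j"
    "smooth_form M (2 * CARD(3)) (form_diff (form_scale r (\<tau> i)) (form_scale s (\<tau> j)))"
    if "i \<le> 3" "j \<le> 3" for r s i j
    using form_integral_diff[OF smooth_form_scale[OF tau_smooth[OF that(1)]] smooth_form_scale[OF tau_smooth[OF that(2)]]]
      smooth_form_diff[OF smooth_form_scale[OF tau_smooth[OF that(1)]] smooth_form_scale[OF tau_smooth[OF that(2)]]]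
    by (simp_all add: form_integral_scale J_def)
  \<comment> \<open>Strictness survives integration because the difference of the two sides is
    itself a smooth top form that is positive everywhere.\<close>
  have "form_integral M (form_diff (form_scale 6 (\<tau> 2)) (form_scale 1 (\<tau> 0))) > 0"
    by (rule form_integral_pos[OF lin(2)]) (use pointwise(2) in \<open>auto simp: form_diff_def form_scale_def\<close>)
  then have J2: "6 * J 2 - J 0 > 0" by (simp add: lin(1))
  have "form_integral M (form_diff (form_scale (sin \<theta>) (\<tau> 0)) (form_scale (3 * cos \<theta>) (\<tau> 1))) > 0"
    by (rule form_integral_pos[OF lin(2)]) (use pointwise(3) in \<open>auto simp: form_diff_def form_scale_def mult_ac\<close>)
  then have J1: "J 0 * sin \<theta> - 3 * J 1 * cos \<theta> > 0" by (simp add: lin(1) mult_ac)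
  have "form_integral M (form_diff (form_scale (3 * cos \<theta>) (\<tau> 1)) (form_scale (6 * cos \<theta>) (\<tau> 3))) =
      form_integral M (form_diff (form_scale (sin \<theta>) (\<tau> 0)) (form_scale (6 * sin \<theta>) (\<tau> 2)))"
    by (rule form_integral_cong_basis)
      (use pointwise(4) in \<open>simp add: form_diff_def form_scale_def algebra_simps\<close>)
  then have J3: "6 * J 3 * cos \<theta> = 3 * J 1 * cos \<theta> + (6 * J 2 - J 0) * sin \<theta>"
    by (simp add: lin(1) algebra_simps)
  have ineq: "J 0 * J 3 < 3 * J 2 * J 1"
  proof -
    \<comment> \<open>The splitting isolates the positive factor \<open>6 * J 2 - J 0\<close>, by
      which the inequality \<open>J1\<close> may be multiplied. \<open>J 3\<close> is controlled
      only together with \<open>cos \<theta>\<close>, so the negative cosine is divided out last and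
      reverses the inequality.\<close>
    have "18 * J 2 * J 1 * cos \<theta> = 3 * J 0 * J 1 * cos \<theta> + (6 * J 2 - J 0) * (3 * J 1 * cos \<theta>)"
      by (simp add: algebra_simps)
    also have "\<dots> < 3 * J 0 * J 1 * cos \<theta> + (6 * J 2 - J 0) * (J 0 * sin \<theta>)"
      using J1 J2 by (intro add_strict_left_mono mult_strict_left_mono) auto
    also have "\<dots> = J 0 * (6 * J 3 * cos \<theta>)" unfolding J3 by (simp add: algebra_simps)
    finally have "(18 * J 2 * J 1 - 6 * J 0 * J 3) * cos \<theta> < 0" by (simp add: algebra_simps)
    then show ?thesis using cos_negative[OF th] by (simp add: mult_less_0_iff mult_ac)
  qed
  \<comment> \<open>\<open>\<tau> 0\<close>, which represents \<omega>^3, serves as the positive top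
    form that orients the atlas.\<close>
  have ch: "ch_number M \<omega> pr L k = J k" if "k \<le> 3" for k
    unfolding J_def \<tau>_def
    using ch_number_eq[OF tau_smooth[of 0] pointwise(1) assms(4,7) w(1), of k] that by simp
  have "form_integral M (form_power \<omega> 3) = J 0"
    unfolding J_def
    by (rule form_integral_cong_basis) (simp add: tau_values(1) form_power_3 alt_w)
  moreover have "gamma_curve M \<omega> pr L t \<noteq> 0" if "t \<in> {1..}" for t
  proof
    assume "gamma_curve M \<omega> pr L t = 0"
    \<comment> \<open>Odd degrees k = 1, 3 carry an even power of -t\<i> and give the real part; k =
      0, 2 give the imaginary part.\<close>
    moreover have "gamma_curve M \<omega> pr L t = Complex (t\<^sup>2 * J 1 / 2 - J 3) (t * J 2 - t ^ 3 * J 0 / 6)"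
      unfolding gamma_curve_def
      by (simp add: ch complex_eq_iff eval_nat_numeral fact_numeral field_simps)
    ultimately have "t\<^sup>2 * J 1 / 2 = J 3" "t * J 2 = t ^ 3 * J 0 / 6"
      by (simp_all add: complex_eq_iff)
    moreover have "t > 0" using that by simp
    ultimately have J20: "t\<^sup>2 * J 0 = 6 * J 2" by (simp add: power2_eq_square power3_eq_cube)
    have "J 0 * J 3 = J 1 * (t\<^sup>2 * J 0) / 2" unfolding \<open>t\<^sup>2 * J 1 / 2 = J 3\<close>[symmetric] by simp
    also have "\<dots> = 3 * J 2 * J 1" unfolding J20 by simp
    finally have "J 0 * J 3 = 3 * J 2 * J 1" .
    with ineq show False by simp
  qed
  ultimately show ?thesis using ineq by (simp add: ch)
qed

end
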